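(* Let $G\curvearrowright(X,\mu)$ be a p.m.p. ergodic action and let $H<G$ be a strong relative ICC group, i.e. $\#\{hgh^{-1}:h\in H\}=\infty$ for all $g\neq e$ in $G$. Assume that $H$ acts on $X$ trivially. Then every intermediate von Neumann subalgebra $\mathsf{P}$ between $L(G)$ and $L^\infty(X)\rtimes G$ is of the form $\mathsf{P}=L^\infty(Y)\rtimes G$ for some $G$-factor $Y$ of $X$.
   Context: All groups are discrete and countable; p.m.p. means probability measure preserving; $L(G)$ is the group von Neumann algebra, viewed inside the crossed product $L^\infty(X)\rtimes G$. Inclusions of von Neumann algebras are unital. A $G$-factor $Y$ of $X$ is a quotient of the p.m.p. action $G\curvearrowright X$, with $L^\infty(Y)$ identified with the corresponding $G$-invariant von Neumann subalgebra of $L^\infty(X)$. *)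

theory Defs
  imports "HOL-Probability.Probability" "HOL-Algebra.Group_Action"
begin

section \<open>The Hilbert space \<open>L\<^sup>2(N)\<close> of complex functions on a measure space\<close>

text \<open>
  Vectors are classes of square-integrable functions modulo equality almost everywhere, following
  the idiom of \<open>HOL.Equiv_Relations\<close>: an operation on classes is the union (or the unique value) of
  the results on all representatives.
\<close>

definition l2_fun :: "'a measure \<Rightarrow> ('a \<Rightarrow> complex) set" where
  "l2_fun N = {f \<in> borel_measurable N. integrable N (\<lambda>z. (cmod (f z))\<^sup>2)}"

definition l2_rel :: "'a measure \<Rightarrow> (('a \<Rightarrow> complex) \<times> ('a \<Rightarrow> complex)) set" where
  "l2_rel N = {(f, g). f \<in> l2_fun N \<and> g \<in> l2_fun N \<and> (AE z in N. f z = g z)}"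

definition L2 :: "'a measure \<Rightarrow> ('a \<Rightarrow> complex) set set" where
  "L2 N = l2_fun N // l2_rel N"

definition l2_add ::
  "'a measure \<Rightarrow> ('a \<Rightarrow> complex) set \<Rightarrow> ('a \<Rightarrow> complex) set \<Rightarrow> ('a \<Rightarrow> complex) set" where
  "l2_add N c d = (\<Union>f\<in>c. \<Union>g\<in>d. l2_rel N `` {\<lambda>z. f z + g z})"

definition l2_scale ::
  "'a measure \<Rightarrow> complex \<Rightarrow> ('a \<Rightarrow> complex) set \<Rightarrow> ('a \<Rightarrow> complex) set" where
  "l2_scale N a c = (\<Union>f\<in>c. l2_rel N `` {\<lambda>z. a * f z})"

definition l2_inner ::
  "'a measure \<Rightarrow> ('a \<Rightarrow> complex) set \<Rightarrow> ('a \<Rightarrow> complex) set \<Rightarrow> complex" where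
  "l2_inner N c d = the_elem (\<Union>f\<in>c. \<Union>g\<in>d. {\<integral>z. f z * cnj (g z) \<partial>N})"

definition l2_norm :: "'a measure \<Rightarrow> ('a \<Rightarrow> complex) set \<Rightarrow> real" where
  "l2_norm N c = sqrt (Re (l2_inner N c c))"


section \<open>Bounded operators and von Neumann algebras on \<open>L\<^sup>2(N)\<close>\<close>

type_synonym 'a l2_op = "('a \<Rightarrow> complex) set \<Rightarrow> ('a \<Rightarrow> complex) set"

text \<open>
  Operators are extensional, i.e. \<open>undefined\<close> outside \<open>L2 N\<close>, so that HOL equality
  is equality of operators.
\<close>

definition bounded_ops :: "'a measure \<Rightarrow> 'a l2_op set" where
  "bounded_ops N = {T \<in> L2 N \<rightarrow>\<^sub>E L2 N.
     (\<forall>c\<in>L2 N. \<forall>d\<in>L2 N. T (l2_add N c d) = l2_add N (T c) (T d)) \<and>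
     (\<forall>a. \<forall>c\<in>L2 N. T (l2_scale N a c) = l2_scale N a (T c)) \<and>
     (\<exists>K. \<forall>c\<in>L2 N. l2_norm N (T c) \<le> K * l2_norm N c)}"

definition adjoint_ops :: "'a measure \<Rightarrow> 'a l2_op \<Rightarrow> 'a l2_op \<Rightarrow> bool" where
  "adjoint_ops N T S \<longleftrightarrow> (\<forall>c\<in>L2 N. \<forall>d\<in>L2 N. l2_inner N (T c) d = l2_inner N c (S d))"

definition commutant :: "'a measure \<Rightarrow> 'a l2_op set \<Rightarrow> 'a l2_op set" where
  "commutant N P =
     {T \<in> bounded_ops N. \<forall>S\<in>P. compose (L2 N) T S = compose (L2 N) S T}"

text \<open>
  A von Neumann algebra is a self-adjoint set of bounded operators equal to its bicommutant.
  Being a commutant, such a set is automatically a subalgebra containing the identity of \<open>L2 N\<close>.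
\<close>

definition von_neumann_algebra :: "'a measure \<Rightarrow> 'a l2_op set \<Rightarrow> bool" where
  "von_neumann_algebra N P \<longleftrightarrow>
     P \<subseteq> bounded_ops N \<and>
     (\<forall>T\<in>P. \<exists>S\<in>P. adjoint_ops N T S) \<and>
     commutant N (commutant N P) = P"

definition vn_generated :: "'a measure \<Rightarrow> 'a l2_op set \<Rightarrow> 'a l2_op set" where
  "vn_generated N S = \<Inter>{P. von_neumann_algebra N P \<and> S \<subseteq> P}"


section \<open>Probability measure preserving actions and their factors\<close>

definition pmp_action ::
  "('g, 'b) monoid_scheme \<Rightarrow> 'x measure \<Rightarrow> ('g \<Rightarrow> 'x \<Rightarrow> 'x) \<Rightarrow> bool" where
  "pmp_action G M \<alpha> \<longleftrightarrow>
     prob_space M \<and> group_action G (space M) \<alpha> \<and>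
     (\<forall>g\<in>carrier G. \<alpha> g \<in> measurable M M \<and> distr M M (\<alpha> g) = M)"

definition ergodic_action ::
  "('g, 'b) monoid_scheme \<Rightarrow> 'x measure \<Rightarrow> ('g \<Rightarrow> 'x \<Rightarrow> 'x) \<Rightarrow> bool" where
  "ergodic_action G M \<alpha> \<longleftrightarrow>
     (\<forall>A\<in>sets M. (\<forall>g\<in>carrier G. \<alpha> g -` A \<inter> space M = A) \<longrightarrow>
        measure M A = 0 \<or> measure M A = 1)"

definition pmp_factor ::
  "('g, 'b) monoid_scheme \<Rightarrow> 'x measure \<Rightarrow> ('g \<Rightarrow> 'x \<Rightarrow> 'x) \<Rightarrow>
     'y measure \<Rightarrow> ('g \<Rightarrow> 'y \<Rightarrow> 'y) \<Rightarrow> ('x \<Rightarrow> 'y) \<Rightarrow> bool" where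
  "pmp_factor G M \<alpha> Y \<beta> \<pi> \<longleftrightarrow>
     pmp_action G Y \<beta> \<and> \<pi> \<in> measurable M Y \<and> distr M Y \<pi> = Y \<and>
     (\<forall>g\<in>carrier G. AE x in M. \<pi> (\<alpha> g x) = \<beta> g (\<pi> x))"

definition strong_relative_icc :: "('g, 'b) monoid_scheme \<Rightarrow> 'g set \<Rightarrow> bool" where
  "strong_relative_icc G H \<longleftrightarrow>
     (\<forall>g\<in>carrier G. g \<noteq> \<one>\<^bsub>G\<^esub> \<longrightarrow> infinite {h \<otimes>\<^bsub>G\<^esub> g \<otimes>\<^bsub>G\<^esub> inv\<^bsub>G\<^esub> h | h. h \<in> H})"


section \<open>Crossed products\<close>

definition Linf :: "'x measure \<Rightarrow> ('x \<Rightarrow> complex) set" where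
  "Linf M = {f \<in> borel_measurable M. \<exists>K. AE x in M. cmod (f x) \<le> K}"

text \<open>The crossed product acts on \<open>L\<^sup>2(X) \<otimes> \<ell>\<^sup>2(G)\<close>, realised as \<open>L\<^sup>2(X \<times> G)\<close>.\<close>

definition cp_space :: "('g, 'b) monoid_scheme \<Rightarrow> 'x measure \<Rightarrow> ('x \<times> 'g) measure" where
  "cp_space G M = M \<Otimes>\<^sub>M count_space (carrier G)"

definition l2_lift :: "'a measure \<Rightarrow> (('a \<Rightarrow> complex) \<Rightarrow> ('a \<Rightarrow> complex)) \<Rightarrow> 'a l2_op" where
  "l2_lift N F = (\<lambda>c\<in>L2 N. \<Union>f\<in>c. l2_rel N `` {F f})"

text \<open>The operator \<open>f \<otimes> 1\<close>.\<close>

definition mult_op ::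
  "('g, 'b) monoid_scheme \<Rightarrow> 'x measure \<Rightarrow> ('x \<Rightarrow> complex) \<Rightarrow> ('x \<times> 'g) l2_op" where
  "mult_op G M f = l2_lift (cp_space G M) (\<lambda>\<xi> (x, s). f x * \<xi> (x, s))"

text \<open>
  The canonical unitary \<open>u\<^sub>g = \<sigma>\<^sub>g \<otimes> \<lambda>\<^sub>g\<close>, where \<open>\<sigma>\<^sub>g\<close> is the Koopman operator \<open>\<xi> \<mapsto> \<xi> \<circ> g\<inverse>\<close> and
  \<open>\<lambda>\<^sub>g\<close> is left translation; thus \<open>u\<^sub>g (f \<otimes> 1) u\<^sub>g\<^sup>* = (f \<circ> g\<inverse>) \<otimes> 1\<close>.
\<close>

definition group_op ::
  "('g, 'b) monoid_scheme \<Rightarrow> 'x measure \<Rightarrow> ('g \<Rightarrow> 'x \<Rightarrow> 'x) \<Rightarrow> 'g \<Rightarrow> ('x \<times> 'g) l2_op" where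
  "group_op G M \<alpha> g =
     l2_lift (cp_space G M) (\<lambda>\<xi> (x, s). \<xi> (\<alpha> (inv\<^bsub>G\<^esub> g) x, inv\<^bsub>G\<^esub> g \<otimes>\<^bsub>G\<^esub> s))"

definition group_vn_algebra ::
  "('g, 'b) monoid_scheme \<Rightarrow> 'x measure \<Rightarrow> ('g \<Rightarrow> 'x \<Rightarrow> 'x) \<Rightarrow> ('x \<times> 'g) l2_op set" where
  "group_vn_algebra G M \<alpha> = vn_generated (cp_space G M) (group_op G M \<alpha> ` carrier G)"

definition crossed_product ::
  "('g, 'b) monoid_scheme \<Rightarrow> 'x measure \<Rightarrow> ('g \<Rightarrow> 'x \<Rightarrow> 'x) \<Rightarrow> ('x \<times> 'g) l2_op set" where
  "crossed_product G M \<alpha> =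
     vn_generated (cp_space G M) (mult_op G M ` Linf M \<union> group_op G M \<alpha> ` carrier G)"

text \<open>
  \<open>L\<^sup>\<infinity>(Y) \<rtimes> G\<close> as a subalgebra of \<open>L\<^sup>\<infinity>(X) \<rtimes> G\<close>, where \<open>L\<^sup>\<infinity>(Y)\<close> is identified with
  \<open>{f \<circ> \<pi> | f \<in> L\<^sup>\<infinity>(Y)} \<subseteq> L\<^sup>\<infinity>(X)\<close> for the factor map \<open>\<pi> : X \<rightarrow> Y\<close>.
\<close>

definition factor_crossed_product ::
  "('g, 'b) monoid_scheme \<Rightarrow> 'x measure \<Rightarrow> ('g \<Rightarrow> 'x \<Rightarrow> 'x) \<Rightarrow>
     'y measure \<Rightarrow> ('x \<Rightarrow> 'y) \<Rightarrow> ('x \<times> 'g) l2_op set" where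
  "factor_crossed_product G M \<alpha> Y \<pi> =
     vn_generated (cp_space G M)
       (mult_op G M ` ((\<lambda>f. f \<circ> \<pi>) ` Linf Y) \<union> group_op G M \<alpha> ` carrier G)"

end

theory Submission
  imports Defs
begin

text \<open>
  Write \<open>\<Omega>\<close> for the vector \<open>1 \<otimes> \<delta>\<^sub>e\<close>. An operator \<open>a\<close> of the crossed product commutes with right
  multiplications, and is determined by \<open>a \<Omega>\<close>, whose component over \<open>g\<close> is the Fourier coefficient
  \<open>f\<^sub>g\<close> of \<open>a = \<Sum> f\<^sub>g u\<^sub>g\<close>. A von Neumann subalgebra contains \<open>a\<close> as soon as it contains operators \<open>q\<^sub>n\<close> with
  \<open>q\<^sub>n \<Omega> \<rightarrow> a \<Omega>\<close> and \<open>q\<^sub>n\<^sup>* \<Omega> \<rightarrow> a\<^sup>* \<Omega>\<close> weakly.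

  Let \<open>a \<in> P\<close>. As \<open>H\<close> acts trivially on \<open>X\<close>, conjugating \<open>a\<close> by \<open>u\<^sub>h\<close> with \<open>h \<in> H\<close> moves \<open>f\<^sub>g\<close> to the position
  \<open>h g h\<inverse>\<close>. Since all \<open>H\<close>-conjugacy classes other than \<open>{e}\<close> are infinite, B. H. Neumann's lemma gives \<open>h\<^sub>n \<in> H\<close>
  that move every finite part of \<open>G - {e}\<close> off itself, so that \<open>u\<^sub>h a u\<^sub>h\<^sup>*\<close> converges to \<open>f\<^sub>e\<close> along \<open>h\<^sub>n\<close> in the above
  sense, whence \<open>f\<^sub>e \<in> P\<close>. The same argument for \<open>a u\<^sub>g\<^sup>*\<close> gives \<open>f\<^sub>g \<in> P\<close> for all \<open>g\<close>. The finite
  Fourier sums of \<open>a\<close> converge to it in the same sense, so \<open>P\<close> is generated by \<open>P \<inter> L\<^sup>\<infinity>(X)\<close> and \<open>G\<close>.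
  Finally \<open>P \<inter> L\<^sup>\<infinity>(X)\<close> consists of the bounded functions measurable for the invariant
  \<open>\<sigma>\<close>-algebra \<open>{A. 1\<^sub>A \<in> P}\<close>, so the factor is \<open>X\<close> itself with this coarser \<open>\<sigma>\<close>-algebra.
\<close>

section \<open>The Hilbert space of square-integrable functions\<close>

text \<open>A von Neumann algebra is given here purely algebraically, as a bicommutant, so the one
  way to show that an operator belongs to \<open>P\<close> is to commute it with all of
  \<open>commutant N P\<close>. Every approximation must therefore be recast as a limit of matrix
  coefficients of commutators. Partial Fourier sums need not be bounded in operator norm, and this
  is why convergence is tested on \<open>\<Omega>\<close> only, for an operator and for its adjoint.
  Adjoints are obtained from the Riesz representation theorem, and that from completeness of L2,
  both proved directly on representatives.

  A Fourier coefficient is a priori only square integrable. Its boundedness comes from comparing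
  \<open>a\<close> with right multiplications by indicator functions, which brings in the operator
  norm of \<open>a\<close>.

  The functions in \<open>P\<close> are handled as a *-algebra closed under bounded almost
  everywhere limits of sequences. Polynomials are thus the only functional calculus at hand, and
  indicators of level sets are reached as limits of iterates of one polynomial.\<close>

lemma borel_measurable_cnj [measurable (raw)]:
  "f \<in> borel_measurable N \<Longrightarrow> (\<lambda>z. cnj (f z)) \<in> borel_measurable N"
  by (intro borel_measurable_continuous_on[of cnj] continuous_intros)

lemma l2_funD:
  assumes "f \<in> l2_fun N"
  shows l2_fun_measurable: "f \<in> borel_measurable N"
    and l2_fun_integrable: "integrable N (\<lambda>z. (cmod (f z))\<^sup>2)"
  using assms by (auto simp: l2_fun_def)

lemma l2_fun_scale:
  assumes "f \<in> l2_fun N"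
  shows "(\<lambda>z. a * f z) \<in> l2_fun N"
  using l2_funD[OF assms] by (auto simp: l2_fun_def norm_mult power_mult_distrib)

lemma l2_fun_zero: "(\<lambda>z. 0) \<in> l2_fun N"
  by (simp add: l2_fun_def)

lemma cmod_add_power2_le: "(cmod (a + b))\<^sup>2 \<le> 2 * (cmod a)\<^sup>2 + 2 * (cmod b)\<^sup>2"
proof -
  have "(cmod (a + b))\<^sup>2 \<le> (cmod a + cmod b)\<^sup>2"
    by (intro power_mono norm_triangle_ineq) auto
  also have "\<dots> \<le> 2 * (cmod a)\<^sup>2 + 2 * (cmod b)\<^sup>2"
    using sum_squares_bound[of "cmod a" "cmod b"] by (simp add: power2_sum)
  finally show ?thesis .
qed

lemma l2_fun_add:
  assumes f: "f \<in> l2_fun N" and g: "g \<in> l2_fun N"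
  shows "(\<lambda>z. f z + g z) \<in> l2_fun N"
proof -
  note [measurable] = l2_fun_measurable[OF f] l2_fun_measurable[OF g]
  have "integrable N (\<lambda>z. 2 * (cmod (f z))\<^sup>2 + 2 * (cmod (g z))\<^sup>2)"
    using f g by (intro Bochner_Integration.integrable_add integrable_mult_right l2_fun_integrable)
  then have "integrable N (\<lambda>z. (cmod (f z + g z))\<^sup>2)"
    by (rule Bochner_Integration.integrable_bound) (auto simp: cmod_add_power2_le)
  then show ?thesis
    by (simp add: l2_fun_def)
qed

lemma l2_fun_diff:
  assumes f: "f \<in> l2_fun N" and g: "g \<in> l2_fun N"
  shows "(\<lambda>z. f z - g z) \<in> l2_fun N"
  using l2_fun_add[OF f l2_fun_scale[OF g, of "-1"]] by simp

lemma l2_fun_cnj: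
  assumes "f \<in> l2_fun N"
  shows "(\<lambda>z. cnj (f z)) \<in> l2_fun N"
  using assms by (auto simp: l2_fun_def intro: borel_measurable_cnj)

lemma l2_fun_bound:
  assumes f: "f \<in> l2_fun N" and [measurable]: "g \<in> borel_measurable N"
    and le: "AE z in N. cmod (g z) \<le> K * cmod (f z)"
  shows "g \<in> l2_fun N"
proof -
  note [measurable] = l2_fun_measurable[OF f]
  have "integrable N (\<lambda>z. K\<^sup>2 * (cmod (f z))\<^sup>2)"
    using f by (intro integrable_mult_right l2_fun_integrable)
  then have "integrable N (\<lambda>z. (cmod (g z))\<^sup>2)"
  proof (rule Bochner_Integration.integrable_bound)
    show "AE z in N. norm ((cmod (g z))\<^sup>2) \<le> norm (K\<^sup>2 * (cmod (f z))\<^sup>2)"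
      using le
    proof eventually_elim
      case (elim z)
      then have "(cmod (g z))\<^sup>2 \<le> (K * cmod (f z))\<^sup>2"
        by (intro power_mono) auto
      then show ?case by (simp add: power_mult_distrib)
    qed
  qed simp
  then show ?thesis by (simp add: l2_fun_def)
qed

lemma integrable_l2_prod:
  assumes f: "f \<in> l2_fun N" and g: "g \<in> l2_fun N"
  shows "integrable N (\<lambda>z. f z * cnj (g z))"
proof -
  note [measurable] = l2_fun_measurable[OF f] l2_fun_measurable[OF g]
  have "integrable N (\<lambda>z. (cmod (f z))\<^sup>2 + (cmod (g z))\<^sup>2)"
    using f g by (intro Bochner_Integration.integrable_add l2_fun_integrable)
  then show ?thesis
  proof (rule Bochner_Integration.integrable_bound)
    have "cmod (f z) * cmod (g z) \<le> (cmod (f z))\<^sup>2 + (cmod (g z))\<^sup>2" for z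
    proof -
      have "0 \<le> cmod (f z) * cmod (g z)" by simp
      then show ?thesis
        using sum_squares_bound[of "cmod (f z)" "cmod (g z)"] by linarith
    qed
    then show "AE z in N. norm (f z * cnj (g z)) \<le> norm ((cmod (f z))\<^sup>2 + (cmod (g z))\<^sup>2)"
      by (simp add: norm_mult)
  qed simp
qed

section \<open>Inner product, squared norm and the Cauchy-Schwarz inequality\<close>

definition ip :: "'a measure \<Rightarrow> ('a \<Rightarrow> complex) \<Rightarrow> ('a \<Rightarrow> complex) \<Rightarrow> complex" where
  "ip N f g = (\<integral>z. f z * cnj (g z) \<partial>N)"

definition sq :: "'a measure \<Rightarrow> ('a \<Rightarrow> complex) \<Rightarrow> real" where
  "sq N f = (\<integral>z. (cmod (f z))\<^sup>2 \<partial>N)"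

lemma ip_add_left:
  assumes "f \<in> l2_fun N" "g \<in> l2_fun N" "h \<in> l2_fun N"
  shows "ip N (\<lambda>z. f z + g z) h = ip N f h + ip N g h"
  using assms by (simp add: ip_def distrib_right integrable_l2_prod)

lemma ip_diff_left:
  assumes "f \<in> l2_fun N" "g \<in> l2_fun N" "h \<in> l2_fun N"
  shows "ip N (\<lambda>z. f z - g z) h = ip N f h - ip N g h"
  using assms by (simp add: ip_def left_diff_distrib integrable_l2_prod)

lemma ip_scale_left: "ip N (\<lambda>z. a * f z) h = a * ip N f h"
  by (simp add: ip_def mult.assoc)

lemma ip_commute: "ip N f g = cnj (ip N g f)"
  unfolding ip_def by (subst Bochner_Integration.integral_cnj[symmetric]) (simp add: mult.commute)

lemma ip_self: "ip N f f = of_real (sq N f)"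
  unfolding ip_def sq_def by (subst integral_complex_of_real[symmetric], intro Bochner_Integration.integral_cong refl)
    (simp only: complex_norm_square)

lemma ip_scale_right: "ip N f (\<lambda>z. a * h z) = cnj a * ip N f h"
  by (subst (1 2) ip_commute) (simp add: ip_scale_left)

lemma ip_add_right:
  assumes "f \<in> l2_fun N" "g \<in> l2_fun N" "h \<in> l2_fun N"
  shows "ip N f (\<lambda>z. g z + h z) = ip N f g + ip N f h"
  by (subst (1 2 3) ip_commute) (simp add: ip_add_left assms)

lemma sq_nonneg: "0 \<le> sq N f"
  by (simp add: sq_def)

lemma sq_scale: "sq N (\<lambda>z. a * f z) = (cmod a)\<^sup>2 * sq N f"
  by (simp add: sq_def norm_mult power_mult_distrib)

lemma sq_add:
  assumes "f \<in> l2_fun N" "g \<in> l2_fun N"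
  shows "sq N (\<lambda>z. f z + g z) = sq N f + sq N g + 2 * Re (ip N f g)"
proof -
  have "complex_of_real (sq N (\<lambda>z. f z + g z)) =
      of_real (sq N f) + of_real (sq N g) + (ip N f g + cnj (ip N f g))"
    using assms unfolding ip_self[symmetric]
    by (simp add: ip_add_left ip_add_right l2_fun_add ip_commute[symmetric])
  also have "\<dots> = of_real (sq N f + sq N g + 2 * Re (ip N f g))"
    by (simp add: complex_add_cnj)
  finally show ?thesis by (simp only: of_real_eq_iff)
qed

lemma sq_parallelogram:
  assumes "f \<in> l2_fun N" "g \<in> l2_fun N"
  shows "sq N (\<lambda>z. f z + g z) + sq N (\<lambda>z. f z - g z) = 2 * sq N f + 2 * sq N g"
  using sq_add[OF assms] sq_add[OF assms(1) l2_fun_scale[OF assms(2), of "-1"]] 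
    ip_scale_right[of N f "-1" g] sq_scale[of N "-1" g]
  by simp

lemma sq_eq_0_iff:
  assumes "f \<in> l2_fun N"
  shows "sq N f = 0 \<longleftrightarrow> (AE z in N. f z = 0)"
  using integral_nonneg_eq_0_iff_AE[OF l2_fun_integrable[OF assms]] by (simp add: sq_def)

text \<open>The discriminant criterion. It serves twice: for Cauchy-Schwarz, and with
  \<open>b = 0\<close> for the vanishing of the first variation in the Riesz theorem.\<close>

lemma quadratic_nonneg_imp_le:
  fixes a b c :: real
  assumes *: "\<And>t. 0 \<le> t\<^sup>2 * a - 2 * t * c + b" and a: "a \<ge> 0"
  shows "c\<^sup>2 \<le> a * b"
proof (cases "a = 0")
  case True
  have "c = 0"
  proof (rule ccontr)
    assume "c \<noteq> 0"
    \<comment> \<open>For \<open>a = 0\<close> the polynomial is affine in t, and at this t it takes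
      the value -1.\<close>
    then show False using *[of "(b + 1) / (2 * c)"] True by simp
  qed
  then show ?thesis using True by simp
next
  case False
  have "0 \<le> a * ((c / a)\<^sup>2 * a - 2 * (c / a) * c + b)"
    by (rule mult_nonneg_nonneg[OF a *])
  also have "\<dots> = a * b - c\<^sup>2"
    using False by (simp add: field_simps power2_eq_square)
  finally show ?thesis by simp
qed

lemma ip_Cauchy_Schwarz:
  assumes f: "f \<in> l2_fun N" and g: "g \<in> l2_fun N"
  shows "cmod (ip N f g) \<le> sqrt (sq N f) * sqrt (sq N g)"
proof -
  have 1: "0 \<le> t\<^sup>2 * sq N f - 2 * t * cmod (ip N f g) + sq N g" for t
  proof -
    define w where "w = ip N f g"
    \<comment> \<open>A phase that rotates the inner product onto its modulus, so that a quadratic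
      in one real parameter suffices.\<close>
    obtain u where u: "cmod u = 1" "u * w = of_real (cmod w)"
    proof (cases "w = 0")
      case True
      then show ?thesis using that[of 1] by simp
    next
      case False
      have "cnj w / cmod w * w = of_real (cmod w)"
        using False complex_norm_square[of w] by (simp add: field_simps power2_eq_square)
      then show ?thesis using False by (intro that[of "cnj w / cmod w"]) (auto simp: norm_divide)
    qed
    have tu: "(cmod (- of_real t * u))\<^sup>2 = t\<^sup>2"
      using u(1) by (simp add: norm_mult)
    have "0 \<le> sq N (\<lambda>z. (- of_real t * u) * f z + g z)"
      by (rule sq_nonneg)
    also have "\<dots> = t\<^sup>2 * sq N f + sq N g + 2 * Re ((- of_real t * u) * w)"
      by (simp only: w_def sq_add[OF l2_fun_scale[OF f] g] sq_scale ip_scale_left tu)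
    also have "(- of_real t * u) * w = - of_real (t * cmod w)"
      using u(2) by (simp add: mult.assoc)
    finally show ?thesis by (simp add: w_def)
  qed
  have "(cmod (ip N f g))\<^sup>2 \<le> sq N f * sq N g"
    by (rule quadratic_nonneg_imp_le[OF 1 sq_nonneg])
  then have "sqrt ((cmod (ip N f g))\<^sup>2) \<le> sqrt (sq N f * sq N g)"
    by (rule real_sqrt_le_mono)
  then show ?thesis by (simp add: real_sqrt_mult)
qed

section \<open>Completeness of L2\<close>

text \<open>The weighted terms are bounded, so the increments decay like 2^(-k/2) and form an
  absolutely convergent series. This turns square-integral control of increments into pointwise
  convergence.\<close>

lemma convergent_if_weighted_square_summable:
  fixes a :: "nat \<Rightarrow> complex"
  assumes "summable (\<lambda>k. 2 ^ k * (cmod (a (Suc k) - a k))\<^sup>2)"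
  shows "convergent a"
proof -
  have "Bseq (\<lambda>k. 2 ^ k * (cmod (a (Suc k) - a k))\<^sup>2)"
    using summable_LIMSEQ_zero[OF assms] by (intro convergent_imp_Bseq convergentI)
  then obtain C where C: "C > 0" "\<And>k. norm (2 ^ k * (cmod (a (Suc k) - a k))\<^sup>2) \<le> C"
    by (auto simp: Bseq_def)
  have bd: "cmod (a (Suc k) - a k) \<le> sqrt C * (sqrt (1/2)) ^ k" for k
  proof -
    have "(cmod (a (Suc k) - a k))\<^sup>2 \<le> C * (1/2) ^ k"
      using C(2)[of k] by (simp add: field_simps abs_mult)
    then have "sqrt ((cmod (a (Suc k) - a k))\<^sup>2) \<le> sqrt (C * (1/2) ^ k)"
      by (rule real_sqrt_le_mono)
    then show ?thesis by (simp only: real_sqrt_mult real_sqrt_power) simp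
  qed
  have "summable (\<lambda>k. sqrt C * (sqrt (1/2)) ^ k)"
    by (intro summable_mult summable_geometric) simp
  then have "summable (\<lambda>k. a (Suc k) - a k)"
    by (rule summable_comparison_test') (use bd in auto)
  then have "convergent (\<lambda>n. \<Sum>k<n. a (Suc k) - a k)"
    by (simp add: summable_iff_convergent)
  then have "convergent (\<lambda>n. a n - a 0)"
    by (simp add: sum_lessThan_telescope)
  then have "convergent (\<lambda>n. (a n - a 0) + a 0)"
    by (intro convergent_add convergent_const)
  then show ?thesis by simp
qed

lemma nn_integral_sq:
  assumes "f \<in> l2_fun N"
  shows "(\<integral>\<^sup>+z. ennreal ((cmod (f z))\<^sup>2) \<partial>N) = ennreal (sq N f)"
  unfolding sq_def using l2_fun_integrable[OF assms] by (intro nn_integral_eq_integral) auto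

text \<open>Riesz-Fischer: a fast subsequence converges almost everywhere, and Fatou's lemma
  transfers the Cauchy estimate to the limit. Squared distances below 4^-k leave room for the weight
  2^k, since the products 2^-k are still summable.\<close>

lemma l2_complete:
  assumes f: "\<And>n. f n \<in> l2_fun N"
    and Cauchy: "\<And>e. e > 0 \<Longrightarrow> \<exists>n0. \<forall>m\<ge>n0. \<forall>n\<ge>n0. sq N (\<lambda>z. f m z - f n z) < e"
  shows "\<exists>g\<in>l2_fun N. (\<lambda>n. sq N (\<lambda>z. f n z - g z)) \<longlonglongrightarrow> 0"
proof -
  note [measurable] = l2_fun_measurable[OF f]
  have "\<exists>n0. \<forall>m\<ge>n0. \<forall>n\<ge>n0. sq N (\<lambda>z. f m z - f n z) < (1/4) ^ k" for k :: nat
    by (rule Cauchy) simp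
  then obtain r0 where r0: "\<And>k m n. m \<ge> r0 k \<Longrightarrow> n \<ge> r0 k \<Longrightarrow> sq N (\<lambda>z. f m z - f n z) < (1/4) ^ k"
    by metis
  \<comment> \<open>Summing the thresholds makes the indices monotone while keeping each at least
    \<open>r0 k\<close>.\<close>
  define r where "r k = (\<Sum>i\<le>k. r0 i) + k" for k
  have r_ge: "r0 k \<le> r k" for k
    unfolding r_def using member_le_sum[of k "{..k}" r0] by (simp add: trans_le_add1)
  have r_Suc: "r k \<le> r (Suc k)" for k
    by (simp add: r_def)
  have r_mono: "mono r"
    by (simp add: mono_iff_le_Suc r_Suc)
  define d where "d k z = f (r (Suc k)) z - f (r k) z" for k z
  have d: "d k \<in> l2_fun N" for k
    unfolding d_def by (intro l2_fun_diff f)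
  note [measurable] = l2_fun_measurable[OF d]
  have sq_d: "sq N (d k) \<le> (1/4) ^ k" for k
    unfolding d_def using r0[of k "r (Suc k)" "r k"] r_ge[of k] r_Suc[of k] by (meson less_imp_le order_trans)
  have "(\<integral>\<^sup>+z. (\<Sum>k. ennreal (2 ^ k * (cmod (d k z))\<^sup>2)) \<partial>N) =
      (\<Sum>k. \<integral>\<^sup>+z. ennreal (2 ^ k * (cmod (d k z))\<^sup>2) \<partial>N)"
    by (rule nn_integral_suminf) simp
  also have "\<dots> = (\<Sum>k. ennreal (2 ^ k * sq N (d k)))"
    by (simp add: ennreal_mult nn_integral_cmult nn_integral_sq[OF d] sq_nonneg)
  also have "\<dots> \<le> (\<Sum>k. ennreal ((1/2) ^ k))"
  proof (intro suminf_le ennreal_leI summableI)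
    fix k
    have "2 ^ k * sq N (d k) \<le> 2 ^ k * (1/4) ^ k"
      by (intro mult_left_mono sq_d) simp
    also have "\<dots> = (1/2) ^ k"
      by (simp add: power_mult_distrib[symmetric])
    finally show "2 ^ k * sq N (d k) \<le> (1/2) ^ k" .
  qed
  also have "\<dots> < \<infinity>"
    by (subst suminf_ennreal2) (simp_all add: summable_geometric)
  finally have "AE z in N. (\<Sum>k. ennreal (2 ^ k * (cmod (d k z))\<^sup>2)) \<noteq> \<infinity>"
    by (intro nn_integral_noteq_infinite) auto
  then have conv: "AE z in N. convergent (\<lambda>k. f (r k) z)"
  proof eventually_elim
    case (elim z)
    then have "summable (\<lambda>k. 2 ^ k * (cmod (d k z))\<^sup>2)"
      by (intro summable_suminf_not_top) auto
    then show ?case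
      by (intro convergent_if_weighted_square_summable) (simp add: d_def)
  qed
  define g where "g z = lim (\<lambda>k. f (r k) z)" for z
  have [measurable]: "g \<in> borel_measurable N"
    unfolding g_def by measurable
  have lim: "AE z in N. (\<lambda>k. f (r k) z) \<longlonglongrightarrow> g z"
    using conv by eventually_elim (simp add: g_def convergent_LIMSEQ_iff)
  \<comment> \<open>Stated for all large \<open>n\<close> and not only along the subsequence, this
    yields both square integrability of \<open>g\<close> and convergence of the whole
    sequence.\<close>
  have fatou: "(\<integral>\<^sup>+z. ennreal ((cmod (f n z - g z))\<^sup>2) \<partial>N) \<le> ennreal ((1/4) ^ k)" if n: "n \<ge> r k" for n k
  proof -
    have "(\<integral>\<^sup>+z. ennreal ((cmod (f n z - g z))\<^sup>2) \<partial>N) =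
        (\<integral>\<^sup>+z. liminf (\<lambda>j. ennreal ((cmod (f n z - f (r j) z))\<^sup>2)) \<partial>N)"
    proof (rule nn_integral_cong_AE, use lim in eventually_elim)
      case (elim z)
      have "(\<lambda>j. ennreal ((cmod (f n z - f (r j) z))\<^sup>2)) \<longlonglongrightarrow> ennreal ((cmod (f n z - g z))\<^sup>2)"
        by (intro tendsto_intros elim)
      then show ?case
        by (intro lim_imp_Liminf[symmetric]) simp_all
    qed
    also have "\<dots> \<le> liminf (\<lambda>j. \<integral>\<^sup>+z. ennreal ((cmod (f n z - f (r j) z))\<^sup>2) \<partial>N)"
      by (rule nn_integral_liminf) simp
    also have "\<dots> \<le> limsup (\<lambda>j. \<integral>\<^sup>+z. ennreal ((cmod (f n z - f (r j) z))\<^sup>2) \<partial>N)"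
      by (rule Liminf_le_Limsup) simp
    also have "\<dots> \<le> ennreal ((1/4) ^ k)"
    proof (rule Limsup_bounded)
      show "\<forall>\<^sub>F j in sequentially. (\<integral>\<^sup>+z. ennreal ((cmod (f n z - f (r j) z))\<^sup>2) \<partial>N) \<le> ennreal ((1/4) ^ k)"
        using eventually_ge_at_top[of k]
      proof eventually_elim
        case (elim j)
        have "sq N (\<lambda>z. f n z - f (r j) z) < (1/4) ^ k"
          using n r_ge[of k] monoD[OF r_mono elim] by (intro r0) auto
        then show ?case
          by (subst nn_integral_sq) (auto intro!: l2_fun_diff f ennreal_leI)
      qed
    qed
    finally show ?thesis .
  qed
  have diff: "(\<lambda>z. f n z - g z) \<in> l2_fun N" if "n \<ge> r k" for n k
    using fatou[OF that] by (auto simp: l2_fun_def integrable_iff_bounded intro: le_less_trans)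
  have "(\<lambda>z. f (r 0) z - (f (r 0) z - g z)) \<in> l2_fun N"
    by (intro l2_fun_diff[OF f diff[of 0]]) simp
  then have g: "g \<in> l2_fun N" by simp
  moreover have "(\<lambda>n. sq N (\<lambda>z. f n z - g z)) \<longlonglongrightarrow> 0"
  proof (rule LIMSEQ_I)
    fix e :: real assume "e > 0"
    then obtain k where k: "(1/4) ^ k < e"
      using real_arch_pow_inv[of e "1/4"] by auto
    have "norm (sq N (\<lambda>z. f n z - g z) - 0) < e" if "n \<ge> r k" for n
    proof -
      have "ennreal (sq N (\<lambda>z. f n z - g z)) \<le> ennreal ((1/4) ^ k)"
        using fatou[OF that] by (simp add: nn_integral_sq[OF l2_fun_diff[OF f g]])
      then show ?thesis using k by (simp add: sq_nonneg)
    qed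
    then show "\<exists>no. \<forall>n\<ge>no. norm (sq N (\<lambda>z. f n z - g z) - 0) < e" by blast
  qed
  ultimately show ?thesis by blast
qed

section \<open>The Riesz representation theorem\<close>

lemma linear_le_quadratic_imp_0:
  fixes a b :: real
  assumes *: "\<And>t. 0 \<le> t\<^sup>2 * a + t * b"
  shows "b = 0"
proof -
  have "a \<ge> 0" using *[of 1] *[of "-1"] by simp
  moreover have "0 \<le> t\<^sup>2 * a - 2 * t * (- b / 2) + 0" for t
    using *[of t] by simp
  ultimately have "(- b / 2)\<^sup>2 \<le> a * 0"
    by (intro quadratic_nonneg_imp_le)
  then show ?thesis by simp
qed

text \<open>Variational proof: if \<Lambda> is the inner product with g, then \<open>J\<close>
  equals the squared distance to g minus a constant, so g is found as the limit of a minimising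
  sequence of \<open>J\<close>.\<close>

lemma l2_Riesz:
  fixes \<Lambda> :: "('a \<Rightarrow> complex) \<Rightarrow> complex"
  assumes add: "\<And>f g. f \<in> l2_fun N \<Longrightarrow> g \<in> l2_fun N \<Longrightarrow> \<Lambda> (\<lambda>z. f z + g z) = \<Lambda> f + \<Lambda> g"
    and scale: "\<And>a f. f \<in> l2_fun N \<Longrightarrow> \<Lambda> (\<lambda>z. a * f z) = a * \<Lambda> f"
    and bound: "\<And>f. f \<in> l2_fun N \<Longrightarrow> cmod (\<Lambda> f) \<le> K * sqrt (sq N f)"
  shows "\<exists>g\<in>l2_fun N. \<forall>f\<in>l2_fun N. \<Lambda> f = ip N f g"
proof -
  define J where "J f = sq N f - 2 * Re (\<Lambda> f)" for f
  have J_ge: "- (K\<^sup>2) \<le> J f" if "f \<in> l2_fun N" for f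
  proof -
    have "Re (\<Lambda> f) \<le> K * sqrt (sq N f)"
      using bound[OF that] complex_Re_le_cmod[of "\<Lambda> f"] by linarith
    moreover have "0 \<le> (sqrt (sq N f) - K)\<^sup>2" by simp
    ultimately show ?thesis
      by (simp add: J_def power2_diff sq_nonneg algebra_simps)
  qed
  define m where "m = Inf (J ` l2_fun N)"
  have bdd: "bdd_below (J ` l2_fun N)"
    using J_ge by (auto simp: bdd_below_def)
  have m_le: "m \<le> J f" if "f \<in> l2_fun N" for f
    unfolding m_def using that bdd by (intro cInf_lower) auto
  have "\<exists>f\<in>l2_fun N. J f < m + 1 / real (Suc n)" for n
  proof -
    have "\<exists>x\<in>J ` l2_fun N. x < m + 1 / real (Suc n)"
      unfolding m_def by (intro cInf_lessD) (use l2_fun_zero in auto)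
    then show ?thesis by auto
  qed
  then obtain v where v: "\<And>n. v n \<in> l2_fun N" "\<And>n. J (v n) < m + 1 / real (Suc n)"
    by metis
  \<comment> \<open>Comparing \<open>J\<close> at the midpoint with its infimum, the parallelogram
    law bounds the distance of two near-minimisers by their excess over \<open>m\<close>.\<close>
  have close: "sq N (\<lambda>z. v i z - v j z) \<le> 2 / real (Suc i) + 2 / real (Suc j)" for i j
  proof -
    have l2: "(\<lambda>z. v i z + v j z) \<in> l2_fun N"
      by (intro l2_fun_add v)
    have "4 * m \<le> 4 * J (\<lambda>z. (1/2) * (v i z + v j z))"
      using m_le[OF l2_fun_scale[OF l2, of "1/2"]] by (simp only: mult_le_cancel_left_pos zero_less_numeral)
    also have "\<dots> = sq N (\<lambda>z. v i z + v j z) - 4 * Re (\<Lambda> (v i)) - 4 * Re (\<Lambda> (v j))"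
      unfolding J_def by (simp only: scale[OF l2] sq_scale add[OF v(1) v(1)])
        (simp add: power2_eq_square norm_divide field_simps)
    finally have "sq N (\<lambda>z. v i z - v j z) \<le> 2 * J (v i) + 2 * J (v j) - 4 * m"
      using sq_parallelogram[OF v(1) v(1), of i j] by (simp add: J_def)
    then show ?thesis using v(2)[of i] v(2)[of j] by simp
  qed
  have "\<exists>g\<in>l2_fun N. (\<lambda>n. sq N (\<lambda>z. v n z - g z)) \<longlonglongrightarrow> 0"
  proof (rule l2_complete[OF v(1)])
    fix e :: real assume "e > 0"
    then obtain n0 where n0: "1 / real (Suc n0) < e / 4"
      using nat_approx_posE[of "e / 4"] by auto
    have "sq N (\<lambda>z. v i z - v j z) < e" if "i \<ge> n0" "j \<ge> n0" for i j
    proof -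
      have "1 / real (Suc i) \<le> 1 / real (Suc n0)" "1 / real (Suc j) \<le> 1 / real (Suc n0)"
        using that by (auto intro!: divide_left_mono)
      then show ?thesis using close[of i j] n0 by linarith
    qed
    then show "\<exists>n0. \<forall>i\<ge>n0. \<forall>j\<ge>n0. sq N (\<lambda>z. v i z - v j z) < e" by blast
  qed
  then obtain g where g: "g \<in> l2_fun N" and lim: "(\<lambda>n. sq N (\<lambda>z. v n z - g z)) \<longlonglongrightarrow> 0" by blast
  have lim_ip: "(\<lambda>n. ip N (v n) w) \<longlonglongrightarrow> ip N g w" if w: "w \<in> l2_fun N" for w
  proof -
    have "(\<lambda>n. ip N (v n) w - ip N g w) \<longlonglongrightarrow> 0"
    proof (rule Lim_null_comparison)
      show "\<forall>\<^sub>F n in sequentially. norm (ip N (v n) w - ip N g w) \<le>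
          sqrt (sq N (\<lambda>z. v n z - g z)) * sqrt (sq N w)"
        using ip_Cauchy_Schwarz[OF l2_fun_diff[OF v(1) g] w] ip_diff_left[OF v(1) g w] by simp
      show "(\<lambda>n. sqrt (sq N (\<lambda>z. v n z - g z)) * sqrt (sq N w)) \<longlonglongrightarrow> 0"
        using tendsto_mult_left_zero[OF tendsto_real_sqrt[OF lim, simplified], of "sqrt (sq N w)"] by simp
    qed
    then show ?thesis using LIM_zero_iff by blast
  qed
  have Re_eq: "Re (\<Lambda> w) = Re (ip N w g)" if w: "w \<in> l2_fun N" for w
  proof -
    have "0 \<le> t\<^sup>2 * sq N w + t * (2 * (Re (ip N g w) - Re (\<Lambda> w)))" for t
    proof -
      have tw: "(\<lambda>z. of_real t * w z) \<in> l2_fun N" by (rule l2_fun_scale[OF w])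
      \<comment> \<open>The first variation is estimated at \<open>v n\<close>, up to the error
        1/(n+1), and only the inner product with \<open>w\<close> is then passed to the limit. The
        value of \<open>J\<close> at \<open>g\<close> never has to be computed.\<close>
      have ge: "- (1 / real (Suc n)) \<le> t\<^sup>2 * sq N w + t * (2 * (Re (ip N (v n) w) - Re (\<Lambda> w)))" for n
      proof -
        have "m \<le> J (\<lambda>z. v n z + of_real t * w z)"
          by (intro m_le l2_fun_add v tw)
        also have "\<dots> = J (v n) + t\<^sup>2 * sq N w + t * (2 * (Re (ip N (v n) w) - Re (\<Lambda> w)))"
          unfolding J_def
          by (simp add: sq_add[OF v(1) tw] add[OF v(1) tw] scale[OF w] sq_scale ip_scale_right algebra_simps)
        finally show ?thesis using v(2)[of n] by linarith
      qed
      have "(\<lambda>n. t\<^sup>2 * sq N w + t * (2 * (Re (ip N (v n) w) - Re (\<Lambda> w)))) \<longlonglongrightarrow>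
          t\<^sup>2 * sq N w + t * (2 * (Re (ip N g w) - Re (\<Lambda> w)))"
        by (intro tendsto_intros lim_ip w)
      moreover have "(\<lambda>n. - (1 / real (Suc n))) \<longlonglongrightarrow> - 0"
        by (intro tendsto_minus LIMSEQ_inverse_real_of_nat[unfolded inverse_eq_divide])
      ultimately have "- 0 \<le> t\<^sup>2 * sq N w + t * (2 * (Re (ip N g w) - Re (\<Lambda> w)))"
        using ge by (rule_tac LIMSEQ_le) auto
      then show ?thesis by simp
    qed
    then have "2 * (Re (ip N g w) - Re (\<Lambda> w)) = 0"
      by (rule linear_le_quadratic_imp_0)
    then show ?thesis using ip_commute[of N g w] by simp
  qed
  have "\<Lambda> w = ip N w g" if w: "w \<in> l2_fun N" for w
  proof (rule complex_eqI)
    show "Re (\<Lambda> w) = Re (ip N w g)" by (rule Re_eq[OF w])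
    \<comment> \<open>Imaginary parts are minus the real parts at the vector multiplied by the
      imaginary unit.\<close>
    show "Im (\<Lambda> w) = Im (ip N w g)"
      using Re_eq[OF l2_fun_scale[OF w, of \<i>]] by (simp add: scale[OF w] ip_scale_left)
  qed
  with g show ?thesis by blast
qed

section \<open>Passing from functions to classes\<close>

lemma equiv_l2_rel: "equiv (l2_fun N) (l2_rel N)"
proof (rule equivI)
  show "l2_rel N \<subseteq> l2_fun N \<times> l2_fun N" by (auto simp: l2_rel_def)
  show "refl_on (l2_fun N) (l2_rel N)" by (auto simp: refl_on_def l2_rel_def)
  show "sym (l2_rel N)" by (auto simp: sym_def l2_rel_def)
  show "trans (l2_rel N)"
    unfolding trans_def l2_rel_def by (auto elim: eventually_elim2)
qed

definition l2_cls :: "'a measure \<Rightarrow> ('a \<Rightarrow> complex) \<Rightarrow> ('a \<Rightarrow> complex) set" where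
  "l2_cls N f = l2_rel N `` {f}"

lemma l2_cls_eq_iff:
  assumes "f \<in> l2_fun N" "g \<in> l2_fun N"
  shows "l2_cls N f = l2_cls N g \<longleftrightarrow> (AE z in N. f z = g z)"
  using eq_equiv_class_iff[OF equiv_l2_rel assms] assms by (simp add: l2_cls_def l2_rel_def)

lemma l2_cls_eqI:
  assumes "f \<in> l2_fun N" "g \<in> l2_fun N" "AE z in N. f z = g z"
  shows "l2_cls N f = l2_cls N g"
  using assms by (simp add: l2_cls_eq_iff)

lemma mem_l2_cls: "g \<in> l2_cls N f \<longleftrightarrow> f \<in> l2_fun N \<and> g \<in> l2_fun N \<and> (AE z in N. f z = g z)"
  by (auto simp: l2_cls_def l2_rel_def)

lemma l2_cls_in_L2 [simp]: "f \<in> l2_fun N \<Longrightarrow> l2_cls N f \<in> L2 N"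
  by (auto simp: L2_def l2_cls_def intro: quotientI)

lemma L2E:
  assumes "c \<in> L2 N"
  obtains f where "f \<in> l2_fun N" "c = l2_cls N f"
  using assms by (auto simp: L2_def l2_cls_def elim: quotientE)

text \<open>The well-definedness principle for the union idiom: a result independent of the
  representative can be computed on any one of them.\<close>

lemma l2_cls_UN:
  assumes f: "f \<in> l2_fun N" and *: "\<And>f'. f' \<in> l2_cls N f \<Longrightarrow> F f' = F f"
  shows "(\<Union>f'\<in>l2_cls N f. F f') = F f"
proof -
  have "f \<in> l2_cls N f" using f by (simp add: mem_l2_cls)
  moreover have "(\<Union>f'\<in>l2_cls N f. F f') = (\<Union>f'\<in>l2_cls N f. F f)"
    by (rule SUP_cong[OF refl *])
  ultimately show ?thesis by auto
qed

lemma l2_add_cls: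
  assumes f: "f \<in> l2_fun N" and g: "g \<in> l2_fun N"
  shows "l2_add N (l2_cls N f) (l2_cls N g) = l2_cls N (\<lambda>z. f z + g z)"
proof -
  have eq: "l2_rel N `` {\<lambda>z. f' z + g' z} = l2_rel N `` {\<lambda>z. f z + g z}"
    if "f' \<in> l2_cls N f" "g' \<in> l2_cls N g" for f' g'
  proof -
    have "AE z in N. f z = f' z" "AE z in N. g z = g' z" "f' \<in> l2_fun N" "g' \<in> l2_fun N"
      using that by (auto simp: mem_l2_cls)
    then show ?thesis
      unfolding l2_cls_def[symmetric] by (intro l2_cls_eqI l2_fun_add f g) auto
  qed
  have self: "f \<in> l2_cls N f" "g \<in> l2_cls N g"
    using f g by (auto simp: mem_l2_cls)
  have "l2_add N (l2_cls N f) (l2_cls N g) =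
      (\<Union>f'\<in>l2_cls N f. \<Union>g'\<in>l2_cls N g. l2_rel N `` {\<lambda>z. f z + g z})"
    unfolding l2_add_def using eq by simp
  also have "\<dots> = l2_cls N (\<lambda>z. f z + g z)"
    using self by (auto simp: l2_cls_def)
  finally show ?thesis .
qed

lemma l2_scale_cls:
  assumes f: "f \<in> l2_fun N"
  shows "l2_scale N a (l2_cls N f) = l2_cls N (\<lambda>z. a * f z)"
  unfolding l2_scale_def l2_cls_def[of N "\<lambda>z. a * f z"]
proof (rule l2_cls_UN[OF f, of "\<lambda>f. l2_rel N `` {\<lambda>z. a * f z}"])
  fix f' assume "f' \<in> l2_cls N f"
  then have "f' \<in> l2_fun N" "AE z in N. f' z = f z" by (auto simp: mem_l2_cls elim: eventually_mono)
  then show "l2_rel N `` {\<lambda>z. a * f' z} = l2_rel N `` {\<lambda>z. a * f z}"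
    unfolding l2_cls_def[symmetric] by (intro l2_cls_eqI l2_fun_scale f) auto
qed

lemma l2_inner_cls:
  assumes f: "f \<in> l2_fun N" and g: "g \<in> l2_fun N"
  shows "l2_inner N (l2_cls N f) (l2_cls N g) = ip N f g"
proof -
  have eq: "(\<integral>z. f' z * cnj (g' z) \<partial>N) = ip N f g"
    if "f' \<in> l2_cls N f" "g' \<in> l2_cls N g" for f' g'
  proof -
    have ae: "AE z in N. f z = f' z" "AE z in N. g z = g' z" and l2: "f' \<in> l2_fun N" "g' \<in> l2_fun N"
      using that by (auto simp: mem_l2_cls)
    have "AE z in N. f' z * cnj (g' z) = f z * cnj (g z)"
      using ae by eventually_elim simp
    then show ?thesis
      unfolding ip_def using f g l2
      by (intro integral_cong_AE borel_measurable_integrable integrable_l2_prod)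
  qed
  have self: "f \<in> l2_cls N f" "g \<in> l2_cls N g"
    using f g by (auto simp: mem_l2_cls)
  have "l2_inner N (l2_cls N f) (l2_cls N g) =
      the_elem (\<Union>f'\<in>l2_cls N f. \<Union>g'\<in>l2_cls N g. {ip N f g})"
    unfolding l2_inner_def using eq by simp
  also have "(\<Union>f'\<in>l2_cls N f. \<Union>g'\<in>l2_cls N g. {ip N f g}) = {ip N f g}"
    using self by auto
  finally show ?thesis by simp
qed

lemma l2_norm_cls: "f \<in> l2_fun N \<Longrightarrow> l2_norm N (l2_cls N f) = sqrt (sq N f)"
  by (simp add: l2_norm_def l2_inner_cls ip_self)

lemma l2_add_closed: "c \<in> L2 N \<Longrightarrow> d \<in> L2 N \<Longrightarrow> l2_add N c d \<in> L2 N"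
  by (auto elim!: L2E simp: l2_add_cls l2_fun_add)

lemma l2_scale_closed: "c \<in> L2 N \<Longrightarrow> l2_scale N a c \<in> L2 N"
  by (auto elim!: L2E simp: l2_scale_cls l2_fun_scale)

lemma l2_inner_commute: "c \<in> L2 N \<Longrightarrow> d \<in> L2 N \<Longrightarrow> l2_inner N c d = cnj (l2_inner N d c)"
  by (auto elim!: L2E simp: l2_inner_cls ip_commute[symmetric])

lemma l2_inner_add_left:
  "c \<in> L2 N \<Longrightarrow> d \<in> L2 N \<Longrightarrow> e \<in> L2 N \<Longrightarrow> l2_inner N (l2_add N c d) e = l2_inner N c e + l2_inner N d e"
  by (auto elim!: L2E simp: l2_inner_cls l2_add_cls l2_fun_add ip_add_left)

lemma l2_inner_scale_left:
  "c \<in> L2 N \<Longrightarrow> d \<in> L2 N \<Longrightarrow> l2_inner N (l2_scale N a c) d = a * l2_inner N c d"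
  by (auto elim!: L2E simp: l2_inner_cls l2_scale_cls l2_fun_scale ip_scale_left)

lemma l2_inner_add_right:
  "c \<in> L2 N \<Longrightarrow> d \<in> L2 N \<Longrightarrow> e \<in> L2 N \<Longrightarrow> l2_inner N c (l2_add N d e) = l2_inner N c d + l2_inner N c e"
  by (auto elim!: L2E simp: l2_inner_cls l2_add_cls l2_fun_add ip_add_right)

lemma l2_inner_scale_right:
  "c \<in> L2 N \<Longrightarrow> d \<in> L2 N \<Longrightarrow> l2_inner N c (l2_scale N a d) = cnj a * l2_inner N c d"
  by (auto elim!: L2E simp: l2_inner_cls l2_scale_cls l2_fun_scale ip_scale_right)

lemma l2_norm_nonneg: "c \<in> L2 N \<Longrightarrow> 0 \<le> l2_norm N c"
  by (auto elim!: L2E simp: l2_norm_cls sq_nonneg)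

lemma l2_norm_square: "c \<in> L2 N \<Longrightarrow> (l2_norm N c)\<^sup>2 = Re (l2_inner N c c)"
  by (auto elim!: L2E simp: l2_norm_cls sq_nonneg l2_inner_cls ip_self)

lemma l2_inner_self: "c \<in> L2 N \<Longrightarrow> l2_inner N c c = of_real ((l2_norm N c)\<^sup>2)"
  by (auto elim!: L2E simp: l2_norm_cls sq_nonneg l2_inner_cls ip_self simp del: of_real_power)

lemma l2_Cauchy_Schwarz:
  "c \<in> L2 N \<Longrightarrow> d \<in> L2 N \<Longrightarrow> cmod (l2_inner N c d) \<le> l2_norm N c * l2_norm N d"
  by (auto elim!: L2E simp: l2_norm_cls l2_inner_cls ip_Cauchy_Schwarz)

text \<open>Testing against the difference of the two representatives gives its squared
  norm.\<close>

lemma L2_eqI: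
  assumes c: "c \<in> L2 N" and d: "d \<in> L2 N"
    and eq: "\<And>e. e \<in> L2 N \<Longrightarrow> l2_inner N c e = l2_inner N d e"
  shows "c = d"
proof -
  obtain f g where f: "f \<in> l2_fun N" "c = l2_cls N f" and g: "g \<in> l2_fun N" "d = l2_cls N g"
    using c d by (auto elim!: L2E)
  have fg: "(\<lambda>z. f z - g z) \<in> l2_fun N" by (intro l2_fun_diff f g)
  have "ip N f (\<lambda>z. f z - g z) = ip N g (\<lambda>z. f z - g z)"
    using eq[of "l2_cls N (\<lambda>z. f z - g z)"] f g fg by (simp add: l2_inner_cls)
  then have "ip N (\<lambda>z. f z - g z) (\<lambda>z. f z - g z) = 0"
    using f g fg by (simp add: ip_diff_left)
  then have "AE z in N. f z - g z = 0"
    using sq_eq_0_iff[OF fg] by (simp add: ip_self)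
  then show ?thesis
    using f g by (simp add: l2_cls_eq_iff)
qed

lemma L2_eqI_right:
  assumes c: "c \<in> L2 N" and d: "d \<in> L2 N"
    and eq: "\<And>e. e \<in> L2 N \<Longrightarrow> l2_inner N e c = l2_inner N e d"
  shows "c = d"
proof (rule L2_eqI[OF c d])
  fix e assume e: "e \<in> L2 N"
  show "l2_inner N c e = l2_inner N d e"
    using eq[OF e] by (simp add: l2_inner_commute[OF c e] l2_inner_commute[OF d e])
qed

section \<open>Adjoints, commutants and von Neumann algebras\<close>

lemma bounded_opsD:
  assumes "T \<in> bounded_ops N"
  shows bounded_ops_closed: "c \<in> L2 N \<Longrightarrow> T c \<in> L2 N"
    and bounded_ops_add: "c \<in> L2 N \<Longrightarrow> d \<in> L2 N \<Longrightarrow> T (l2_add N c d) = l2_add N (T c) (T d)"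
    and bounded_ops_scale: "c \<in> L2 N \<Longrightarrow> T (l2_scale N a c) = l2_scale N a (T c)"
    and bounded_ops_extensional: "T \<in> extensional (L2 N)"
  using assms by (auto simp: bounded_ops_def PiE_def)

lemma bounded_ops_bound:
  assumes "T \<in> bounded_ops N"
  obtains K where "K \<ge> 0" "\<And>c. c \<in> L2 N \<Longrightarrow> l2_norm N (T c) \<le> K * l2_norm N c"
proof -
  obtain K where K: "\<forall>c\<in>L2 N. l2_norm N (T c) \<le> K * l2_norm N c"
    using assms by (auto simp: bounded_ops_def)
  have "l2_norm N (T c) \<le> \<bar>K\<bar> * l2_norm N c" if "c \<in> L2 N" for c
    using K that mult_right_mono[of K "\<bar>K\<bar>" "l2_norm N c"] l2_norm_nonneg[OF that]
    by (meson abs_ge_self order_trans)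
  then show ?thesis by (intro that[of "\<bar>K\<bar>"]) auto
qed

lemma bounded_ops_eqI:
  assumes "T \<in> bounded_ops N" "S \<in> bounded_ops N" "\<And>c. c \<in> L2 N \<Longrightarrow> T c = S c"
  shows "T = S"
  using assms by (intro extensionalityI[of T "L2 N" S] bounded_ops_extensional) auto

lemma bounded_opsI:
  assumes "T \<in> L2 N \<rightarrow>\<^sub>E L2 N"
    and "\<And>c d. c \<in> L2 N \<Longrightarrow> d \<in> L2 N \<Longrightarrow> T (l2_add N c d) = l2_add N (T c) (T d)"
    and "\<And>a c. c \<in> L2 N \<Longrightarrow> T (l2_scale N a c) = l2_scale N a (T c)"
    and "\<And>c. c \<in> L2 N \<Longrightarrow> l2_norm N (T c) \<le> K * l2_norm N c"
  shows "T \<in> bounded_ops N"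
  using assms unfolding bounded_ops_def by (intro CollectI conjI ballI allI exI[of _ K]) auto

lemma bounded_ops_compose:
  assumes T: "T \<in> bounded_ops N" and S: "S \<in> bounded_ops N"
  shows "compose (L2 N) T S \<in> bounded_ops N"
proof -
  obtain K where K: "K \<ge> 0" "\<And>c. c \<in> L2 N \<Longrightarrow> l2_norm N (T c) \<le> K * l2_norm N c"
    using bounded_ops_bound[OF T] by blast
  obtain L where L: "L \<ge> 0" "\<And>c. c \<in> L2 N \<Longrightarrow> l2_norm N (S c) \<le> L * l2_norm N c"
    using bounded_ops_bound[OF S] by blast
  show ?thesis
  proof (rule bounded_opsI[where K = "K * L"])
    show "compose (L2 N) T S \<in> L2 N \<rightarrow>\<^sub>E L2 N"
      using T S by (auto simp: compose_def bounded_ops_closed)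
    fix c assume c: "c \<in> L2 N"
    show "compose (L2 N) T S (l2_add N c d) = l2_add N (compose (L2 N) T S c) (compose (L2 N) T S d)"
      if "d \<in> L2 N" for d
      using c that T S by (simp add: compose_eq l2_add_closed bounded_ops_add bounded_ops_closed)
    show "compose (L2 N) T S (l2_scale N a c) = l2_scale N a (compose (L2 N) T S c)" for a
      using c T S by (simp add: compose_eq l2_scale_closed bounded_ops_scale bounded_ops_closed)
    have "l2_norm N (T (S c)) \<le> K * l2_norm N (S c)"
      by (rule K(2)[OF bounded_ops_closed[OF S c]])
    also have "\<dots> \<le> K * (L * l2_norm N c)"
      using c K(1) L(2) by (intro mult_left_mono)
    finally show "l2_norm N (compose (L2 N) T S c) \<le> K * L * l2_norm N c"
      using c by (simp add: compose_eq mult.assoc)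
  qed
qed

section \<open>Adjoints\<close>

lemma adjoint_opsD:
  "adjoint_ops N T S \<Longrightarrow> c \<in> L2 N \<Longrightarrow> d \<in> L2 N \<Longrightarrow> l2_inner N (T c) d = l2_inner N c (S d)"
  by (simp add: adjoint_ops_def)

lemma adjoint_ops_sym:
  assumes "T \<in> bounded_ops N" "S \<in> bounded_ops N" "adjoint_ops N T S"
  shows "adjoint_ops N S T"
  using assms unfolding adjoint_ops_def by (metis bounded_ops_closed l2_inner_commute)

lemma adjoint_ops_unique:
  assumes T: "T \<in> bounded_ops N" and S: "S \<in> bounded_ops N" and S': "S' \<in> bounded_ops N"
    and adj: "adjoint_ops N T S" "adjoint_ops N T S'"
  shows "S = S'"
proof (rule bounded_ops_eqI[OF S S'])
  fix d assume d: "d \<in> L2 N"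
  show "S d = S' d"
  proof (rule L2_eqI)
    fix c assume c: "c \<in> L2 N"
    show "l2_inner N (S d) c = l2_inner N (S' d) c"
      using adjoint_opsD[OF adj(1) c d] adjoint_opsD[OF adj(2) c d] c d S S'
      by (metis bounded_ops_closed l2_inner_commute)
  qed (use S S' d in \<open>auto simp: bounded_ops_closed\<close>)
qed

lemma adjoint_ops_compose:
  assumes "T \<in> bounded_ops N" "S \<in> bounded_ops N" "T' \<in> bounded_ops N" "S' \<in> bounded_ops N"
    and "adjoint_ops N T T'" "adjoint_ops N S S'"
  shows "adjoint_ops N (compose (L2 N) T S) (compose (L2 N) S' T')"
  using assms by (simp add: adjoint_ops_def compose_eq bounded_ops_closed)

text \<open>The Riesz theorem represents each functional c \<mapsto> <T c, d>. Linearity of the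
  chosen map follows because a vector is determined by its inner products.\<close>

lemma adjoint_exists:
  assumes T: "T \<in> bounded_ops N"
  obtains S where "S \<in> bounded_ops N" "adjoint_ops N T S"
proof -
  obtain K where K: "K \<ge> 0" "\<And>c. c \<in> L2 N \<Longrightarrow> l2_norm N (T c) \<le> K * l2_norm N c"
    using bounded_ops_bound[OF T] by blast
  have ex: "\<exists>e\<in>L2 N. \<forall>c\<in>L2 N. l2_inner N (T c) d = l2_inner N c e" if d: "d \<in> L2 N" for d
  proof -
    define \<Lambda> where "\<Lambda> f = l2_inner N (T (l2_cls N f)) d" for f
    have "\<exists>g\<in>l2_fun N. \<forall>f\<in>l2_fun N. \<Lambda> f = ip N f g"
    proof (rule l2_Riesz)
      fix f assume f: "f \<in> l2_fun N"
      show "\<Lambda> (\<lambda>z. f z + g z) = \<Lambda> f + \<Lambda> g" if "g \<in> l2_fun N" for g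
        unfolding \<Lambda>_def using T d f that
        by (simp add: l2_add_cls[symmetric] bounded_ops_add l2_inner_add_left bounded_ops_closed)
      show "\<Lambda> (\<lambda>z. a * f z) = a * \<Lambda> f" for a
        unfolding \<Lambda>_def using T d f
        by (simp add: l2_scale_cls[symmetric] bounded_ops_scale l2_inner_scale_left bounded_ops_closed)
      have "cmod (\<Lambda> f) \<le> l2_norm N (T (l2_cls N f)) * l2_norm N d"
        unfolding \<Lambda>_def using T f d by (intro l2_Cauchy_Schwarz) (auto simp: bounded_ops_closed)
      also have "\<dots> \<le> K * l2_norm N (l2_cls N f) * l2_norm N d"
        using f d by (intro mult_right_mono K l2_norm_nonneg) auto
      finally show "cmod (\<Lambda> f) \<le> (K * l2_norm N d) * sqrt (sq N f)"
        using f by (simp add: l2_norm_cls algebra_simps)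
    qed
    then obtain g where g: "g \<in> l2_fun N" "\<forall>f\<in>l2_fun N. \<Lambda> f = ip N f g" by blast
    have "l2_inner N (T c) d = l2_inner N c (l2_cls N g)" if "c \<in> L2 N" for c
      using that g by (auto elim!: L2E simp: l2_inner_cls \<Lambda>_def)
    then show ?thesis using g by auto
  qed
  define S where "S = (\<lambda>d\<in>L2 N. SOME e. e \<in> L2 N \<and> (\<forall>c\<in>L2 N. l2_inner N (T c) d = l2_inner N c e))"
  have S_closed: "S d \<in> L2 N" and S_adj: "\<And>c. c \<in> L2 N \<Longrightarrow> l2_inner N (T c) d = l2_inner N c (S d)"
    if "d \<in> L2 N" for d
    using that someI_ex[OF ex[OF that, unfolded Bex_def]] by (auto simp: S_def)
  have "S \<in> bounded_ops N"
  proof (rule bounded_opsI[where K = K])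
    show "S \<in> L2 N \<rightarrow>\<^sub>E L2 N"
      using S_closed by (auto simp: S_def)
    fix c assume c: "c \<in> L2 N"
    show "S (l2_add N c d) = l2_add N (S c) (S d)" if d: "d \<in> L2 N" for d
      using c d T
      by (intro L2_eqI_right[where N = N] l2_add_closed S_closed)
         (simp_all add: l2_inner_add_right S_closed S_adj[symmetric] l2_add_closed bounded_ops_closed)
    show "S (l2_scale N a c) = l2_scale N a (S c)" for a
      using c T
      by (intro L2_eqI_right[where N = N] l2_scale_closed S_closed)
         (simp_all add: l2_inner_scale_right S_closed S_adj[symmetric] l2_scale_closed bounded_ops_closed)
    \<comment> \<open>The squared norm of S c equals <T (S c), c>, so after division by the norm of
      S c the bound \<open>K\<close> of \<open>T\<close> serves for \<open>S\<close> too.\<close>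
    have "(l2_norm N (S c))\<^sup>2 = cmod (l2_inner N (T (S c)) c)"
      using c by (simp add: S_adj S_closed l2_inner_self norm_power)
    also have "\<dots> \<le> l2_norm N (T (S c)) * l2_norm N c"
      using c T S_closed by (intro l2_Cauchy_Schwarz) (auto simp: bounded_ops_closed)
    also have "\<dots> \<le> K * l2_norm N (S c) * l2_norm N c"
      using c S_closed by (intro mult_right_mono K l2_norm_nonneg)
    finally have "l2_norm N (S c) * l2_norm N (S c) \<le> l2_norm N (S c) * (K * l2_norm N c)"
      by (simp add: power2_eq_square algebra_simps)
    then show "l2_norm N (S c) \<le> K * l2_norm N c"
      using l2_norm_nonneg[OF S_closed[OF c]] l2_norm_nonneg[OF c] K(1)
      by (cases "l2_norm N (S c) = 0") (auto simp: mult_le_cancel_left)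
  qed
  moreover have "adjoint_ops N T S"
    by (simp add: adjoint_ops_def S_adj)
  ultimately show ?thesis by (rule that)
qed

section \<open>Commutants and closure properties of von Neumann algebras\<close>

lemma mem_commutant_iff:
  assumes "S \<subseteq> bounded_ops N"
  shows "T \<in> commutant N S \<longleftrightarrow> T \<in> bounded_ops N \<and> (\<forall>A\<in>S. \<forall>c\<in>L2 N. T (A c) = A (T c))"
proof -
  have "compose (L2 N) T A = compose (L2 N) A T \<longleftrightarrow> (\<forall>c\<in>L2 N. T (A c) = A (T c))"
    if "T \<in> bounded_ops N" "A \<in> S" for A
  proof
    assume "compose (L2 N) T A = compose (L2 N) A T"
    then show "\<forall>c\<in>L2 N. T (A c) = A (T c)" by (metis compose_eq)
  qed (auto simp: compose_def fun_eq_iff)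
  then show ?thesis by (auto simp: commutant_def)
qed

lemma commutant_subset: "commutant N S \<subseteq> bounded_ops N"
  by (auto simp: commutant_def)

lemma subset_bicommutant: "S \<subseteq> bounded_ops N \<Longrightarrow> S \<subseteq> commutant N (commutant N S)"
  by (auto simp: commutant_def)

lemma commutant_antimono: "S \<subseteq> S' \<Longrightarrow> commutant N S' \<subseteq> commutant N S"
  by (auto simp: commutant_def)

text \<open>Take adjoints in T A' = A' T, where A' is an adjoint of \<open>A\<close> that again lies
  in \<open>S\<close>.\<close>

lemma adjoint_in_commutant:
  assumes S: "S \<subseteq> bounded_ops N" and S_adj: "\<And>A. A \<in> S \<Longrightarrow> \<exists>A'\<in>S. adjoint_ops N A A'"
    and T: "T \<in> commutant N S" and T': "T' \<in> bounded_ops N" and adj: "adjoint_ops N T T'"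
  shows "T' \<in> commutant N S"
proof -
  have Tb: "T \<in> bounded_ops N" and comm: "\<And>A c. A \<in> S \<Longrightarrow> c \<in> L2 N \<Longrightarrow> T (A c) = A (T c)"
    using T by (auto simp: mem_commutant_iff[OF S])
  note adj' = adjoint_ops_sym[OF Tb T' adj]
  have "T' (A c) = A (T' c)" if A: "A \<in> S" and c: "c \<in> L2 N" for A c
  proof -
    obtain A' where A': "A' \<in> S" "adjoint_ops N A A'" using S_adj[OF A] by blast
    have b: "A \<in> bounded_ops N" "A' \<in> bounded_ops N" using A A' S by auto
    show ?thesis
    proof (rule L2_eqI)
      fix d assume d: "d \<in> L2 N"
      have "l2_inner N (T' (A c)) d = l2_inner N c (A' (T d))"
        using b c d Tb by (simp add: adjoint_opsD[OF adj'] adjoint_opsD[OF A'(2)] bounded_ops_closed)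
      also have "\<dots> = l2_inner N (A (T' c)) d"
        using b c d Tb T' A' comm
        by (simp add: adjoint_opsD[OF adj'] adjoint_opsD[OF A'(2)] bounded_ops_closed)
      finally show "l2_inner N (T' (A c)) d = l2_inner N (A (T' c)) d" .
    qed (use b c T' in \<open>auto simp: bounded_ops_closed\<close>)
  qed
  then show ?thesis using T' by (simp add: mem_commutant_iff[OF S])
qed

lemma von_neumann_algebra_commutant:
  assumes S: "S \<subseteq> bounded_ops N" and S_adj: "\<And>A. A \<in> S \<Longrightarrow> \<exists>A'\<in>S. adjoint_ops N A A'"
  shows "von_neumann_algebra N (commutant N S)"
  unfolding von_neumann_algebra_def
proof (intro conjI ballI)
  show "commutant N (commutant N (commutant N S)) = commutant N S"
    by (intro equalityI commutant_antimono subset_bicommutant S commutant_subset)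
  fix T assume T: "T \<in> commutant N S"
  then have "T \<in> bounded_ops N" using commutant_subset by blast
  then obtain T' where "T' \<in> bounded_ops N" "adjoint_ops N T T'" by (rule adjoint_exists)
  then show "\<exists>T'\<in>commutant N S. adjoint_ops N T T'"
    using adjoint_in_commutant[OF S S_adj T] by blast
qed (rule commutant_subset)

lemma von_neumann_algebra_subset: "von_neumann_algebra N P \<Longrightarrow> P \<subseteq> bounded_ops N"
  by (simp add: von_neumann_algebra_def)

text \<open>The membership test behind all closure properties: products, sums, scalars and weak
  limits are each checked against an arbitrary element of the commutant.\<close>

lemma von_neumann_algebraI_mem:
  assumes P: "von_neumann_algebra N P" and T: "T \<in> bounded_ops N"
    and "\<And>A c. A \<in> commutant N P \<Longrightarrow> c \<in> L2 N \<Longrightarrow> T (A c) = A (T c)"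
  shows "T \<in> P"
proof -
  have "T \<in> commutant N (commutant N P)"
    using T assms(3) by (simp add: mem_commutant_iff[OF commutant_subset])
  then show ?thesis using P by (simp add: von_neumann_algebra_def)
qed

lemma commutantD:
  assumes "von_neumann_algebra N P" "A \<in> commutant N P" "T \<in> P" "c \<in> L2 N"
  shows "A (T c) = T (A c)"
  using assms mem_commutant_iff[OF von_neumann_algebra_subset[OF assms(1)]] by blast

lemma von_neumann_algebra_compose:
  assumes P: "von_neumann_algebra N P" and T: "T \<in> P" and S: "S \<in> P"
  shows "compose (L2 N) T S \<in> P"
proof -
  have b: "T \<in> bounded_ops N" "S \<in> bounded_ops N"
    using von_neumann_algebra_subset[OF P] T S by auto
  show ?thesis
  proof (rule von_neumann_algebraI_mem[OF P bounded_ops_compose[OF b]])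
    fix A c assume A: "A \<in> commutant N P" and c: "c \<in> L2 N"
    have "A \<in> bounded_ops N" using A commutant_subset by blast
    then show "compose (L2 N) T S (A c) = A (compose (L2 N) T S c)"
      using c b by (simp add: compose_eq bounded_ops_closed commutantD[OF P A T] commutantD[OF P A S])
  qed
qed

lemma von_neumann_algebra_adjoint:
  assumes P: "von_neumann_algebra N P" and T: "T \<in> P"
    and T': "T' \<in> bounded_ops N" "adjoint_ops N T T'"
  shows "T' \<in> P"
proof -
  obtain S where S: "S \<in> P" "adjoint_ops N T S"
    using P T by (auto simp: von_neumann_algebra_def)
  then have "S = T'"
    using von_neumann_algebra_subset[OF P] T T' by (intro adjoint_ops_unique[of T N]) auto
  then show ?thesis using S by simp
qed

definition op_add :: "'a measure \<Rightarrow> 'a l2_op \<Rightarrow> 'a l2_op \<Rightarrow> 'a l2_op" where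
  "op_add N T S = (\<lambda>c\<in>L2 N. l2_add N (T c) (S c))"

lemma l2_norm_triangle:
  assumes "c \<in> L2 N" "d \<in> L2 N"
  shows "l2_norm N (l2_add N c d) \<le> l2_norm N c + l2_norm N d"
proof (rule power2_le_imp_le)
  have "Re (l2_inner N c d) \<le> l2_norm N c * l2_norm N d" "Re (l2_inner N d c) \<le> l2_norm N c * l2_norm N d"
    using l2_Cauchy_Schwarz[OF assms] l2_Cauchy_Schwarz[OF assms(2,1)]
      complex_Re_le_cmod[of "l2_inner N c d"] complex_Re_le_cmod[of "l2_inner N d c"]
    by (simp_all add: mult.commute)
  then show "(l2_norm N (l2_add N c d))\<^sup>2 \<le> (l2_norm N c + l2_norm N d)\<^sup>2"
    using assms by (simp add: l2_norm_square l2_add_closed l2_inner_add_left l2_inner_add_right power2_sum)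
qed (use assms in \<open>simp add: l2_norm_nonneg\<close>)

lemma op_add_bounded:
  assumes T: "T \<in> bounded_ops N" and S: "S \<in> bounded_ops N"
  shows "op_add N T S \<in> bounded_ops N"
proof -
  obtain K where K: "K \<ge> 0" "\<And>c. c \<in> L2 N \<Longrightarrow> l2_norm N (T c) \<le> K * l2_norm N c"
    using bounded_ops_bound[OF T] by blast
  obtain L where L: "L \<ge> 0" "\<And>c. c \<in> L2 N \<Longrightarrow> l2_norm N (S c) \<le> L * l2_norm N c"
    using bounded_ops_bound[OF S] by blast
  show ?thesis
  proof (rule bounded_opsI[where K = "K + L"])
    show "op_add N T S \<in> L2 N \<rightarrow>\<^sub>E L2 N"
      using T S by (auto simp: op_add_def bounded_ops_closed l2_add_closed)
    fix c assume c: "c \<in> L2 N"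
    have Tc: "T c \<in> L2 N" "S c \<in> L2 N" using T S c by (auto simp: bounded_ops_closed)
    show "op_add N T S (l2_add N c d) = l2_add N (op_add N T S c) (op_add N T S d)" if d: "d \<in> L2 N" for d
    proof (rule L2_eqI)
      have Td: "T d \<in> L2 N" "S d \<in> L2 N" using T S d by (auto simp: bounded_ops_closed)
      show "op_add N T S (l2_add N c d) \<in> L2 N"
        "l2_add N (op_add N T S c) (op_add N T S d) \<in> L2 N"
        using c d T S by (auto simp: op_add_def bounded_ops_closed l2_add_closed)
      fix e assume "e \<in> L2 N"
      then show "l2_inner N (op_add N T S (l2_add N c d)) e =
          l2_inner N (l2_add N (op_add N T S c) (op_add N T S d)) e"
        using c d Tc Td T S by (simp add: op_add_def bounded_ops_add l2_add_closed l2_inner_add_left)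
    qed
    show "op_add N T S (l2_scale N a c) = l2_scale N a (op_add N T S c)" for a
    proof (rule L2_eqI)
      show "op_add N T S (l2_scale N a c) \<in> L2 N" "l2_scale N a (op_add N T S c) \<in> L2 N"
        using c Tc T S by (auto simp: op_add_def bounded_ops_closed l2_add_closed l2_scale_closed)
      fix e assume "e \<in> L2 N"
      then show "l2_inner N (op_add N T S (l2_scale N a c)) e = l2_inner N (l2_scale N a (op_add N T S c)) e"
        using c Tc T S
        by (simp add: op_add_def bounded_ops_scale l2_add_closed l2_scale_closed l2_inner_add_left
            l2_inner_scale_left distrib_left)
    qed
    show "l2_norm N (op_add N T S c) \<le> (K + L) * l2_norm N c"
      using l2_norm_triangle[OF Tc] K(2)[OF c] L(2)[OF c] c by (simp add: op_add_def distrib_right)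
  qed
qed

lemma von_neumann_algebra_add:
  assumes P: "von_neumann_algebra N P" and T: "T \<in> P" and S: "S \<in> P"
  shows "op_add N T S \<in> P"
proof -
  have b: "T \<in> bounded_ops N" "S \<in> bounded_ops N"
    using von_neumann_algebra_subset[OF P] T S by auto
  show ?thesis
  proof (rule von_neumann_algebraI_mem[OF P op_add_bounded[OF b]])
    fix A c assume A: "A \<in> commutant N P" and c: "c \<in> L2 N"
    have "A \<in> bounded_ops N" using A commutant_subset by blast
    then show "op_add N T S (A c) = A (op_add N T S c)"
      using c b
      by (simp add: op_add_def bounded_ops_closed bounded_ops_add commutantD[OF P A T] commutantD[OF P A S])
  qed
qed

lemma adjoint_ops_add:
  assumes "T \<in> bounded_ops N" "S \<in> bounded_ops N" "T' \<in> bounded_ops N" "S' \<in> bounded_ops N"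
    and "adjoint_ops N T T'" "adjoint_ops N S S'"
  shows "adjoint_ops N (op_add N T S) (op_add N T' S')"
  using assms by (simp add: adjoint_ops_def op_add_def bounded_ops_closed l2_inner_add_left l2_inner_add_right)

lemma vn_generated_subset:
  assumes "von_neumann_algebra N P" "S \<subseteq> P"
  shows "vn_generated N S \<subseteq> P"
  using assms by (auto simp: vn_generated_def)

lemma subset_vn_generated: "S \<subseteq> vn_generated N S"
  by (auto simp: vn_generated_def)

section \<open>Weighted composition operators\<close>

text \<open>The common form of multiplications, left translations and right multiplications. The
  form is stable under products and adjoints, so operator identities reduce to almost everywhere
  identities between weights and maps.\<close>

definition wc :: "'a measure \<Rightarrow> ('a \<Rightarrow> complex) \<Rightarrow> ('a \<Rightarrow> 'a) \<Rightarrow> 'a l2_op" where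
  "wc N w \<tau> = l2_lift N (\<lambda>\<xi> z. w z * \<xi> (\<tau> z))"

text \<open>Preservation of the measure makes composition with \<tau> respect null sets, hence act
  on classes, and makes it isometric.\<close>

definition wc_adm :: "'a measure \<Rightarrow> ('a \<Rightarrow> complex) \<Rightarrow> ('a \<Rightarrow> 'a) \<Rightarrow> bool" where
  "wc_adm N w \<tau> \<longleftrightarrow> w \<in> Linf N \<and> \<tau> \<in> measurable N N \<and> distr N N \<tau> = N"

lemma wc_admD:
  assumes "wc_adm N w \<tau>"
  shows wc_adm_weight: "w \<in> borel_measurable N" and wc_adm_map: "\<tau> \<in> measurable N N"
    and wc_adm_distr: "distr N N \<tau> = N"
  using assms by (auto simp: wc_adm_def Linf_def)

lemma AE_distr_self:
  assumes "\<tau> \<in> measurable N N" "distr N N \<tau> = N" "AE z in N. Q z"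
  shows "AE z in N. Q (\<tau> z)"
proof (rule AE_distrD[OF assms(1)])
  show "AE z in distr N N \<tau>. Q z"
    using assms(3) unfolding assms(2) .
qed

lemma l2_fun_comp:
  assumes [measurable]: "\<tau> \<in> measurable N N" and \<tau>: "distr N N \<tau> = N" and f: "f \<in> l2_fun N"
  shows "(\<lambda>z. f (\<tau> z)) \<in> l2_fun N" and "sq N (\<lambda>z. f (\<tau> z)) = sq N f"
proof -
  note [measurable] = l2_fun_measurable[OF f]
  have "integrable (distr N N \<tau>) (\<lambda>z. (cmod (f z))\<^sup>2)"
    using l2_fun_integrable[OF f] \<tau> by simp
  then have "integrable N (\<lambda>z. (cmod (f (\<tau> z)))\<^sup>2)"
    by (subst (asm) integrable_distr_eq) auto
  then show "(\<lambda>z. f (\<tau> z)) \<in> l2_fun N"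
    by (simp add: l2_fun_def)
  have "sq (distr N N \<tau>) f = sq N (\<lambda>z. f (\<tau> z))"
    unfolding sq_def by (rule integral_distr) auto
  then show "sq N (\<lambda>z. f (\<tau> z)) = sq N f" using \<tau> by simp
qed

lemma l2_fun_mult_Linf:
  assumes w: "w \<in> Linf N" and f: "f \<in> l2_fun N"
  shows "(\<lambda>z. w z * f z) \<in> l2_fun N"
proof -
  obtain K where [measurable]: "w \<in> borel_measurable N" and K: "AE z in N. cmod (w z) \<le> K"
    using w by (auto simp: Linf_def)
  note [measurable] = l2_fun_measurable[OF f]
  show ?thesis
  proof (rule l2_fun_bound[OF f, where K = K])
    show "AE z in N. cmod (w z * f z) \<le> K * cmod (f z)"
      using K by eventually_elim (simp add: norm_mult mult_right_mono)
  qed simp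
qed

lemma wc_fun:
  assumes "wc_adm N w \<tau>" "f \<in> l2_fun N"
  shows "(\<lambda>z. w z * f (\<tau> z)) \<in> l2_fun N"
  using assms l2_fun_comp(1) l2_fun_mult_Linf unfolding wc_adm_def by blast

lemma wc_cls:
  assumes adm: "wc_adm N w \<tau>" and f: "f \<in> l2_fun N"
  shows "wc N w \<tau> (l2_cls N f) = l2_cls N (\<lambda>z. w z * f (\<tau> z))"
proof -
  have "(\<Union>f'\<in>l2_cls N f. l2_rel N `` {\<lambda>z. w z * f' (\<tau> z)}) = l2_rel N `` {\<lambda>z. w z * f (\<tau> z)}"
  proof (rule l2_cls_UN[OF f])
    fix f' assume "f' \<in> l2_cls N f"
    then have f': "f' \<in> l2_fun N" "AE z in N. f z = f' z" by (auto simp: mem_l2_cls)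
    have "AE z in N. f (\<tau> z) = f' (\<tau> z)"
      using adm f'(2) by (intro AE_distr_self[of \<tau> N "\<lambda>z. f z = f' z"]) (auto simp: wc_adm_def)
    then show "l2_rel N `` {\<lambda>z. w z * f' (\<tau> z)} = l2_rel N `` {\<lambda>z. w z * f (\<tau> z)}"
      unfolding l2_cls_def[symmetric] by (intro l2_cls_eqI wc_fun adm f f'(1)) auto
  qed
  then show ?thesis using f by (simp add: wc_def l2_lift_def l2_cls_def[of N "\<lambda>z. w z * f (\<tau> z)"])
qed

lemma wc_bounded:
  assumes adm: "wc_adm N w \<tau>"
  shows "wc N w \<tau> \<in> bounded_ops N"
proof -
  note \<tau> = wc_adm_map[OF adm] wc_adm_distr[OF adm]
  obtain K where w [measurable]: "w \<in> borel_measurable N" and K: "AE z in N. cmod (w z) \<le> K"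
    using adm by (auto simp: wc_adm_def Linf_def)
  show ?thesis
  proof (rule bounded_opsI[where K = "\<bar>K\<bar>"])
    show "wc N w \<tau> \<in> L2 N \<rightarrow>\<^sub>E L2 N"
    proof (rule PiE_I)
      show "wc N w \<tau> c \<in> L2 N" if "c \<in> L2 N" for c
        using that by (auto elim!: L2E simp: wc_cls[OF adm] wc_fun[OF adm])
      show "wc N w \<tau> c = undefined" if "c \<notin> L2 N" for c
        using that by (simp add: wc_def l2_lift_def)
    qed
    fix c assume "c \<in> L2 N"
    then obtain f where f: "f \<in> l2_fun N" "c = l2_cls N f" by (rule L2E)
    show "wc N w \<tau> (l2_add N c d) = l2_add N (wc N w \<tau> c) (wc N w \<tau> d)" if "d \<in> L2 N" for d
      using that f
      by (auto elim!: L2E simp: wc_cls[OF adm] wc_fun[OF adm] l2_add_cls l2_fun_add distrib_left)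
    show "wc N w \<tau> (l2_scale N a c) = l2_scale N a (wc N w \<tau> c)" for a
      using f by (simp add: wc_cls[OF adm] wc_fun[OF adm] l2_scale_cls l2_fun_scale mult.left_commute)
    have "sq N (\<lambda>z. w z * f (\<tau> z)) \<le> (\<integral>z. K\<^sup>2 * (cmod (f (\<tau> z)))\<^sup>2 \<partial>N)"
      unfolding sq_def
    proof (rule integral_mono_AE)
      show "integrable N (\<lambda>z. (cmod (w z * f (\<tau> z)))\<^sup>2)"
        by (rule l2_fun_integrable[OF wc_fun[OF adm f(1)]])
      show "integrable N (\<lambda>z. K\<^sup>2 * (cmod (f (\<tau> z)))\<^sup>2)"
        by (intro integrable_mult_right l2_fun_integrable[OF l2_fun_comp(1)[OF \<tau> f(1)]])
      show "AE z in N. (cmod (w z * f (\<tau> z)))\<^sup>2 \<le> K\<^sup>2 * (cmod (f (\<tau> z)))\<^sup>2"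
        using K by eventually_elim
          (simp add: norm_mult power_mult_distrib, intro mult_right_mono power_mono, auto)
    qed
    also have "\<dots> = K\<^sup>2 * sq N f"
      using l2_fun_comp(2)[OF \<tau> f(1)] by (simp add: sq_def)
    finally have "sqrt (sq N (\<lambda>z. w z * f (\<tau> z))) \<le> sqrt (K\<^sup>2 * sq N f)"
      by (rule real_sqrt_le_mono)
    then show "l2_norm N (wc N w \<tau> c) \<le> \<bar>K\<bar> * l2_norm N c"
      using f by (simp add: wc_cls[OF adm] wc_fun[OF adm] l2_norm_cls real_sqrt_mult)
  qed
qed

lemma Linf_measurable: "f \<in> Linf N \<Longrightarrow> f \<in> borel_measurable N"
  by (simp add: Linf_def)

lemma Linf_comp:
  assumes "f \<in> Linf N" "\<tau> \<in> measurable N N" "distr N N \<tau> = N"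
  shows "(\<lambda>z. f (\<tau> z)) \<in> Linf N"
proof -
  obtain K where "AE z in N. cmod (f z) \<le> K" using assms(1) by (auto simp: Linf_def)
  then have "AE z in N. cmod (f (\<tau> z)) \<le> K" using assms by (intro AE_distr_self[of \<tau> N "\<lambda>z. cmod (f z) \<le> K"])
  then show ?thesis using assms by (auto simp: Linf_def intro: measurable_compose)
qed

lemma Linf_mult:
  assumes "f \<in> Linf N" "g \<in> Linf N"
  shows "(\<lambda>z. f z * g z) \<in> Linf N"
proof -
  obtain K L where K: "AE z in N. cmod (f z) \<le> K" "AE z in N. cmod (g z) \<le> L"
    using assms by (auto simp: Linf_def)
  have "AE z in N. cmod (f z * g z) \<le> \<bar>K\<bar> * \<bar>L\<bar>"
    using K by eventually_elim (auto simp: norm_mult intro!: mult_mono)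
  then show ?thesis using assms by (auto simp: Linf_def)
qed

lemma Linf_add:
  assumes "f \<in> Linf N" "g \<in> Linf N"
  shows "(\<lambda>z. f z + g z) \<in> Linf N"
proof -
  obtain K L where K: "AE z in N. cmod (f z) \<le> K" "AE z in N. cmod (g z) \<le> L"
    using assms by (auto simp: Linf_def)
  have "AE z in N. cmod (f z + g z) \<le> K + L"
    using K by eventually_elim (auto intro: order_trans[OF norm_triangle_ineq])
  then show ?thesis using assms by (auto simp: Linf_def)
qed

lemma Linf_cnj: "f \<in> Linf N \<Longrightarrow> (\<lambda>z. cnj (f z)) \<in> Linf N"
  by (auto simp: Linf_def intro: borel_measurable_cnj)

lemma Linf_const [simp]: "(\<lambda>z. c) \<in> Linf N"
  by (auto simp: Linf_def)

lemma wc_adm_compose: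
  assumes "wc_adm N w \<tau>" "wc_adm N w' \<tau>'"
  shows "wc_adm N (\<lambda>z. w z * w' (\<tau> z)) (\<lambda>z. \<tau>' (\<tau> z))"
proof -
  have m: "\<tau> \<in> measurable N N" "\<tau>' \<in> measurable N N" using assms by (auto simp: wc_adm_def)
  have "distr N N (\<tau>' \<circ> \<tau>) = distr (distr N N \<tau>) N \<tau>'"
    by (rule distr_distr[symmetric]) (use m in auto)
  then have "distr N N (\<lambda>z. \<tau>' (\<tau> z)) = N"
    using assms by (simp add: wc_adm_def comp_def)
  then show ?thesis
    using assms by (auto simp: wc_adm_def intro!: Linf_mult Linf_comp intro: measurable_compose)
qed

lemma wc_compose:
  assumes "wc_adm N w \<tau>" "wc_adm N w' \<tau>'"
  shows "compose (L2 N) (wc N w \<tau>) (wc N w' \<tau>') = wc N (\<lambda>z. w z * w' (\<tau> z)) (\<lambda>z. \<tau>' (\<tau> z))"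
proof (rule bounded_ops_eqI)
  fix c assume "c \<in> L2 N"
  then show "compose (L2 N) (wc N w \<tau>) (wc N w' \<tau>') c = wc N (\<lambda>z. w z * w' (\<tau> z)) (\<lambda>z. \<tau>' (\<tau> z)) c"
    using assms wc_adm_compose[OF assms] by (auto elim!: L2E simp: compose_eq wc_cls wc_fun mult.assoc)
qed (use assms wc_adm_compose[OF assms] in \<open>auto intro!: bounded_ops_compose wc_bounded\<close>)

lemma wc_cong:
  assumes "wc_adm N w \<tau>" "wc_adm N w' \<tau>'" "AE z in N. w z = w' z \<and> \<tau> z = \<tau>' z"
  shows "wc N w \<tau> = wc N w' \<tau>'"
proof (rule bounded_ops_eqI)
  fix c assume "c \<in> L2 N"
  then obtain f where f: "f \<in> l2_fun N" "c = l2_cls N f" by (rule L2E)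
  have "AE z in N. w z * f (\<tau> z) = w' z * f (\<tau>' z)"
    using assms(3) by eventually_elim simp
  then show "wc N w \<tau> c = wc N w' \<tau>' c"
    unfolding f(2) wc_cls[OF assms(1) f(1)] wc_cls[OF assms(2) f(1)]
    by (intro l2_cls_eqI wc_fun[OF assms(1) f(1)] wc_fun[OF assms(2) f(1)])
qed (use assms in \<open>auto intro!: wc_bounded\<close>)

text \<open>The substitution z \<mapsto> \<tau>' z in the integral. The inverse map preserves the
  measure as well: push \<open>N\<close>, which is its own image under \<tau>, forward by
  \<tau>'.\<close>

lemma wc_adjoint:
  assumes adm: "wc_adm N w \<tau>" and \<tau>': "\<tau>' \<in> measurable N N"
    and inv: "\<And>z. z \<in> space N \<Longrightarrow> \<tau>' (\<tau> z) = z" "\<And>z. z \<in> space N \<Longrightarrow> \<tau> (\<tau>' z) = z"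
  shows "wc_adm N (\<lambda>z. cnj (w (\<tau>' z))) \<tau>'"
    and "adjoint_ops N (wc N w \<tau>) (wc N (\<lambda>z. cnj (w (\<tau>' z))) \<tau>')"
proof -
  note \<tau> [measurable] = wc_adm_map[OF adm] and [measurable] = \<tau>' wc_adm_weight[OF adm]
  have "distr N N \<tau>' = distr (distr N N \<tau>) N \<tau>'"
    using wc_adm_distr[OF adm] by simp
  also have "\<dots> = distr N N (\<tau>' \<circ> \<tau>)"
    by (rule distr_distr) auto
  also have "\<dots> = N"
    using inv by (intro distr_cong[of N N N N "\<tau>' \<circ> \<tau>" "\<lambda>x. x", simplified distr_id2, THEN trans]) auto
  finally have d': "distr N N \<tau>' = N" .
  show adm': "wc_adm N (\<lambda>z. cnj (w (\<tau>' z))) \<tau>'"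
    using adm d' \<tau>' by (auto simp: wc_adm_def intro: Linf_cnj Linf_comp)
  show "adjoint_ops N (wc N w \<tau>) (wc N (\<lambda>z. cnj (w (\<tau>' z))) \<tau>')"
    unfolding adjoint_ops_def
  proof (intro ballI)
    fix c d assume "c \<in> L2 N" "d \<in> L2 N"
    then obtain f g where f: "f \<in> l2_fun N" "c = l2_cls N f" and g: "g \<in> l2_fun N" "d = l2_cls N g"
      by (auto elim!: L2E)
    note [measurable] = l2_fun_measurable[OF f(1)] l2_fun_measurable[OF g(1)]
    have "ip N (\<lambda>z. w z * f (\<tau> z)) g = (\<integral>z. w z * f (\<tau> z) * cnj (g z) \<partial>distr N N \<tau>')"
      by (simp add: ip_def d')
    also have "\<dots> = (\<integral>z. w (\<tau>' z) * f (\<tau> (\<tau>' z)) * cnj (g (\<tau>' z)) \<partial>N)"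
      by (rule integral_distr) auto
    also have "\<dots> = ip N f (\<lambda>z. cnj (w (\<tau>' z)) * g (\<tau>' z))"
      unfolding ip_def using inv by (intro Bochner_Integration.integral_cong) (auto simp: mult_ac)
    finally show "l2_inner N (wc N w \<tau> c) d = l2_inner N c (wc N (\<lambda>z. cnj (w (\<tau>' z))) \<tau>' d)"
      using f g adm adm'
      by (simp add: wc_cls wc_fun[OF adm f(1)] wc_fun[OF adm' g(1)] l2_inner_cls)
  qed
qed

section \<open>The crossed product and its commutant\<close>

text \<open>The truncation of \<open>u\<close> to the set where its modulus is at most n is itself a
  bounded test function. It vanishes for every n, and these sets exhaust the space.\<close>

lemma AE_zero_if_orthogonal_Linf:
  assumes u: "u \<in> l2_fun M" and *: "\<And>k. k \<in> Linf M \<Longrightarrow> ip M u k = 0"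
  shows "AE x in M. u x = 0"
proof -
  note [measurable] = l2_fun_measurable[OF u]
  have "AE x in M. \<forall>n::nat. cmod (u x) \<le> real n \<longrightarrow> u x = 0"
  proof (subst AE_all_countable, rule allI)
    fix n :: nat
    define k where "k x = (if cmod (u x) \<le> real n then u x else 0)" for x
    have [measurable]: "k \<in> borel_measurable M"
      unfolding k_def by measurable
    have k: "k \<in> Linf M"
      unfolding Linf_def by (auto simp: k_def intro!: exI[of _ "real n"])
    have k2: "k \<in> l2_fun M"
      by (rule l2_fun_bound[OF u, where K = 1]) (auto simp: k_def)
    have "ip M k k = ip M u k"
      unfolding ip_def by (intro Bochner_Integration.integral_cong) (auto simp: k_def)
    then have "sq M k = 0"
      using *[OF k] by (simp add: ip_self)
    then have "AE x in M. k x = 0"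
      by (simp add: sq_eq_0_iff[OF k2])
    then show "AE x in M. cmod (u x) \<le> real n \<longrightarrow> u x = 0"
      by eventually_elim (auto simp: k_def split: if_splits)
  qed
  then show ?thesis
  proof eventually_elim
    case (elim x)
    then show ?case using real_arch_simple[of "cmod (u x)"] by blast
  qed
qed

section \<open>The product of the space with the group, slice by slice\<close>

locale pmp_setting =
  fixes G :: "('g, 'b) monoid_scheme" (structure)
    and M :: "'x measure"
    and \<alpha> :: "'g \<Rightarrow> 'x \<Rightarrow> 'x"
  assumes group: "group G" and countable_G: "countable (carrier G)" and pmp: "pmp_action G M \<alpha>"
begin

abbreviation N :: "('x \<times> 'g) measure" where "N \<equiv> cp_space G M"

sublocale group G by (rule group)

sublocale prob_space M using pmp by (simp add: pmp_action_def)

lemma act_measurable [measurable]: "g \<in> carrier G \<Longrightarrow> \<alpha> g \<in> measurable M M"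
  and act_distr: "g \<in> carrier G \<Longrightarrow> distr M M (\<alpha> g) = M"
  using pmp by (auto simp: pmp_action_def)

lemma act_space: "g \<in> carrier G \<Longrightarrow> x \<in> space M \<Longrightarrow> \<alpha> g x \<in> space M"
  using act_measurable by (rule measurable_space)

lemma act_one: "x \<in> space M \<Longrightarrow> \<alpha> \<one> x = x"
  using pmp group_action.id_eq_one[of G "space M" \<alpha>] by (metis pmp_action_def restrict_apply')

lemma act_mult:
  assumes "g \<in> carrier G" "h \<in> carrier G" "x \<in> space M"
  shows "\<alpha> (g \<otimes> h) x = \<alpha> g (\<alpha> h x)"
  using pmp group_action.composition_rule[of G "space M" \<alpha> x g h] assms by (simp add: pmp_action_def)

lemma act_inv:
  assumes "g \<in> carrier G" "x \<in> space M"
  shows "\<alpha> (inv g) (\<alpha> g x) = x" "\<alpha> g (\<alpha> (inv g) x) = x"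
  using assms by (simp_all add: act_mult[symmetric] act_one)

lemma space_N: "space N = space M \<times> carrier G"
  by (simp add: cp_space_def space_pair_measure)

lemma sigma_finite_G: "sigma_finite_measure (count_space (carrier G))"
  using countable_G by (rule sigma_finite_measure_count_space_countable)

text \<open>Countability of the group reduces measurability on the product to the slices;
  \<open>AE_N_iff\<close> does the same for null sets.\<close>

lemma measurable_N_iff:
  "f \<in> measurable N K \<longleftrightarrow> (\<forall>s\<in>carrier G. (\<lambda>x. f (x, s)) \<in> measurable M K)"
proof
  assume [measurable]: "f \<in> measurable N K"
  show "\<forall>s\<in>carrier G. (\<lambda>x. f (x, s)) \<in> measurable M K"
  proof
    fix s assume "s \<in> carrier G"
    then have "(\<lambda>x. (x, s)) \<in> measurable M N" by (auto simp: cp_space_def)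
    then show "(\<lambda>x. f (x, s)) \<in> measurable M K" by measurable
  qed
next
  assume *: "\<forall>s\<in>carrier G. (\<lambda>x. f (x, s)) \<in> measurable M K"
  have "(\<lambda>z. f (fst z, snd z)) \<in> measurable N K"
    by (rule measurable_compose_countable'[where f = "\<lambda>s z. f (fst z, s)" and g = snd and I = "carrier G"])
       (use * countable_G in \<open>auto simp: cp_space_def intro: measurable_compose[OF measurable_fst]\<close>)
  then show "f \<in> measurable N K" by simp
qed

lemma measurable_Pair_N: "s \<in> carrier G \<Longrightarrow> (\<lambda>x. (x, s)) \<in> measurable M N"
  by (auto simp: cp_space_def)

lemma measurable_fst_N [measurable]: "fst \<in> measurable N M"
  and measurable_snd_N [measurable]: "snd \<in> measurable N (count_space (carrier G))"
  by (auto simp: cp_space_def)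

lemma emeasure_N_slice:
  assumes "A \<in> sets M" "t \<in> carrier G"
  shows "A \<times> {t} \<in> sets N" "emeasure N (A \<times> {t}) = emeasure M A"
  using assms sigma_finite_measure.emeasure_pair_measure_Times[OF sigma_finite_G, of A M "{t}"]
  by (auto simp: cp_space_def)

text \<open>The slice over \<open>t\<close> is a copy of \<open>M\<close>. All integrals over single
  slices come from this identity of measures by change of variables and densities.\<close>

lemma distr_slice:
  assumes t: "t \<in> carrier G"
  shows "distr M N (\<lambda>x. (x, t)) = density N (indicator {z \<in> space N. snd z = t})"
proof (rule measure_eqI)
  note [measurable] = measurable_Pair_N[OF t]
  have S: "{z \<in> space N. snd z = t} = space M \<times> {t}"
    using t by (auto simp: space_N)
  have S': "{z \<in> space N. snd z = t} \<in> sets N"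
    unfolding S by (intro emeasure_N_slice t) simp
  fix A assume "A \<in> sets (distr M N (\<lambda>x. (x, t)))"
  then have A: "A \<in> sets N" by simp
  have "{z \<in> space N. snd z = t} \<inter> A = ((\<lambda>x. (x, t)) -` A \<inter> space M) \<times> {t}"
    using sets.sets_into_space[OF A] t by (auto simp: space_N)
  moreover have "(\<lambda>x. (x, t)) -` A \<inter> space M \<in> sets M"
    using A by measurable
  ultimately show "emeasure (distr M N (\<lambda>x. (x, t))) A =
      emeasure (density N (indicator {z \<in> space N. snd z = t})) A"
    using A t S' by (simp add: emeasure_distr emeasure_restricted emeasure_N_slice)
qed simp

lemma slice_set [measurable]: "t \<in> carrier G \<Longrightarrow> {z \<in> space N. snd z = t} \<in> sets N"
  by measurable

lemma AE_N_iff: "(AE z in N. Q z) \<longleftrightarrow> (\<forall>s\<in>carrier G. AE x in M. Q (x, s))"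
proof
  assume Q: "AE z in N. Q z"
  show "\<forall>s\<in>carrier G. AE x in M. Q (x, s)"
  proof
    fix t assume t: "t \<in> carrier G"
    have "AE z in distr M N (\<lambda>x. (x, t)). Q z"
      unfolding distr_slice[OF t] by (subst AE_density) (use Q t in \<open>auto intro: slice_set\<close>)
    then show "AE x in M. Q (x, t)"
      by (rule AE_distrD[OF measurable_Pair_N[OF t]])
  qed
next
  assume *: "\<forall>s\<in>carrier G. AE x in M. Q (x, s)"
  have "\<exists>Z. Z \<in> null_sets M \<and> {x \<in> space M. \<not> Q (x, s)} \<subseteq> Z" if "s \<in> carrier G" for s
    using * that by (auto simp: eventually_ae_filter)
  then obtain Z where Z: "\<And>s. s \<in> carrier G \<Longrightarrow> Z s \<in> null_sets M"
    "\<And>s. s \<in> carrier G \<Longrightarrow> {x \<in> space M. \<not> Q (x, s)} \<subseteq> Z s"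
    by metis
  have "(\<Union>s\<in>carrier G. Z s \<times> {s}) \<in> null_sets N"
    using Z(1) emeasure_N_slice by (intro null_sets_UN' countable_G) (auto simp: null_sets_def)
  moreover have "{z \<in> space N. \<not> Q z} \<subseteq> (\<Union>s\<in>carrier G. Z s \<times> {s})"
    using Z(2) by (fastforce simp: space_N)
  ultimately show "AE z in N. Q z" by (rule AE_I')
qed

lemma integrable_slice:
  fixes F :: "'x \<times> 'g \<Rightarrow> 'c::{banach, second_countable_topology}"
  assumes F: "integrable N F" and t: "t \<in> carrier G"
  shows "integrable M (\<lambda>x. F (x, t))"
    and "(\<integral>z. indicator {z. snd z = t} z *\<^sub>R F z \<partial>N) = (\<integral>x. F (x, t) \<partial>M)"
proof -
  note [measurable] = borel_measurable_integrable[OF F] slice_set[OF t]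
  have ind: "density N (indicator {z \<in> space N. snd z = t}) =
      density N (\<lambda>z. ennreal (indicator {z \<in> space N. snd z = t} z))"
    by (simp add: ennreal_indicator)
  have "integrable (distr M N (\<lambda>x. (x, t))) F"
    unfolding distr_slice[OF t] ind
    by (subst integrable_density) (use F in \<open>auto intro!: integrable_mult_indicator\<close>)
  then show "integrable M (\<lambda>x. F (x, t))"
    by (subst (asm) integrable_distr_eq) (auto intro: measurable_Pair_N[OF t])
  have "(\<integral>x. F (x, t) \<partial>M) = (\<integral>z. F z \<partial>distr M N (\<lambda>x. (x, t)))"
    by (rule integral_distr[symmetric]) (auto intro: measurable_Pair_N[OF t])
  also have "\<dots> = (\<integral>z. indicator {z \<in> space N. snd z = t} z *\<^sub>R F z \<partial>N)"
    unfolding distr_slice[OF t] ind by (subst integral_density) auto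
  also have "\<dots> = (\<integral>z. indicator {z. snd z = t} z *\<^sub>R F z \<partial>N)"
    by (intro Bochner_Integration.integral_cong) (auto simp: indicator_def)
  finally show "(\<integral>z. indicator {z. snd z = t} z *\<^sub>R F z \<partial>N) = (\<integral>x. F (x, t) \<partial>M)" ..
qed

lemma l2_fun_slice:
  assumes f: "f \<in> l2_fun N" and t: "t \<in> carrier G"
  shows "(\<lambda>x. f (x, t)) \<in> l2_fun M"
  using integrable_slice(1)[OF l2_fun_integrable[OF f] t] l2_fun_measurable[OF f] t
  by (auto simp: l2_fun_def measurable_N_iff)

text \<open>The elementary tensor of \<open>k\<close> with the point mass at
  \<open>t\<close>.\<close>

definition fibre :: "'g \<Rightarrow> ('x \<Rightarrow> complex) \<Rightarrow> 'x \<times> 'g \<Rightarrow> complex" where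
  "fibre t k z = (if snd z = t then k (fst z) else 0)"

lemma distr_N:
  assumes "\<tau> \<in> measurable M M" "distr M M \<tau> = M" "bij_betw \<rho> (carrier G) (carrier G)"
  shows "(\<lambda>z. (\<tau> (fst z), \<rho> (snd z))) \<in> measurable N N"
    and "distr N N (\<lambda>z. (\<tau> (fst z), \<rho> (snd z))) = N"
proof -
  have \<rho>: "\<rho> \<in> measurable (count_space (carrier G)) (count_space (carrier G))"
    using assms(3) by (auto simp: bij_betw_def)
  show "(\<lambda>z. (\<tau> (fst z), \<rho> (snd z))) \<in> measurable N N"
    using assms(1) \<rho> unfolding cp_space_def by measurable
  have "distr M M \<tau> \<Otimes>\<^sub>M distr (count_space (carrier G)) (count_space (carrier G)) \<rho> =
      distr (M \<Otimes>\<^sub>M count_space (carrier G)) (M \<Otimes>\<^sub>M count_space (carrier G)) (\<lambda>(x, y). (\<tau> x, \<rho> y))"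
    using assms(1) \<rho>
    by (rule pair_measure_distr) (simp add: distr_bij_count_space assms(3) sigma_finite_G)
  then show "distr N N (\<lambda>z. (\<tau> (fst z), \<rho> (snd z))) = N"
    by (simp add: distr_bij_count_space assms(2,3) cp_space_def split_beta')
qed

lemma fibre_l2:
  assumes k: "k \<in> l2_fun M" and t: "t \<in> carrier G"
  shows "fibre t k \<in> l2_fun N"
proof -
  note [measurable] = l2_fun_measurable[OF k]
  have m: "fibre t k \<in> borel_measurable N"
    unfolding measurable_N_iff fibre_def fst_conv snd_conv by measurable
  have "(\<integral>\<^sup>+z. ennreal ((cmod (fibre t k z))\<^sup>2) \<partial>N) =
      (\<integral>\<^sup>+z. ennreal ((cmod (k (fst z)))\<^sup>2) * indicator {z \<in> space N. snd z = t} z \<partial>N)"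
    by (intro nn_integral_cong) (auto simp: fibre_def indicator_def)
  also have "\<dots> = (\<integral>\<^sup>+z. ennreal ((cmod (k (fst z)))\<^sup>2) \<partial>distr M N (\<lambda>x. (x, t)))"
    unfolding distr_slice[OF t] using slice_set[OF t]
    by (subst nn_integral_density) (auto simp: mult.commute)
  also have "\<dots> = (\<integral>\<^sup>+x. ennreal ((cmod (k x))\<^sup>2) \<partial>M)"
    by (subst nn_integral_distr) (auto intro: measurable_Pair_N[OF t])
  also have "\<dots> < \<infinity>"
    by (simp add: nn_integral_sq[OF k])
  finally show ?thesis using m by (simp add: l2_fun_def integrable_iff_bounded)
qed

lemma ip_fibre:
  assumes f: "f \<in> l2_fun N" and k: "k \<in> l2_fun M" and t: "t \<in> carrier G"
  shows "ip N f (fibre t k) = ip M (\<lambda>x. f (x, t)) k"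
proof -
  have "ip N f (fibre t k) = (\<integral>z. indicator {z. snd z = t} z *\<^sub>R (f z * cnj (fibre t k z)) \<partial>N)"
    unfolding ip_def by (intro Bochner_Integration.integral_cong) (auto simp: fibre_def)
  also have "\<dots> = (\<integral>x. f (x, t) * cnj (fibre t k (x, t)) \<partial>M)"
    by (intro integrable_slice(2) integrable_l2_prod f fibre_l2 k t)
  finally show ?thesis by (simp add: ip_def fibre_def)
qed

lemma Linf_l2: "k \<in> Linf M \<Longrightarrow> k \<in> l2_fun M"
proof -
  assume k: "k \<in> Linf M"
  have "(\<lambda>x. 1 :: complex) \<in> l2_fun M" by (simp add: l2_fun_def)
  from l2_fun_mult_Linf[OF k this] show ?thesis by simp
qed

lemma Linf_act: "k \<in> Linf M \<Longrightarrow> g \<in> carrier G \<Longrightarrow> (\<lambda>x. k (\<alpha> g x)) \<in> Linf M"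
  by (rule Linf_comp) (auto simp: act_distr)

text \<open>\<open>R k g\<close> is right multiplication by \<open>u\<^sub>g k\<close> on the image of the crossed product in \<open>L\<^sup>2(N)\<close>.\<close>

definition U_map :: "'g \<Rightarrow> 'x \<times> 'g \<Rightarrow> 'x \<times> 'g" where
  "U_map g z = (\<alpha> (inv g) (fst z), inv g \<otimes> snd z)"

text \<open>In \<xi> u_g k, moving \<open>k\<close> to the left of u_s replaces it by k o s^-1; this
  is its value over s.\<close>

definition R_weight :: "('x \<Rightarrow> complex) \<Rightarrow> 'x \<times> 'g \<Rightarrow> complex" where
  "R_weight k z = k (\<alpha> (inv (snd z)) (fst z))"

definition R_map :: "'g \<Rightarrow> 'x \<times> 'g \<Rightarrow> 'x \<times> 'g" where
  "R_map g z = (fst z, snd z \<otimes> inv g)"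

abbreviation U :: "'g \<Rightarrow> ('x \<times> 'g) l2_op" where "U \<equiv> group_op G M \<alpha>"
abbreviation m_op :: "('x \<Rightarrow> complex) \<Rightarrow> ('x \<times> 'g) l2_op" where "m_op \<equiv> mult_op G M"

definition R :: "('x \<Rightarrow> complex) \<Rightarrow> 'g \<Rightarrow> ('x \<times> 'g) l2_op" where
  "R k g = wc N (R_weight k) (R_map g)"

lemma U_eq: "U g = wc N (\<lambda>z. 1) (U_map g)"
  by (simp add: group_op_def wc_def U_map_def split_beta')

lemma m_op_eq: "m_op f = wc N (\<lambda>z. f (fst z)) (\<lambda>z. z)"
  by (simp add: mult_op_def wc_def split_beta')

lemma bij_mult_left: "g \<in> carrier G \<Longrightarrow> bij_betw (\<lambda>s. g \<otimes> s) (carrier G) (carrier G)"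
  by (rule bij_betw_byWitness[where f' = "\<lambda>s. inv g \<otimes> s"]) (auto simp: m_assoc[symmetric])

lemma bij_mult_right: "g \<in> carrier G \<Longrightarrow> bij_betw (\<lambda>s. s \<otimes> g) (carrier G) (carrier G)"
  by (rule bij_betw_byWitness[where f' = "\<lambda>s. s \<otimes> inv g"]) (auto simp: m_assoc)

lemma U_adm: "g \<in> carrier G \<Longrightarrow> wc_adm N (\<lambda>z. 1) (U_map g)"
  unfolding wc_adm_def U_map_def
  using distr_N[OF act_measurable[of "inv g"] act_distr[of "inv g"] bij_mult_left[of "inv g"]] by simp

lemma Linf_fst:
  assumes "f \<in> Linf M"
  shows "(\<lambda>z. f (fst z)) \<in> Linf N"
proof -
  obtain K where "AE x in M. cmod (f x) \<le> K" using assms by (auto simp: Linf_def)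
  then have "AE z in N. cmod (f (fst z)) \<le> K" by (simp add: AE_N_iff)
  then show ?thesis using Linf_measurable[OF assms] by (auto simp: Linf_def)
qed

lemma m_adm: "f \<in> Linf M \<Longrightarrow> wc_adm N (\<lambda>z. f (fst z)) (\<lambda>z. z)"
  by (simp add: wc_adm_def Linf_fst distr_id2)

lemma R_adm:
  assumes k: "k \<in> Linf M" and g: "g \<in> carrier G"
  shows "wc_adm N (R_weight k) (R_map g)"
proof -
  obtain K where K: "AE x in M. cmod (k x) \<le> K" using k by (auto simp: Linf_def)
  note [measurable] = Linf_measurable[OF k]
  have "AE z in N. cmod (R_weight k z) \<le> K"
    unfolding AE_N_iff R_weight_def
    using AE_distr_self[OF act_measurable act_distr K] by simp
  moreover have "R_weight k \<in> borel_measurable N"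
    unfolding measurable_N_iff R_weight_def by simp
  ultimately have "R_weight k \<in> Linf N" by (auto simp: Linf_def)
  then show ?thesis
    unfolding wc_adm_def R_map_def
    using distr_N[of "\<lambda>x. x", OF _ _ bij_mult_right[of "inv g"]] g by (simp add: distr_id2)
qed

lemma U_bounded: "g \<in> carrier G \<Longrightarrow> U g \<in> bounded_ops N"
  unfolding U_eq by (intro wc_bounded U_adm)

lemma m_op_bounded: "f \<in> Linf M \<Longrightarrow> m_op f \<in> bounded_ops N"
  unfolding m_op_eq by (intro wc_bounded m_adm)

lemma R_bounded: "k \<in> Linf M \<Longrightarrow> g \<in> carrier G \<Longrightarrow> R k g \<in> bounded_ops N"
  unfolding R_def by (intro wc_bounded R_adm)

lemma U_map_inv: "g \<in> carrier G \<Longrightarrow> z \<in> space N \<Longrightarrow> U_map (inv g) (U_map g z) = z"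
  by (auto simp: U_map_def space_N act_inv m_assoc[symmetric])

lemma U_adjoint:
  assumes g: "g \<in> carrier G"
  shows "adjoint_ops N (U g) (U (inv g))"
  using wc_adjoint(2)[OF U_adm[OF g] wc_adm_map[OF U_adm[of "inv g"]]] g
    U_map_inv[OF g] U_map_inv[of "inv g"]
  by (simp add: U_eq)

lemma m_op_adjoint:
  assumes f: "f \<in> Linf M"
  shows "adjoint_ops N (m_op f) (m_op (\<lambda>x. cnj (f x)))"
  using wc_adjoint(2)[OF m_adm[OF f], of "\<lambda>z. z"] by (simp add: m_op_eq)

text \<open>With k* the conjugate of \<open>k\<close>, the adjoint of u_g k is k* u_(g^-1) =
  u_(g^-1) (k* o g^-1), again of the same form.\<close>

lemma R_adjoint:
  assumes k: "k \<in> Linf M" and g: "g \<in> carrier G"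
  shows "adjoint_ops N (R k g) (R (\<lambda>x. cnj (k (\<alpha> (inv g) x))) (inv g))"
proof -
  let ?k = "\<lambda>x. cnj (k (\<alpha> (inv g) x))"
  have k': "?k \<in> Linf M" using g by (intro Linf_cnj Linf_act k) auto
  have m: "R_map (inv g) \<in> measurable N N"
    using R_adm[OF k' inv_closed[OF g]] by (rule wc_adm_map)
  note adj = wc_adjoint[OF R_adm[OF k g] m]
  have inv: "R_map (inv g) (R_map g z) = z" "R_map g (R_map (inv g) z) = z" if "z \<in> space N" for z
    using that g by (auto simp: R_map_def space_N m_assoc)
  have "wc N (\<lambda>z. cnj (R_weight k (R_map (inv g) z))) (R_map (inv g)) = R ?k (inv g)"
    unfolding R_def
  proof (rule wc_cong)
    show "AE z in N. cnj (R_weight k (R_map (inv g) z)) = R_weight ?k z \<and> R_map (inv g) z = R_map (inv g) z"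
      using g by (auto simp: R_weight_def R_map_def space_N inv_mult_group act_mult)
  qed (use adj(1) inv R_adm k' g in auto)
  then show ?thesis
    using adj(2) inv by (simp add: R_def)
qed

section \<open>Right multiplications and their commutant\<close>

definition right_ops :: "('x \<times> 'g) l2_op set" where
  "right_ops = {R k g | k g. k \<in> Linf M \<and> g \<in> carrier G}"

lemma right_ops_bounded: "right_ops \<subseteq> bounded_ops N"
  by (auto simp: right_ops_def R_bounded)

lemma right_ops_adjoint: "A \<in> right_ops \<Longrightarrow> \<exists>A'\<in>right_ops. adjoint_ops N A A'"
  unfolding right_ops_def using R_adjoint by (fastforce intro: Linf_cnj Linf_act)

text \<open>It stands in for the crossed product below: what the arguments use of an element of
  \<open>P\<close> or of the crossed product is that it commutes with right multiplications.\<close>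

definition right_commutant :: "('x \<times> 'g) l2_op set" where
  "right_commutant = commutant N right_ops"

lemma right_commutant_vna: "von_neumann_algebra N right_commutant"
  unfolding right_commutant_def by (intro von_neumann_algebra_commutant right_ops_bounded right_ops_adjoint)

lemma right_commutant_bounded: "T \<in> right_commutant \<Longrightarrow> T \<in> bounded_ops N"
  using commutant_subset by (auto simp: right_commutant_def)

lemma right_commutant_R: "T \<in> right_commutant \<Longrightarrow> k \<in> Linf M \<Longrightarrow> g \<in> carrier G \<Longrightarrow> c \<in> L2 N \<Longrightarrow> T (R k g c) = R k g (T c)"
  unfolding right_commutant_def mem_commutant_iff[OF right_ops_bounded] by (auto simp: right_ops_def)

lemma m_op_right_commutant:
  assumes f: "f \<in> Linf M"
  shows "m_op f \<in> right_commutant"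
proof -
  have "compose (L2 N) (m_op f) (R k g) = compose (L2 N) (R k g) (m_op f)"
    if k: "k \<in> Linf M" and g: "g \<in> carrier G" for k g
    unfolding m_op_eq R_def wc_compose[OF m_adm[OF f] R_adm[OF k g]] wc_compose[OF R_adm[OF k g] m_adm[OF f]]
    by (rule wc_cong[OF wc_adm_compose[OF m_adm[OF f] R_adm[OF k g]] wc_adm_compose[OF R_adm[OF k g] m_adm[OF f]]])
       (auto simp: R_map_def mult.commute)
  then show ?thesis
    using m_op_bounded[OF f] by (auto simp: right_commutant_def commutant_def right_ops_def)
qed

lemma U_right_commutant:
  assumes h: "h \<in> carrier G"
  shows "U h \<in> right_commutant"
proof -
  have "compose (L2 N) (U h) (R k g) = compose (L2 N) (R k g) (U h)"
    if k: "k \<in> Linf M" and g: "g \<in> carrier G" for k g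
    unfolding U_eq R_def wc_compose[OF U_adm[OF h] R_adm[OF k g]] wc_compose[OF R_adm[OF k g] U_adm[OF h]]
  proof (rule wc_cong[OF wc_adm_compose[OF U_adm[OF h] R_adm[OF k g]] wc_adm_compose[OF R_adm[OF k g] U_adm[OF h]]])
    show "AE z in N. 1 * R_weight k (U_map h z) = R_weight k z * 1 \<and> R_map g (U_map h z) = U_map h (R_map g z)"
      using h g by (auto simp: R_weight_def R_map_def U_map_def space_N inv_mult_group act_mult act_inv m_assoc act_space)
  qed
  then show ?thesis
    using U_bounded[OF h] by (auto simp: right_commutant_def commutant_def right_ops_def)
qed

lemma crossed_product_right_commutant: "crossed_product G M \<alpha> \<subseteq> right_commutant"
  unfolding crossed_product_def
  by (intro vn_generated_subset right_commutant_vna) (auto intro: m_op_right_commutant U_right_commutant)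

section \<open>The vector at the identity\<close>

definition \<Omega> :: "('x \<times> 'g \<Rightarrow> complex) set" where
  "\<Omega> = l2_cls N (fibre \<one> (\<lambda>x. 1))"

lemma Omega_fun: "fibre \<one> (\<lambda>x. 1) \<in> l2_fun N"
  by (intro fibre_l2 Linf_l2) auto

lemma Omega_L2 [simp]: "\<Omega> \<in> L2 N"
  unfolding \<Omega>_def by (intro l2_cls_in_L2 Omega_fun)

lemma R_Omega:
  assumes k: "k \<in> Linf M" and g: "g \<in> carrier G"
  shows "R k g \<Omega> = l2_cls N (fibre g (\<lambda>x. k (\<alpha> (inv g) x)))"
  unfolding \<Omega>_def R_def wc_cls[OF R_adm[OF k g] Omega_fun]
proof (rule l2_cls_eqI)
  show "(\<lambda>z. R_weight k z * fibre \<one> (\<lambda>x. 1) (R_map g z)) \<in> l2_fun N"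
    by (intro wc_fun R_adm k g Omega_fun)
  show "fibre g (\<lambda>x. k (\<alpha> (inv g) x)) \<in> l2_fun N"
    by (intro fibre_l2 Linf_l2 Linf_act k inv_closed g)
  have "s \<otimes> inv g = \<one> \<longleftrightarrow> s = g" if "s \<in> carrier G" for s
    using that g by (metis inv_closed inv_equality inv_inv r_inv)
  then show "AE z in N. R_weight k z * fibre \<one> (\<lambda>x. 1) (R_map g z) = fibre g (\<lambda>x. k (\<alpha> (inv g) x)) z"
    by (auto simp: R_weight_def R_map_def fibre_def space_N)
qed

lemma R_Omega_L2 [simp]: "k \<in> Linf M \<Longrightarrow> g \<in> carrier G \<Longrightarrow> R k g \<Omega> \<in> L2 N"
  by (simp add: R_bounded bounded_ops_closed)

text \<open>\<Omega> is cyclic for the right multiplications: the vectors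
  \<open>R k g \<Omega>\<close> are, up to null sets, all bounded functions placed over a single
  group element. An operator in \<open>right_commutant\<close> is thereby determined by its value at
  \<Omega>.\<close>

lemma right_ops_total:
  assumes c: "c \<in> L2 N" and d: "d \<in> L2 N"
    and eq: "\<And>k g. k \<in> Linf M \<Longrightarrow> g \<in> carrier G \<Longrightarrow> l2_inner N c (R k g \<Omega>) = l2_inner N d (R k g \<Omega>)"
  shows "c = d"
proof -
  obtain f h where f: "f \<in> l2_fun N" "c = l2_cls N f" and h: "h \<in> l2_fun N" "d = l2_cls N h"
    using c d by (auto elim!: L2E)
  have "AE x in M. f (x, g) - h (x, g) = 0" if g: "g \<in> carrier G" for g
  proof (rule AE_zero_if_orthogonal_Linf)
    have sl: "(\<lambda>x. f (x, g)) \<in> l2_fun M" "(\<lambda>x. h (x, g)) \<in> l2_fun M"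
      using f h g by (auto intro: l2_fun_slice)
    show "(\<lambda>x. f (x, g) - h (x, g)) \<in> l2_fun M"
      by (intro l2_fun_diff sl)
    fix k assume k: "k \<in> Linf M"
    \<comment> \<open>\<open>R_Omega\<close> composes with the inverse of \<open>g\<close>; starting
      from k o g cancels this on the space.\<close>
    let ?k = "\<lambda>x. k (\<alpha> g x)"
    let ?k' = "\<lambda>x. k (\<alpha> g (\<alpha> (inv g) x))"
    have k': "?k \<in> Linf M" "?k' \<in> l2_fun M"
      using Linf_act[OF k g] Linf_act[OF Linf_act[OF k g], of "inv g"] g by (auto intro: Linf_l2)
    have "ip N f (fibre g ?k') = ip N h (fibre g ?k')"
      using eq[OF k'(1) g] f h g k' by (simp add: R_Omega l2_inner_cls fibre_l2)
    then have "ip M (\<lambda>x. f (x, g)) ?k' = ip M (\<lambda>x. h (x, g)) ?k'"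
      using f h g k' by (simp add: ip_fibre)
    moreover have "ip M u ?k' = ip M u k" for u
      unfolding ip_def using g by (intro Bochner_Integration.integral_cong) (auto simp: act_inv)
    ultimately show "ip M (\<lambda>x. f (x, g) - h (x, g)) k = 0"
      using Linf_l2[OF k] sl by (simp add: ip_diff_left)
  qed
  then have "AE z in N. f z = h z" by (simp add: AE_N_iff)
  then show ?thesis using f h by (simp add: l2_cls_eq_iff)
qed

end

section \<open>Weak limits and Fourier coefficients\<close>

context pmp_setting
begin

lemma right_commutant_adjoint:
  assumes "T \<in> right_commutant" "T' \<in> bounded_ops N" "adjoint_ops N T T'"
  shows "T' \<in> right_commutant"
  using adjoint_in_commutant[OF right_ops_bounded right_ops_adjoint] assms by (simp add: right_commutant_def)

text \<open>
  Matrix coefficients of \<open>a A - A a\<close> between vectors \<open>R \<Omega>\<close>, with \<open>R\<close> a right multiplication, depend on \<open>a\<close>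
  only through \<open>a \<Omega>\<close> and \<open>a\<^sup>* \<Omega>\<close>, continuously for the weak topology. So weak convergence of these two
  vectors replaces weak operator convergence, without any bound on the operator norms.
\<close>

lemma mem_if_weak_limit:
  assumes P: "von_neumann_algebra N P" and PC: "P \<subseteq> right_commutant"
    and a: "a \<in> right_commutant" and a': "a' \<in> bounded_ops N" and adj: "adjoint_ops N a a'"
    and q: "\<And>n. q n \<in> P" and q': "\<And>n. q' n \<in> bounded_ops N" and qadj: "\<And>n. adjoint_ops N (q n) (q' n)"
    and lim: "\<And>\<zeta>. \<zeta> \<in> L2 N \<Longrightarrow> (\<lambda>n. l2_inner N (q n \<Omega>) \<zeta>) \<longlonglongrightarrow> l2_inner N (a \<Omega>) \<zeta>"
    and lim': "\<And>\<zeta>. \<zeta> \<in> L2 N \<Longrightarrow> (\<lambda>n. l2_inner N (q' n \<Omega>) \<zeta>) \<longlonglongrightarrow> l2_inner N (a' \<Omega>) \<zeta>"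
  shows "a \<in> P"
proof (rule von_neumann_algebraI_mem[OF P right_commutant_bounded[OF a]])
  fix A c assume A: "A \<in> commutant N P" and c: "c \<in> L2 N"
  have Ab: "A \<in> bounded_ops N" using A commutant_subset by blast
  obtain A' where A': "A' \<in> bounded_ops N" "adjoint_ops N A A'"
    using adjoint_exists[OF Ab] by blast
  note A'_adj = adjoint_ops_sym[OF Ab A']
  have a'C: "a' \<in> right_commutant" by (rule right_commutant_adjoint[OF a a' adj])
  note ab = right_commutant_bounded[OF a]
  note a'_adj = adjoint_ops_sym[OF ab a' adj]
  have on_Omega: "a (A (R k g \<Omega>)) = A (a (R k g \<Omega>))" if k: "k \<in> Linf M" and g: "g \<in> carrier G" for k g
  proof (rule right_ops_total)
    fix l h assume l: "l \<in> Linf M" and h: "h \<in> carrier G"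
    obtain S where S: "S \<in> bounded_ops N" "adjoint_ops N (R k g) S"
      using adjoint_exists[OF R_bounded[OF k g]] by blast
    obtain S2 where S2: "S2 \<in> bounded_ops N" "adjoint_ops N (R l h) S2"
      using adjoint_exists[OF R_bounded[OF l h]] by blast
    note S2_adj = adjoint_ops_sym[OF R_bounded[OF l h] S2]
    \<comment> \<open>Neither vector depends on the operator tested, so the formulas
      \<open>left\<close> and \<open>right\<close> apply with the same \<zeta>1 and \<zeta>2 to
      every \<open>q n\<close> and to \<open>a\<close>.\<close>
    define \<zeta>1 where "\<zeta>1 = S (A' (R l h \<Omega>))"
    define \<zeta>2 where "\<zeta>2 = S2 (A (R k g \<Omega>))"
    have z: "\<zeta>1 \<in> L2 N" "\<zeta>2 \<in> L2 N"
      unfolding \<zeta>1_def \<zeta>2_def using k g l h by (simp_all add: bounded_ops_closed[OF S(1)]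
          bounded_ops_closed[OF S2(1)] bounded_ops_closed[OF A'(1)] bounded_ops_closed[OF Ab])
    have left: "l2_inner N (b (A (R k g \<Omega>))) (R l h \<Omega>) = cnj (l2_inner N (b' \<Omega>) \<zeta>2)"
      if b: "b \<in> right_commutant" "b' \<in> bounded_ops N" "adjoint_ops N b b'" for b b'
    proof -
      have b'\<Omega>: "b' \<Omega> \<in> L2 N" using b(2) by (simp add: bounded_ops_closed)
      have "l2_inner N (b (A (R k g \<Omega>))) (R l h \<Omega>) = l2_inner N (A (R k g \<Omega>)) (b' (R l h \<Omega>))"
        using k g l h by (intro adjoint_opsD[OF b(3)]) (simp_all add: bounded_ops_closed[OF Ab])
      also have "\<dots> = l2_inner N (A (R k g \<Omega>)) (R l h (b' \<Omega>))"
        using right_commutant_R[OF right_commutant_adjoint[OF b] l h] by simp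
      also have "\<dots> = l2_inner N \<zeta>2 (b' \<Omega>)"
        unfolding \<zeta>2_def using k g b'\<Omega>
        by (intro adjoint_opsD[OF S2_adj, symmetric]) (simp_all add: bounded_ops_closed[OF Ab])
      also have "\<dots> = cnj (l2_inner N (b' \<Omega>) \<zeta>2)"
        by (rule l2_inner_commute[OF z(2) b'\<Omega>])
      finally show ?thesis .
    qed
    have right: "l2_inner N (A (b (R k g \<Omega>))) (R l h \<Omega>) = l2_inner N (b \<Omega>) \<zeta>1"
      if b: "b \<in> right_commutant" for b
    proof -
      have bom: "b \<Omega> \<in> L2 N" using right_commutant_bounded[OF b] by (simp add: bounded_ops_closed)
      have "l2_inner N (A (b (R k g \<Omega>))) (R l h \<Omega>) = l2_inner N (A (R k g (b \<Omega>))) (R l h \<Omega>)"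
        using right_commutant_R[OF b k g] by simp
      also have "\<dots> = l2_inner N (R k g (b \<Omega>)) (A' (R l h \<Omega>))"
        using l h bom by (intro adjoint_opsD[OF A'(2)]) (simp_all add: bounded_ops_closed[OF R_bounded[OF k g]])
      also have "\<dots> = l2_inner N (b \<Omega>) \<zeta>1"
        unfolding \<zeta>1_def using l h bom by (intro adjoint_opsD[OF S(2)]) (simp_all add: bounded_ops_closed[OF A'(1)])
      finally show ?thesis .
    qed
    have qC: "q n \<in> right_commutant" for n using q PC by blast
    have "A (q n (R k g \<Omega>)) = q n (A (R k g \<Omega>))" for n
      using commutantD[OF P A q] k g by simp
    then have "l2_inner N (q n \<Omega>) \<zeta>1 = cnj (l2_inner N (q' n \<Omega>) \<zeta>2)" for n
      using left[OF qC q' qadj] right[OF qC] by metis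
    moreover have "(\<lambda>n. cnj (l2_inner N (q' n \<Omega>) \<zeta>2)) \<longlonglongrightarrow> cnj (l2_inner N (a' \<Omega>) \<zeta>2)"
      by (intro tendsto_cnj lim' z)
    ultimately have "cnj (l2_inner N (a' \<Omega>) \<zeta>2) = l2_inner N (a \<Omega>) \<zeta>1"
      using lim[OF z(1)] by (simp add: LIMSEQ_unique)
    then show "l2_inner N (a (A (R k g \<Omega>))) (R l h \<Omega>) = l2_inner N (A (a (R k g \<Omega>))) (R l h \<Omega>)"
      by (simp add: left[OF a a' adj] right[OF a])
  qed (use k g in \<open>simp_all add: bounded_ops_closed[OF Ab] bounded_ops_closed[OF ab]\<close>)
  have cl: "A d \<in> L2 N" "A' d \<in> L2 N" "a d \<in> L2 N" "a' d \<in> L2 N" if "d \<in> L2 N" for d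
    using that by (simp_all add: bounded_ops_closed[OF Ab] bounded_ops_closed[OF ab]
        bounded_ops_closed[OF a'] bounded_ops_closed[OF A'(1)])
  \<comment> \<open>Totality extends \<open>on_Omega\<close> to all vectors once it is stated for
    the adjoints, since the total vectors then stand in the test slot of the inner product.\<close>
  have adj_comm: "A' (a' e) = a' (A' e)" if e: "e \<in> L2 N" for e
  proof (rule right_ops_total)
    fix k g assume kg: "k \<in> Linf M" "g \<in> carrier G"
    then show "l2_inner N (A' (a' e)) (R k g \<Omega>) = l2_inner N (a' (A' e)) (R k g \<Omega>)"
      using e cl on_Omega[OF kg] by (simp add: adjoint_opsD[OF A'_adj] adjoint_opsD[OF a'_adj])
  qed (use e cl in simp_all)
  show "a (A c) = A (a c)"
  proof (rule L2_eqI)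
    fix e assume e: "e \<in> L2 N"
    show "l2_inner N (a (A c)) e = l2_inner N (A (a c)) e"
      using c e cl adj_comm[OF e] by (simp add: adjoint_opsD[OF A'(2)] adjoint_opsD[OF adj])
  qed (use c cl in simp_all)
qed

lemma m_op_Omega:
  assumes f: "f \<in> Linf M"
  shows "m_op f \<Omega> = l2_cls N (fibre \<one> f)"
proof -
  have "(\<lambda>z. f (fst z) * fibre \<one> (\<lambda>x. 1) z) = fibre \<one> f"
    by (auto simp: fibre_def)
  then show ?thesis
    unfolding \<Omega>_def m_op_eq wc_cls[OF m_adm[OF f] Omega_fun] by simp
qed

lemma ip_fibre_left:
  assumes "f \<in> l2_fun N" "k \<in> l2_fun M" "t \<in> carrier G"
  shows "ip N (fibre t k) f = ip M k (\<lambda>x. f (x, t))"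
  using ip_fibre[OF assms] ip_commute by metis

text \<open>Over the identity the inner products with \<zeta> are integrals against one slice of
  \<zeta>, and dominated convergence applies to the functions and to their conjugates alike.\<close>

lemma m_op_limit:
  assumes P: "von_neumann_algebra N P" and PC: "P \<subseteq> right_commutant"
    and f: "f \<in> Linf M" and fn: "\<And>n. fn n \<in> Linf M" and fP: "\<And>n. m_op (fn n) \<in> P"
    and bd: "\<And>n. AE x in M. cmod (fn n x) \<le> K" and lim: "AE x in M. (\<lambda>n. fn n x) \<longlonglongrightarrow> f x"
  shows "m_op f \<in> P"
proof -
  have conv: "(\<lambda>n. l2_inner N (m_op (gn n) \<Omega>) \<zeta>) \<longlonglongrightarrow> l2_inner N (m_op g \<Omega>) \<zeta>"
    if \<zeta>: "\<zeta> \<in> L2 N" and g: "g \<in> Linf M" "\<And>n. gn n \<in> Linf M"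
      and bd: "\<And>n. AE x in M. cmod (gn n x) \<le> K" and lim: "AE x in M. (\<lambda>n. gn n x) \<longlonglongrightarrow> g x" for \<zeta> g gn
  proof -
    obtain u where u: "u \<in> l2_fun N" "\<zeta> = l2_cls N u" using \<zeta> by (rule L2E)
    have sl: "(\<lambda>x. u (x, \<one>)) \<in> l2_fun M" by (rule l2_fun_slice[OF u(1)]) simp
    note [measurable] = l2_fun_measurable[OF sl] Linf_measurable[OF g(1)] Linf_measurable[OF g(2)]
    have inner: "l2_inner N (m_op k \<Omega>) \<zeta> = ip M k (\<lambda>x. u (x, \<one>))" if "k \<in> Linf M" for k
      using that u Linf_l2[OF that] by (simp add: m_op_Omega l2_inner_cls fibre_l2 ip_fibre_left)
    \<comment> \<open>On a probability space the constant 1 is square integrable, so the slice of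
      \<zeta> is integrable and yields the dominating function.\<close>
    have "(\<lambda>x. 1 :: complex) \<in> l2_fun M" by (simp add: l2_fun_def)
    from integrable_l2_prod[OF this sl] have "integrable M (\<lambda>x. K * cmod (cnj (u (x, \<one>))))"
      by simp
    then have "(\<lambda>n. ip M (gn n) (\<lambda>x. u (x, \<one>))) \<longlonglongrightarrow> ip M g (\<lambda>x. u (x, \<one>))"
      unfolding ip_def
    proof (rule integral_dominated_convergence[rotated 2])
      show "AE x in M. (\<lambda>n. gn n x * cnj (u (x, \<one>))) \<longlonglongrightarrow> g x * cnj (u (x, \<one>))"
        using lim by eventually_elim (intro tendsto_intros)
      show "AE x in M. norm (gn n x * cnj (u (x, \<one>))) \<le> K * cmod (cnj (u (x, \<one>)))" for n
        using bd[of n] by eventually_elim (simp add: norm_mult mult_right_mono)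
    qed measurable
    then show ?thesis by (simp add: inner g)
  qed
  show ?thesis
  proof (rule mem_if_weak_limit[OF P PC m_op_right_commutant[OF f] m_op_bounded[OF Linf_cnj[OF f]] m_op_adjoint[OF f]
        fP m_op_bounded[OF Linf_cnj[OF fn]] m_op_adjoint[OF fn]])
    fix \<zeta> assume \<zeta>: "\<zeta> \<in> L2 N"
    show "(\<lambda>n. l2_inner N (m_op (fn n) \<Omega>) \<zeta>) \<longlonglongrightarrow> l2_inner N (m_op f \<Omega>) \<zeta>"
      by (rule conv[OF \<zeta> f fn bd lim])
    show "(\<lambda>n. l2_inner N (m_op (\<lambda>x. cnj (fn n x)) \<Omega>) \<zeta>) \<longlonglongrightarrow> l2_inner N (m_op (\<lambda>x. cnj (f x)) \<Omega>) \<zeta>"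
    proof (rule conv[OF \<zeta> Linf_cnj[OF f] Linf_cnj[OF fn]])
      show "AE x in M. (\<lambda>n. cnj (fn n x)) \<longlonglongrightarrow> cnj (f x)"
        using lim by eventually_elim (intro tendsto_intros)
    qed (use bd in simp)
  qed
qed

lemma m_op_const:
  assumes P: "von_neumann_algebra N P"
  shows "m_op (\<lambda>x. r) \<in> P"
proof (rule von_neumann_algebraI_mem[OF P m_op_bounded])
  have sc: "m_op (\<lambda>x. r) c = l2_scale N r c" if "c \<in> L2 N" for c
    using that by (elim L2E) (simp add: m_op_eq wc_cls[OF m_adm[OF Linf_const[of r]]] l2_scale_cls)
  fix A c assume "A \<in> commutant N P" and c: "c \<in> L2 N"
  then have A: "A \<in> bounded_ops N" using commutant_subset by blast
  show "m_op (\<lambda>x. r) (A c) = A (m_op (\<lambda>x. r) c)"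
    using c by (simp add: sc bounded_ops_closed[OF A] bounded_ops_scale[OF A])
qed simp

lemma m_op_mult:
  assumes "f \<in> Linf M" "g \<in> Linf M"
  shows "compose (L2 N) (m_op f) (m_op g) = m_op (\<lambda>x. f x * g x)"
  unfolding m_op_eq wc_compose[OF m_adm[OF assms(1)] m_adm[OF assms(2)]] ..

lemma m_op_add:
  assumes "f \<in> Linf M" "g \<in> Linf M"
  shows "op_add N (m_op f) (m_op g) = m_op (\<lambda>x. f x + g x)"
proof (rule bounded_ops_eqI[OF op_add_bounded[OF m_op_bounded[OF assms(1)] m_op_bounded[OF assms(2)]]
      m_op_bounded[OF Linf_add[OF assms]]])
  fix c assume c: "c \<in> L2 N"
  then obtain u where u: "u \<in> l2_fun N" "c = l2_cls N u" by (rule L2E)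
  show "op_add N (m_op f) (m_op g) c = m_op (\<lambda>x. f x + g x) c"
    using c wc_fun[OF m_adm[OF assms(1)] u(1)] wc_fun[OF m_adm[OF assms(2)] u(1)]
    unfolding u(2) m_op_eq op_add_def
    by (simp add: wc_cls[OF m_adm[OF assms(1)] u(1)] wc_cls[OF m_adm[OF assms(2)] u(1)]
        wc_cls[OF m_adm[OF Linf_add[OF assms]] u(1)] l2_add_cls distrib_right)
qed

lemma U_Omega:
  assumes g: "g \<in> carrier G"
  shows "U g \<Omega> = l2_cls N (fibre g (\<lambda>x. 1))"
  unfolding \<Omega>_def U_eq wc_cls[OF U_adm[OF g] Omega_fun]
proof (rule l2_cls_eqI)
  show "(\<lambda>z. 1 * fibre \<one> (\<lambda>x. 1) (U_map g z)) \<in> l2_fun N"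
    by (rule wc_fun[OF U_adm[OF g] Omega_fun])
  show "fibre g (\<lambda>x. 1) \<in> l2_fun N" by (intro fibre_l2 Linf_l2 g) simp
  have "inv g \<otimes> s = \<one> \<longleftrightarrow> s = g" if "s \<in> carrier G" for s
    using that g by (metis inv_closed inv_inv inv_equality l_inv)
  then show "AE z in N. 1 * fibre \<one> (\<lambda>x. 1) (U_map g z) = fibre g (\<lambda>x. 1) z"
    using g by (auto simp: U_map_def fibre_def space_N)
qed

text \<open>Left and right translation agree at \<Omega>. This lets an operator in
  \<open>right_commutant\<close> pass a unitary applied to \<Omega>.\<close>

lemma U_Omega_R: "g \<in> carrier G \<Longrightarrow> U g \<Omega> = R (\<lambda>x. 1) g \<Omega>"
  by (simp add: U_Omega R_Omega)

lemma U_cls: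
  assumes g: "g \<in> carrier G" and f: "f \<in> l2_fun N"
  shows "(\<lambda>z. f (U_map g z)) \<in> l2_fun N" "U g (l2_cls N f) = l2_cls N (\<lambda>z. f (U_map g z))"
  using wc_fun[OF U_adm[OF g] f] wc_cls[OF U_adm[OF g] f] by (simp_all add: U_eq)

lemma R_cls:
  assumes g: "g \<in> carrier G" and f: "f \<in> l2_fun N"
  shows "(\<lambda>z. f (R_map g z)) \<in> l2_fun N" "R (\<lambda>x. 1) g (l2_cls N f) = l2_cls N (\<lambda>z. f (R_map g z))"
proof -
  have 1: "(\<lambda>x. 1) \<in> Linf M" by simp
  show "(\<lambda>z. f (R_map g z)) \<in> l2_fun N" "R (\<lambda>x. 1) g (l2_cls N f) = l2_cls N (\<lambda>z. f (R_map g z))"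
    using wc_fun[OF R_adm[OF 1 g] f] wc_cls[OF R_adm[OF 1 g] f] by (simp_all add: R_def R_weight_def)
qed

section \<open>Fourier coefficients of an operator and of its adjoint\<close>

text \<open>With f* the conjugate of f, the adjoint of f_s u_s is u_(s^-1) f_s* = (f_s* o s)
  u_(s^-1); put s = g^-1. The proof reads this off from <a* \<Omega>, R \<Omega>> = <\<Omega>, R a
  \<Omega>>, where only the slice over the identity contributes.\<close>

lemma adjoint_coefficient:
  assumes a: "a \<in> right_commutant" and a': "a' \<in> bounded_ops N" and adj: "adjoint_ops N a a'"
    and \<xi>: "\<xi> \<in> l2_fun N" "a \<Omega> = l2_cls N \<xi>" and \<xi>': "\<xi>' \<in> l2_fun N" "a' \<Omega> = l2_cls N \<xi>'"
    and g: "g \<in> carrier G"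
  shows "AE x in M. \<xi>' (x, g) = cnj (\<xi> (\<alpha> (inv g) x, inv g))"
proof -
  let ?v = "\<lambda>x. cnj (\<xi> (\<alpha> (inv g) x, inv g))"
  have s1: "(\<lambda>x. \<xi>' (x, g)) \<in> l2_fun M" and s0: "(\<lambda>x. \<xi> (x, inv g)) \<in> l2_fun M"
    using g \<xi> \<xi>' by (auto intro: l2_fun_slice)
  have s2: "?v \<in> l2_fun M"
    using g by (intro l2_fun_cnj l2_fun_comp(1)[OF _ _ s0] act_measurable act_distr) auto
  have eq: "ip M (\<lambda>x. \<xi>' (x, g)) (\<lambda>x. k (\<alpha> (inv g) x)) = ip M ?v (\<lambda>x. k (\<alpha> (inv g) x))"
    if k: "k \<in> Linf M" for k
  proof -
    let ?F = "\<lambda>z. R_weight k z * \<xi> (R_map g z)"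
    have F: "?F \<in> l2_fun N" by (rule wc_fun[OF R_adm[OF k g] \<xi>(1)])
    have k': "(\<lambda>x. k (\<alpha> (inv g) x)) \<in> l2_fun M" using g by (intro Linf_l2 Linf_act k) simp
    have 1: "(\<lambda>x. 1 :: complex) \<in> l2_fun M" by (simp add: l2_fun_def)
    note [measurable] = Linf_measurable[OF k] l2_fun_measurable[OF s0]
    have "ip M (\<lambda>x. \<xi>' (x, g)) (\<lambda>x. k (\<alpha> (inv g) x)) = l2_inner N (a' \<Omega>) (R k g \<Omega>)"
      using \<xi>' k g k' by (simp add: R_Omega l2_inner_cls fibre_l2 ip_fibre)
    also have "\<dots> = l2_inner N \<Omega> (a (R k g \<Omega>))"
      using k g by (intro adjoint_opsD[OF adjoint_ops_sym[OF right_commutant_bounded[OF a] a' adj]]) auto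
    also have "\<dots> = l2_inner N \<Omega> (R k g (l2_cls N \<xi>))"
      by (simp add: right_commutant_R[OF a k g] \<xi>(2))
    also have "\<dots> = ip N (fibre \<one> (\<lambda>x. 1)) ?F"
      unfolding \<Omega>_def R_def wc_cls[OF R_adm[OF k g] \<xi>(1)] by (rule l2_inner_cls[OF Omega_fun F])
    also have "\<dots> = ip M (\<lambda>x. 1) (\<lambda>x. ?F (x, \<one>))"
      by (rule ip_fibre_left[OF F 1]) simp
    also have "\<dots> = (\<integral>x. cnj (k x) * cnj (\<xi> (x, inv g)) \<partial>M)"
      unfolding ip_def using g
      by (intro Bochner_Integration.integral_cong) (auto simp: R_weight_def R_map_def act_one)
    also have "\<dots> = (\<integral>x. cnj (k x) * cnj (\<xi> (x, inv g)) \<partial>distr M M (\<alpha> (inv g)))"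
      using g by (simp add: act_distr)
    also have "\<dots> = (\<integral>x. cnj (k (\<alpha> (inv g) x)) * cnj (\<xi> (\<alpha> (inv g) x, inv g)) \<partial>M)"
      using g by (intro integral_distr) auto
    also have "\<dots> = ip M ?v (\<lambda>x. k (\<alpha> (inv g) x))"
      by (simp add: ip_def mult.commute)
    finally show ?thesis .
  qed
  have "AE x in M. \<xi>' (x, g) - ?v x = 0"
  proof (rule AE_zero_if_orthogonal_Linf)
    show "(\<lambda>x. \<xi>' (x, g) - ?v x) \<in> l2_fun M" by (rule l2_fun_diff[OF s1 s2])
    fix k assume k: "k \<in> Linf M"
    have "ip M u (\<lambda>x. k (\<alpha> g (\<alpha> (inv g) x))) = ip M u k" for u
      unfolding ip_def using g by (intro Bochner_Integration.integral_cong) (auto simp: act_inv)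
    then show "ip M (\<lambda>x. \<xi>' (x, g) - ?v x) k = 0"
      using eq[OF Linf_act[OF k g]] by (simp add: ip_diff_left[OF s1 s2 Linf_l2[OF k]])
  qed
  then show ?thesis by simp
qed

lemma sq_slice_le:
  assumes f: "f \<in> l2_fun N" and t: "t \<in> carrier G"
  shows "sq M (\<lambda>x. f (x, t)) \<le> sq N f"
  unfolding sq_def integrable_slice(2)[OF l2_fun_integrable[OF f] t, symmetric]
proof (rule integral_mono')
  show "integrable N (\<lambda>z. (cmod (f z))\<^sup>2)" by (rule l2_fun_integrable[OF f])
qed (auto simp: indicator_def)

text \<open>Multiply on the right by the indicator \<open>k\<close> of the set where the coefficient
  exceeds the operator bound \<open>K\<close>. As this commutes with \<open>a\<close>, the squared
  norm of the coefficient on the set is at most K^2 times the measure of the set, so the set is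
  null.\<close>

lemma coefficient_Linf:
  assumes a: "a \<in> right_commutant" and \<xi>: "\<xi> \<in> l2_fun N" "a \<Omega> = l2_cls N \<xi>"
  shows "(\<lambda>x. \<xi> (x, \<one>)) \<in> Linf M"
proof -
  let ?f = "\<lambda>x. \<xi> (x, \<one>)"
  have f2: "?f \<in> l2_fun M" by (rule l2_fun_slice[OF \<xi>(1)]) simp
  note [measurable] = l2_fun_measurable[OF f2]
  obtain K where K: "K \<ge> 0" "\<And>c. c \<in> L2 N \<Longrightarrow> l2_norm N (a c) \<le> K * l2_norm N c"
    using bounded_ops_bound[OF right_commutant_bounded[OF a]] by blast
  define k :: "'x \<Rightarrow> complex" where "k x = (if K < cmod (?f x) then 1 else 0)" for x
  have [measurable]: "k \<in> borel_measurable M" unfolding k_def by measurable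
  have k: "k \<in> Linf M" by (auto simp: Linf_def k_def intro!: exI[of _ 1])
  let ?F = "\<lambda>z. R_weight k z * \<xi> (R_map \<one> z)"
  have F: "?F \<in> l2_fun N" by (rule wc_fun[OF R_adm[OF k one_closed] \<xi>(1)])
  have kf: "(\<lambda>x. k x * ?f x) \<in> l2_fun M" by (rule l2_fun_mult_Linf[OF k f2])
  have "sq M (\<lambda>x. k x * ?f x) = sq M (\<lambda>x. ?F (x, \<one>))"
    unfolding sq_def by (intro Bochner_Integration.integral_cong) (auto simp: R_weight_def R_map_def act_one)
  also have "\<dots> \<le> sq N ?F"
    by (rule sq_slice_le[OF F one_closed])
  also have "\<dots> = (l2_norm N (R k \<one> (a \<Omega>)))\<^sup>2"
    using F by (simp add: \<xi>(2) R_def wc_cls[OF R_adm[OF k one_closed] \<xi>(1)] l2_norm_cls sq_nonneg)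
  also have "\<dots> = (l2_norm N (a (R k \<one> \<Omega>)))\<^sup>2"
    by (simp add: right_commutant_R[OF a k one_closed])
  also have "\<dots> \<le> (K * l2_norm N (R k \<one> \<Omega>))\<^sup>2"
    using k by (intro power_mono K l2_norm_nonneg) (auto simp: bounded_ops_closed[OF right_commutant_bounded[OF a]])
  also have "\<dots> = K\<^sup>2 * sq N (fibre \<one> (\<lambda>x. k (\<alpha> (inv \<one>) x)))"
    using k by (simp add: R_Omega l2_norm_cls fibre_l2 Linf_l2 Linf_act power_mult_distrib sq_nonneg)
  also have "sq N (fibre \<one> (\<lambda>x. k (\<alpha> (inv \<one>) x))) = sq M k"
  proof -
    have l: "(\<lambda>x. k (\<alpha> (inv \<one>) x)) \<in> l2_fun M" using k by (intro Linf_l2 Linf_act) auto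
    have "complex_of_real (sq N (fibre \<one> (\<lambda>x. k (\<alpha> (inv \<one>) x)))) = of_real (sq M (\<lambda>x. k (\<alpha> (inv \<one>) x)))"
      unfolding ip_self[symmetric] ip_fibre[OF fibre_l2[OF l one_closed] l one_closed] by (simp add: fibre_def)
    then show ?thesis
      unfolding of_real_eq_iff unfolding sq_def
      by (simp add: act_one cong: Bochner_Integration.integral_cong)
  qed
  finally have le: "sq M (\<lambda>x. k x * ?f x) \<le> K\<^sup>2 * sq M k" .
  have int: "integrable M (\<lambda>x. (cmod (k x * ?f x))\<^sup>2 - K\<^sup>2 * (cmod (k x))\<^sup>2)"
    by (intro Bochner_Integration.integrable_diff integrable_mult_right l2_fun_integrable[OF kf]
        l2_fun_integrable[OF Linf_l2[OF k]])
  have nonneg: "0 \<le> (cmod (k x * ?f x))\<^sup>2 - K\<^sup>2 * (cmod (k x))\<^sup>2" for x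
    using K(1) by (auto simp: k_def power_mono)
  have "(\<integral>x. (cmod (k x * ?f x))\<^sup>2 - K\<^sup>2 * (cmod (k x))\<^sup>2 \<partial>M) = sq M (\<lambda>x. k x * ?f x) - K\<^sup>2 * sq M k"
    unfolding sq_def
    by (subst Bochner_Integration.integral_diff)
       (simp_all add: l2_fun_integrable[OF kf] l2_fun_integrable[OF Linf_l2[OF k]])
  then have "(\<integral>x. (cmod (k x * ?f x))\<^sup>2 - K\<^sup>2 * (cmod (k x))\<^sup>2 \<partial>M) = 0"
    using le Bochner_Integration.integral_nonneg[of M "\<lambda>x. (cmod (k x * ?f x))\<^sup>2 - K\<^sup>2 * (cmod (k x))\<^sup>2", OF nonneg]
    by linarith
  then have "AE x in M. (cmod (k x * ?f x))\<^sup>2 - K\<^sup>2 * (cmod (k x))\<^sup>2 = 0"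
    using integral_nonneg_eq_0_iff_AE[OF int] nonneg by simp
  then have "AE x in M. cmod (?f x) \<le> K"
  proof eventually_elim
    case (elim x)
    show ?case
    proof (rule ccontr)
      assume "\<not> cmod (?f x) \<le> K"
      then have "(cmod (?f x))\<^sup>2 = K\<^sup>2" "K < cmod (?f x)" using elim by (auto simp: k_def)
      then show False using K(1) by simp
    qed
  qed
  then show ?thesis by (auto simp: Linf_def)
qed

end

section \<open>The conditional expectation by conjugation\<close>

context group
begin

section \<open>Conjugation and Neumann's lemma\<close>

definition conj_by :: "'a \<Rightarrow> 'a \<Rightarrow> 'a" where
  "conj_by h s = h \<otimes> s \<otimes> inv h"

lemma conj_by_closed [simp]: "h \<in> carrier G \<Longrightarrow> s \<in> carrier G \<Longrightarrow> conj_by h s \<in> carrier G"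
  by (simp add: conj_by_def)

lemma conj_by_mult: "g \<in> carrier G \<Longrightarrow> h \<in> carrier G \<Longrightarrow> s \<in> carrier G \<Longrightarrow> conj_by (g \<otimes> h) s = conj_by g (conj_by h s)"
  by (simp add: conj_by_def inv_mult_group m_assoc)

lemma conj_by_inv:
  assumes "h \<in> carrier G" "s \<in> carrier G"
  shows "conj_by (inv h) (conj_by h s) = s" "conj_by h (conj_by (inv h) s) = s"
  using assms by (simp_all add: conj_by_mult[symmetric]) (simp_all add: conj_by_def)

lemma conj_by_one: "h \<in> carrier G \<Longrightarrow> conj_by h \<one> = \<one>"
  by (simp add: conj_by_def)

text \<open>
  B. H. Neumann's lemma. If \<open>s\<close> is the new element of \<open>F\<close>, every coset \<open>{h. conj_by h s = k}\<close> with \<open>k \<in> K\<close> is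
  translated to a coset \<open>{h. conj_by h s = t}\<close> with \<open>t \<notin> K\<close>; this enlarges \<open>K\<close> and removes \<open>s\<close> from \<open>F\<close>.
\<close>

lemma exists_conjugation_avoiding:
  assumes H: "subgroup H G" and "finite F" "F \<subseteq> carrier G"
    and inf: "\<And>s. s \<in> F \<Longrightarrow> infinite ((\<lambda>h. conj_by h s) ` H)" and "finite K" "K \<subseteq> carrier G"
  shows "\<exists>h\<in>H. \<forall>s\<in>F. conj_by h s \<notin> K"
  using \<open>finite F\<close> \<open>F \<subseteq> carrier G\<close> inf \<open>finite K\<close> \<open>K \<subseteq> carrier G\<close>
proof (induction F arbitrary: K rule: finite_induct)
  case empty
  then show ?case using subgroup.one_closed[OF H] by blast
next
  case (insert s F)
  have HG: "h \<in> carrier G" if "h \<in> H" for h using subgroup.mem_carrier[OF H that] .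
  have s: "s \<in> carrier G" using insert.prems by simp
  have "\<not> (\<lambda>h. conj_by h s) ` H \<subseteq> K"
    using insert.prems finite_subset by blast
  then obtain g where g: "g \<in> H" "conj_by g s \<notin> K" by blast
  \<comment> \<open>A coset representative for each \<open>k\<close> in the orbit of
    \<open>s\<close>; elsewhere any element of \<open>H\<close> will do, which keeps the choice
    total.\<close>
  have "\<exists>a. a \<in> H \<and> (k \<in> (\<lambda>h. conj_by h s) ` H \<longrightarrow> conj_by a s = k)" for k
    using g(1) by auto
  then obtain a where a: "\<And>k. a k \<in> H" "\<And>k. k \<in> (\<lambda>h. conj_by h s) ` H \<Longrightarrow> conj_by (a k) s = k"
    by metis
  \<comment> \<open>For h' = b h, h' sends \<open>f\<close> into \<open>K\<close> only if
    \<open>h\<close> sends \<open>f\<close> into the conjugate of \<open>K\<close> by the inverse of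
    b. Which b occurs depends on the value of \<open>conj_by h s\<close>, so all these conjugates
    are added in advance.\<close>
  define K' where "K' = K \<union> (\<Union>k\<in>K. conj_by (a k \<otimes> inv g) ` K)"
  have "finite K'" "K' \<subseteq> carrier G"
    using insert.prems a(1) g HG by (auto simp: K'_def)
  then obtain h where h: "h \<in> H" "\<forall>f\<in>F. conj_by h f \<notin> K'"
    using insert.IH[of K'] insert.prems by auto
  show ?case
  proof (cases "conj_by h s \<in> K")
    case False
    then show ?thesis using h by (auto simp: K'_def)
  next
    case True
    define k where "k = conj_by h s"
    have k: "k \<in> K" "conj_by (a k) s = k" using True h(1) a(2)[of k] by (auto simp: k_def)
    define b where "b = g \<otimes> inv (a k)"
    define h' where "h' = b \<otimes> h"
    have car: "g \<in> carrier G" "a k \<in> carrier G" "h \<in> carrier G" "b \<in> carrier G"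
      using g a h HG by (auto simp: b_def)
    have h'H: "h' \<in> H"
      unfolding h'_def b_def using H g a h
      by (intro subgroup.m_closed[OF H] subgroup.m_inv_closed[OF H]) auto
    have b_inv: "inv b = a k \<otimes> inv g"
      using car by (simp add: b_def inv_mult_group)
    have "conj_by h' s = conj_by b (conj_by (a k) s)"
      using car s k by (simp add: h'_def conj_by_mult k_def)
    also have "\<dots> = conj_by g s"
      using car s by (simp add: b_def conj_by_mult conj_by_inv)
    finally have "conj_by h' s \<notin> K" using g by simp
    moreover have "conj_by h' f \<notin> K" if f: "f \<in> F" for f
    proof
      assume in_K: "conj_by h' f \<in> K"
      have fc: "f \<in> carrier G" using f insert.prems by auto
      have "conj_by h f = conj_by (inv b) (conj_by h' f)"
        using car fc by (simp add: h'_def conj_by_mult conj_by_inv)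
      then have "conj_by h f \<in> K'"
        using in_K k(1) unfolding K'_def b_inv by blast
      then show False using h(2) f by blast
    qed
    ultimately show ?thesis using h'H by auto
  qed
qed

end

lemma ip_tendsto_dominated:
  assumes f: "f \<in> l2_fun N" and g: "g \<in> l2_fun N" and [measurable]: "\<And>n. fn n \<in> borel_measurable N"
    and le: "\<And>n z. z \<in> space N \<Longrightarrow> cmod (fn n z) \<le> cmod (f z)"
    and lim: "\<And>z. z \<in> space N \<Longrightarrow> (\<lambda>n. fn n z) \<longlonglongrightarrow> f z"
  shows "(\<lambda>n. ip N (fn n) g) \<longlonglongrightarrow> ip N f g"
  unfolding ip_def
proof (rule integral_dominated_convergence)
  note [measurable] = l2_fun_measurable[OF f] l2_fun_measurable[OF g]
  show "(\<lambda>z. f z * cnj (g z)) \<in> borel_measurable N" "\<And>n. (\<lambda>z. fn n z * cnj (g z)) \<in> borel_measurable N"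
    by measurable
  show "integrable N (\<lambda>z. norm (f z * cnj (g z)))"
    by (intro integrable_norm integrable_l2_prod f g)
  show "AE z in N. (\<lambda>n. fn n z * cnj (g z)) \<longlonglongrightarrow> f z * cnj (g z)"
    by (intro AE_I2 tendsto_intros lim)
  show "AE z in N. norm (fn n z * cnj (g z)) \<le> norm (f z * cnj (g z))" for n
    using le by (auto simp: norm_mult intro!: mult_right_mono)
qed

lemma sq_tendsto_zero:
  assumes f: "f \<in> l2_fun N" and [measurable]: "\<And>n. fn n \<in> borel_measurable N"
    and le: "\<And>n z. z \<in> space N \<Longrightarrow> cmod (fn n z) \<le> cmod (f z)"
    and lim: "\<And>z. z \<in> space N \<Longrightarrow> (\<lambda>n. fn n z) \<longlonglongrightarrow> 0"
  shows "(\<lambda>n. sq N (fn n)) \<longlonglongrightarrow> 0"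
proof -
  note [measurable] = l2_fun_measurable[OF f]
  have "(\<lambda>n. sq N (fn n)) \<longlonglongrightarrow> (\<integral>z. 0 \<partial>N)"
    unfolding sq_def
  proof (rule integral_dominated_convergence)
    show "integrable N (\<lambda>z. (cmod (f z))\<^sup>2)" by (rule l2_fun_integrable[OF f])
    show "AE z in N. (\<lambda>n. (cmod (fn n z))\<^sup>2) \<longlonglongrightarrow> 0"
    proof (rule AE_I2)
      fix z assume "z \<in> space N"
      then have "(\<lambda>n. (cmod (fn n z))\<^sup>2) \<longlonglongrightarrow> (cmod 0)\<^sup>2"
        by (intro tendsto_intros lim)
      then show "(\<lambda>n. (cmod (fn n z))\<^sup>2) \<longlonglongrightarrow> 0" by simp
    qed
    show "AE z in N. norm ((cmod (fn n z))\<^sup>2) \<le> (cmod (f z))\<^sup>2" for n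
      using le by (auto intro!: power_mono)
  qed measurable
  then show ?thesis by simp
qed

context pmp_setting
begin

section \<open>Conjugating an operator and passing to the limit\<close>

text \<open>Increasing finite sets that fill up the group; \<open>from_nat_into\<close> may repeat
  elements, so a finite group is covered.\<close>

definition exhaustion :: "nat \<Rightarrow> 'g set" where
  "exhaustion n = from_nat_into (carrier G) ` {..<n}"

lemma exhaustion_finite: "finite (exhaustion n)" and exhaustion_carrier: "exhaustion n \<subseteq> carrier G"
proof -
  have "carrier G \<noteq> {}" by auto
  then show "finite (exhaustion n)" "exhaustion n \<subseteq> carrier G"
    by (auto simp: exhaustion_def intro: from_nat_into)
qed

lemma exhaustion_eventually:
  assumes "s \<in> carrier G"
  shows "eventually (\<lambda>n. s \<in> exhaustion n) sequentially"
proof -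
  obtain i where i: "s = from_nat_into (carrier G) i"
    using from_nat_into_surj[OF countable_G assms] by metis
  show ?thesis
    using eventually_gt_at_top[of i] by eventually_elim (auto simp: exhaustion_def i)
qed

lemma measurable_restrict_snd:
  assumes "f \<in> borel_measurable N"
  shows "(\<lambda>z. if Q (snd z) then f z else (0::complex)) \<in> borel_measurable N"
  using assms unfolding measurable_N_iff by auto

lemma l2_restrict_snd:
  assumes "f \<in> l2_fun N"
  shows "(\<lambda>z. if Q (snd z) then f z else 0) \<in> l2_fun N"
  by (rule l2_fun_bound[OF assms, where K = 1])
     (auto intro: measurable_restrict_snd[OF l2_fun_measurable[OF assms]])

lemma bij_conj_by: "h \<in> carrier G \<Longrightarrow> bij_betw (conj_by h) (carrier G) (carrier G)"
  by (rule bij_betw_byWitness[where f' = "conj_by (inv h)"]) (auto simp: conj_by_inv)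

lemma conjugate_l2:
  assumes h: "h \<in> carrier G" and f: "f \<in> l2_fun N"
  shows "(\<lambda>z. f (fst z, conj_by h (snd z))) \<in> l2_fun N"
    and "sq N (\<lambda>z. f (fst z, conj_by h (snd z))) = sq N f"
  using l2_fun_comp[OF distr_N[of "\<lambda>x. x", OF _ _ bij_conj_by[OF h]] f] by (simp_all add: distr_id2)

text \<open>The part of \<xi> over the identity is fixed by conjugation. For the rest \<eta>, split
  \<zeta> at \<open>exhaustion n\<close>: inside, the conjugate of \<eta> sees only the tail of
  \<eta>; outside, \<zeta> itself is a tail. Cauchy-Schwarz bounds both contributions by quantities
  tending to zero.\<close>

lemma conjugates_tendsto:
  assumes h: "\<And>n. h n \<in> carrier G" and avoid: "\<And>n s. s \<in> exhaustion n \<Longrightarrow> s \<noteq> \<one> \<Longrightarrow> conj_by (h n) s \<notin> exhaustion n"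
    and \<xi>: "\<xi> \<in> l2_fun N" and \<zeta>: "\<zeta> \<in> l2_fun N"
  shows "(\<lambda>n. ip N (\<lambda>z. \<xi> (fst z, conj_by (inv (h n)) (snd z))) \<zeta>) \<longlonglongrightarrow> ip N (fibre \<one> (\<lambda>x. \<xi> (x, \<one>))) \<zeta>"
proof -
  define \<eta> where "\<eta> z = (if snd z \<noteq> \<one> then \<xi> z else 0)" for z
  have \<eta>: "\<eta> \<in> l2_fun N" unfolding \<eta>_def by (rule l2_restrict_snd[OF \<xi>])
  let ?d = "fibre \<one> (\<lambda>x. \<xi> (x, \<one>))"
  have d: "?d \<in> l2_fun N" by (intro fibre_l2 l2_fun_slice \<xi>) auto
  define \<eta>o where "\<eta>o n z = (if snd z \<notin> exhaustion n then \<eta> z else 0)" for n z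
  define \<zeta>o where "\<zeta>o n z = (if snd z \<notin> exhaustion n then \<zeta> z else 0)" for n z
  define \<zeta>i where "\<zeta>i n z = (if snd z \<in> exhaustion n then \<zeta> z else 0)" for n z
  have l2: "\<eta>o n \<in> l2_fun N" "\<zeta>o n \<in> l2_fun N" "\<zeta>i n \<in> l2_fun N" for n
    unfolding \<eta>o_def \<zeta>o_def \<zeta>i_def by (intro l2_restrict_snd \<eta> \<zeta>)+
  define c where "c n f z = f (fst z, conj_by (inv (h n)) (snd z))" for n and f :: "'x \<times> 'g \<Rightarrow> complex" and z
  have c: "c n f \<in> l2_fun N" "sq N (c n f) = sq N f" if "f \<in> l2_fun N" for n f
    unfolding c_def using conjugate_l2[OF inv_closed[OF h] that] by simp_all
  have split_\<zeta>: "ip N f \<zeta> = ip N f (\<zeta>i n) + ip N f (\<zeta>o n)" if "f \<in> l2_fun N" for f n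
    unfolding ip_add_right[OF that l2(3) l2(2), symmetric]
    by (rule arg_cong[of _ _ "ip N f"]) (auto simp: \<zeta>i_def \<zeta>o_def)
  \<comment> \<open>If the conjugated position \<open>t\<close> of an element of
    \<open>exhaustion n\<close> lay in \<open>exhaustion n\<close> too, \<open>avoid\<close> would
    force t = \<one>, where \<eta> vanishes.\<close>
  have inner: "ip N (c n \<eta>) (\<zeta>i n) = ip N (c n (\<eta>o n)) (\<zeta>i n)" for n
    unfolding ip_def
  proof (intro Bochner_Integration.integral_cong refl)
    fix z assume z: "z \<in> space N"
    define t where "t = conj_by (inv (h n)) (snd z)"
    have t: "t \<in> carrier G" "conj_by (h n) t = snd z"
      using z h by (auto simp: t_def space_N conj_by_inv)
    have "\<eta> (fst z, t) = \<eta>o n (fst z, t)" if "snd z \<in> exhaustion n"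
      using avoid[of t n] that t by (auto simp: \<eta>o_def \<eta>_def)
    then show "c n \<eta> z * cnj (\<zeta>i n z) = c n (\<eta>o n) z * cnj (\<zeta>i n z)"
      by (auto simp: c_def \<zeta>i_def t_def)
  qed
  have \<zeta>i_le: "sq N (\<zeta>i n) \<le> sq N \<zeta>" for n
    unfolding sq_def by (intro integral_mono' l2_fun_integrable[OF \<zeta>]) (auto simp: \<zeta>i_def)
  have bound: "cmod (ip N (c n \<eta>) \<zeta>) \<le> sqrt (sq N (\<eta>o n)) * sqrt (sq N \<zeta>) + sqrt (sq N \<eta>) * sqrt (sq N (\<zeta>o n))" for n
  proof -
    have "cmod (ip N (c n \<eta>) \<zeta>) \<le> cmod (ip N (c n (\<eta>o n)) (\<zeta>i n)) + cmod (ip N (c n \<eta>) (\<zeta>o n))"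
      unfolding split_\<zeta>[OF c(1)[OF \<eta>], of n n] inner by (rule norm_triangle_ineq)
    also have "\<dots> \<le> sqrt (sq N (\<eta>o n)) * sqrt (sq N (\<zeta>i n)) + sqrt (sq N \<eta>) * sqrt (sq N (\<zeta>o n))"
      using ip_Cauchy_Schwarz[OF c(1)[OF l2(1), of n] l2(3), of n n] ip_Cauchy_Schwarz[OF c(1)[OF \<eta>, of n] l2(2), of n]
      unfolding c(2)[OF l2(1)] c(2)[OF \<eta>] by (rule add_mono)
    also have "\<dots> \<le> sqrt (sq N (\<eta>o n)) * sqrt (sq N \<zeta>) + sqrt (sq N \<eta>) * sqrt (sq N (\<zeta>o n))"
      using \<zeta>i_le by (intro add_mono mult_left_mono real_sqrt_le_mono) (auto simp: sq_nonneg)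
    finally show ?thesis .
  qed
  have tail: "(\<lambda>n. sq N (\<lambda>z. if snd z \<notin> exhaustion n then f z else 0)) \<longlonglongrightarrow> 0" if f: "f \<in> l2_fun N" for f
  proof (rule sq_tendsto_zero[OF f])
    show "(\<lambda>z. if snd z \<notin> exhaustion n then f z else 0) \<in> borel_measurable N" for n
      by (intro measurable_restrict_snd l2_fun_measurable f)
    show "(\<lambda>n. if snd z \<notin> exhaustion n then f z else 0) \<longlonglongrightarrow> 0" if "z \<in> space N" for z
    proof (rule tendsto_eventually)
      show "\<forall>\<^sub>F n in sequentially. (if snd z \<notin> exhaustion n then f z else 0) = 0"
        by (rule eventually_mono[OF exhaustion_eventually[of "snd z"]]) (use that in \<open>auto simp: space_N\<close>)
    qed
  qed auto
  have "(\<lambda>n. sqrt (sq N (\<eta>o n)) * sqrt (sq N \<zeta>) + sqrt (sq N \<eta>) * sqrt (sq N (\<zeta>o n)))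
      \<longlonglongrightarrow> sqrt 0 * sqrt (sq N \<zeta>) + sqrt (sq N \<eta>) * sqrt 0"
    unfolding \<eta>o_def \<zeta>o_def by (intro tendsto_intros tail \<eta> \<zeta>)
  then have "(\<lambda>n. ip N (c n \<eta>) \<zeta>) \<longlonglongrightarrow> 0"
    using bound by (intro Lim_null_comparison[of "\<lambda>n. ip N (c n \<eta>) \<zeta>"]) auto
  moreover have "ip N (c n \<xi>) \<zeta> = ip N (c n \<eta>) \<zeta> + ip N ?d \<zeta>" for n
  proof -
    have "ip N (c n \<xi>) \<zeta> = ip N (\<lambda>z. c n \<eta> z + ?d z) \<zeta>"
      unfolding ip_def
    proof (intro Bochner_Integration.integral_cong refl)
      fix z assume z: "z \<in> space N"
      then have "conj_by (inv (h n)) (snd z) = \<one> \<longleftrightarrow> snd z = \<one>"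
        using h[of n] conj_by_inv(2)[of "h n" "snd z"] conj_by_one[of "h n"] conj_by_one[of "inv (h n)"] by (auto simp: space_N)
      then show "c n \<xi> z * cnj (\<zeta> z) = (c n \<eta> z + ?d z) * cnj (\<zeta> z)"
        by (auto simp: c_def \<eta>_def fibre_def)
    qed
    then show ?thesis by (simp add: ip_add_left[OF c(1)[OF \<eta>] d \<zeta>])
  qed
  ultimately have "(\<lambda>n. ip N (c n \<xi>) \<zeta>) \<longlonglongrightarrow> 0 + ip N ?d \<zeta>"
    by (simp only:) (intro tendsto_add tendsto_const)
  then show ?thesis by (simp add: c_def[abs_def])
qed

text \<open>At \<Omega> the unitary to the right of \<open>a\<close> acts as a right translation,
  which commutes with \<open>a\<close>. Together with the left translation it conjugates the group
  coordinate, and the space coordinate stays put because \<open>h\<close> acts trivially.\<close>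

lemma conjugate_Omega:
  assumes a: "a \<in> right_commutant" and \<xi>: "\<xi> \<in> l2_fun N" "a \<Omega> = l2_cls N \<xi>"
    and h: "h \<in> carrier G" and triv: "AE x in M. \<alpha> (inv h) x = x"
  shows "compose (L2 N) (U h) (compose (L2 N) a (U (inv h))) \<Omega> =
      l2_cls N (\<lambda>z. \<xi> (fst z, conj_by (inv h) (snd z)))"
proof -
  have hi: "inv h \<in> carrier G" using h by simp
  have 1: "(\<lambda>x. 1) \<in> Linf M" by simp
  have "U (inv h) \<Omega> \<in> L2 N" by (rule bounded_ops_closed[OF U_bounded[OF hi] Omega_L2])
  then have "compose (L2 N) (U h) (compose (L2 N) a (U (inv h))) \<Omega> = U h (a (R (\<lambda>x. 1) (inv h) \<Omega>))"
    by (simp add: compose_eq U_Omega_R[OF hi])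
  also have "\<dots> = U h (l2_cls N (\<lambda>z. \<xi> (R_map (inv h) z)))"
    by (simp add: right_commutant_R[OF a 1 hi] \<xi>(2) R_cls[OF hi \<xi>(1)])
  also have "\<dots> = l2_cls N (\<lambda>z. \<xi> (R_map (inv h) (U_map h z)))"
    by (rule U_cls(2)[OF h R_cls(1)[OF hi \<xi>(1)]])
  also have "\<dots> = l2_cls N (\<lambda>z. \<xi> (fst z, conj_by (inv h) (snd z)))"
  proof (rule l2_cls_eqI)
    show "(\<lambda>z. \<xi> (R_map (inv h) (U_map h z))) \<in> l2_fun N"
      by (rule U_cls(1)[OF h R_cls(1)[OF hi \<xi>(1)]])
    show "(\<lambda>z. \<xi> (fst z, conj_by (inv h) (snd z))) \<in> l2_fun N"
      by (rule conjugate_l2(1)[OF hi \<xi>(1)])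
    have "AE z in N. \<alpha> (inv h) (fst z) = fst z" using triv by (simp add: AE_N_iff)
    then show "AE z in N. \<xi> (R_map (inv h) (U_map h z)) = \<xi> (fst z, conj_by (inv h) (snd z))"
      by eventually_elim (simp add: R_map_def U_map_def conj_by_def)
  qed
  finally show ?thesis .
qed

lemma conjugate_adjoint:
  assumes a: "a \<in> bounded_ops N" and a': "a' \<in> bounded_ops N" and adj: "adjoint_ops N a a'"
    and h: "h \<in> carrier G"
  shows "adjoint_ops N (compose (L2 N) (U h) (compose (L2 N) a (U (inv h))))
    (compose (L2 N) (U h) (compose (L2 N) a' (U (inv h))))"
proof -
  have hi: "inv h \<in> carrier G" using h by simp
  note cl = bounded_ops_closed[OF U_bounded[OF h]] bounded_ops_closed[OF U_bounded[OF hi]]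
    bounded_ops_closed[OF a] bounded_ops_closed[OF a']
  note U_adj = adjoint_opsD[OF U_adjoint[OF h]] adjoint_opsD[OF U_adjoint[OF hi]]
  show ?thesis
    unfolding adjoint_ops_def using h by (simp add: compose_eq cl U_adj adjoint_opsD[OF adj])
qed

lemma unit_coefficient_mem:
  assumes P: "von_neumann_algebra N P" and PC: "P \<subseteq> right_commutant" and UP: "\<And>g. g \<in> carrier G \<Longrightarrow> U g \<in> P"
    and H: "subgroup H G" and icc: "strong_relative_icc G H" and triv: "\<And>h. h \<in> H \<Longrightarrow> AE x in M. \<alpha> h x = x"
    and a: "a \<in> P" and \<xi>: "\<xi> \<in> l2_fun N" "a \<Omega> = l2_cls N \<xi>"
  shows "m_op (\<lambda>x. \<xi> (x, \<one>)) \<in> P"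
proof -
  let ?f = "\<lambda>x. \<xi> (x, \<one>)"
  have aC: "a \<in> right_commutant" using a PC by blast
  note ab = right_commutant_bounded[OF aC]
  have f: "?f \<in> Linf M" by (rule coefficient_Linf[OF aC \<xi>])
  obtain a' where a': "a' \<in> bounded_ops N" "adjoint_ops N a a'"
    using adjoint_exists[OF ab] by blast
  have a'C: "a' \<in> right_commutant" by (rule right_commutant_adjoint[OF aC a'])
  obtain \<xi>' where \<xi>': "\<xi>' \<in> l2_fun N" "a' \<Omega> = l2_cls N \<xi>'"
    using bounded_ops_closed[OF a'(1) Omega_L2] by (rule L2E)
  \<comment> \<open>This identifies the limit of the adjoints with the adjoint of the limit: the
    weak limit criterion needs both.\<close>
  have coeff': "AE x in M. \<xi>' (x, \<one>) = cnj (?f x)"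
    using adjoint_coefficient[OF aC a' \<xi> \<xi>' one_closed] AE_space
    by eventually_elim (simp add: act_one)
  have "\<exists>h\<in>H. \<forall>s\<in>exhaustion n - {\<one>}. conj_by h s \<notin> exhaustion n" for n
  proof (rule exists_conjugation_avoiding[OF H])
    show "infinite ((\<lambda>h. conj_by h s) ` H)" if "s \<in> exhaustion n - {\<one>}" for s
    proof -
      have "(\<lambda>h. conj_by h s) ` H = {h \<otimes> s \<otimes> inv h |h. h \<in> H}" by (auto simp: conj_by_def)
      then show ?thesis using icc that exhaustion_carrier[of n] by (auto simp: strong_relative_icc_def)
    qed
  qed (use exhaustion_finite exhaustion_carrier in auto)
  then obtain h where h: "\<And>n. h n \<in> H" "\<And>n s. s \<in> exhaustion n \<Longrightarrow> s \<noteq> \<one> \<Longrightarrow> conj_by (h n) s \<notin> exhaustion n"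
    by (metis DiffI singletonD)
  have hG: "h n \<in> carrier G" for n by (rule subgroup.mem_carrier[OF H h(1)])
  have hi: "inv (h n) \<in> carrier G" for n using hG by simp
  have ht: "AE x in M. \<alpha> (inv (h n)) x = x" for n
    by (intro triv subgroup.m_inv_closed[OF H] h)
  let ?c = "\<lambda>n b. compose (L2 N) (U (h n)) (compose (L2 N) b (U (inv (h n))))"
  have conv: "(\<lambda>n. l2_inner N (?c n b \<Omega>) \<zeta>) \<longlonglongrightarrow> l2_inner N (l2_cls N (fibre \<one> (\<lambda>x. v (x, \<one>)))) \<zeta>"
    if b: "b \<in> right_commutant" and v: "v \<in> l2_fun N" "b \<Omega> = l2_cls N v" and \<zeta>: "\<zeta> \<in> L2 N" for b v \<zeta>
  proof -
    obtain u where u: "u \<in> l2_fun N" "\<zeta> = l2_cls N u" using \<zeta> by (rule L2E)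
    have d: "fibre \<one> (\<lambda>x. v (x, \<one>)) \<in> l2_fun N" by (intro fibre_l2 l2_fun_slice v) auto
    have "l2_inner N (?c n b \<Omega>) \<zeta> = ip N (\<lambda>z. v (fst z, conj_by (inv (h n)) (snd z))) u" for n
      unfolding conjugate_Omega[OF b v hG ht] u(2)
      by (rule l2_inner_cls[OF conjugate_l2(1)[OF hi v(1)] u(1)])
    then show ?thesis
      using conjugates_tendsto[OF hG h(2) v(1) u(1)] d u by (simp add: l2_inner_cls)
  qed
  have f_Omega: "m_op ?f \<Omega> = l2_cls N (fibre \<one> ?f)" by (rule m_op_Omega[OF f])
  have f'_Omega: "m_op (\<lambda>x. cnj (?f x)) \<Omega> = l2_cls N (fibre \<one> (\<lambda>x. \<xi>' (x, \<one>)))"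
    unfolding m_op_Omega[OF Linf_cnj[OF f]]
  proof (rule l2_cls_eqI)
    show "fibre \<one> (\<lambda>x. cnj (?f x)) \<in> l2_fun N" "fibre \<one> (\<lambda>x. \<xi>' (x, \<one>)) \<in> l2_fun N"
      by (intro fibre_l2 Linf_l2 Linf_cnj f l2_fun_slice[OF \<xi>'(1)] one_closed)+
    have "AE z in N. \<xi>' (fst z, \<one>) = cnj (?f (fst z))"
      using coeff' by (simp add: AE_N_iff)
    then show "AE z in N. fibre \<one> (\<lambda>x. cnj (?f x)) z = fibre \<one> (\<lambda>x. \<xi>' (x, \<one>)) z"
      by eventually_elim (simp add: fibre_def)
  qed
  show ?thesis
  proof (rule mem_if_weak_limit[OF P PC m_op_right_commutant[OF f] m_op_bounded[OF Linf_cnj[OF f]] m_op_adjoint[OF f],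
        where q = "\<lambda>n. ?c n a" and q' = "\<lambda>n. ?c n a'"])
    show "?c n a \<in> P" for n
      by (intro von_neumann_algebra_compose[OF P] UP a hG hi)
    show "?c n a' \<in> bounded_ops N" for n
      by (intro bounded_ops_compose U_bounded a' hG hi)
    show "adjoint_ops N (?c n a) (?c n a')" for n
      by (rule conjugate_adjoint[OF ab a' hG])
    show "(\<lambda>n. l2_inner N (?c n a \<Omega>) \<zeta>) \<longlonglongrightarrow> l2_inner N (m_op ?f \<Omega>) \<zeta>" if "\<zeta> \<in> L2 N" for \<zeta>
      unfolding f_Omega by (rule conv[OF aC \<xi> that])
    show "(\<lambda>n. l2_inner N (?c n a' \<Omega>) \<zeta>) \<longlonglongrightarrow> l2_inner N (m_op (\<lambda>x. cnj (?f x)) \<Omega>) \<zeta>"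
      if "\<zeta> \<in> L2 N" for \<zeta>
      unfolding f'_Omega by (rule conv[OF a'C \<xi>' that])
  qed
qed

section \<open>Fourier sums\<close>

text \<open>Reduces the coefficient over \<open>g\<close> to the coefficient over the identity, at
  which the shifted function takes the value \<xi> (x, g).\<close>

lemma coefficient_shift:
  assumes a: "a \<in> right_commutant" and \<xi>: "\<xi> \<in> l2_fun N" "a \<Omega> = l2_cls N \<xi>" and g: "g \<in> carrier G"
  shows "(\<lambda>z. \<xi> (fst z, snd z \<otimes> g)) \<in> l2_fun N"
    and "compose (L2 N) a (U (inv g)) \<Omega> = l2_cls N (\<lambda>z. \<xi> (fst z, snd z \<otimes> g))"
proof -
  have gi: "inv g \<in> carrier G" using g by simp
  have 1: "(\<lambda>x. 1) \<in> Linf M" by simp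
  have R: "R_map (inv g) z = (fst z, snd z \<otimes> g)" for z using g by (simp add: R_map_def)
  show "(\<lambda>z. \<xi> (fst z, snd z \<otimes> g)) \<in> l2_fun N"
    using R_cls(1)[OF gi \<xi>(1)] by (simp add: R)
  show "compose (L2 N) a (U (inv g)) \<Omega> = l2_cls N (\<lambda>z. \<xi> (fst z, snd z \<otimes> g))"
    using R_cls(2)[OF gi \<xi>(1)] by (simp add: compose_eq U_Omega_R[OF gi] right_commutant_R[OF a 1 gi] \<xi>(2) R)
qed

text \<open>Here q is the sum of f_g u_g over \<open>F\<close>. Its adjoint is built alongside,
  because its value at \<Omega> is needed too; that value is supported on the inverses of
  \<open>F\<close>.\<close>

lemma finite_Fourier_sum:
  assumes Q: "von_neumann_algebra N Q" and UQ: "\<And>g. g \<in> carrier G \<Longrightarrow> U g \<in> Q"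
    and a: "a \<in> right_commutant" and a': "a' \<in> bounded_ops N" and adj: "adjoint_ops N a a'"
    and \<xi>: "\<xi> \<in> l2_fun N" "a \<Omega> = l2_cls N \<xi>" and \<xi>': "\<xi>' \<in> l2_fun N" "a' \<Omega> = l2_cls N \<xi>'"
    and fL: "\<And>g. g \<in> carrier G \<Longrightarrow> (\<lambda>x. \<xi> (x, g)) \<in> Linf M"
    and fQ: "\<And>g. g \<in> carrier G \<Longrightarrow> m_op (\<lambda>x. \<xi> (x, g)) \<in> Q"
    and "finite F" "F \<subseteq> carrier G"
  shows "\<exists>q q'. q \<in> Q \<and> q' \<in> bounded_ops N \<and> adjoint_ops N q q' \<and>
    q \<Omega> = l2_cls N (\<lambda>z. if snd z \<in> F then \<xi> z else 0) \<and>
    q' \<Omega> = l2_cls N (\<lambda>z. if inv (snd z) \<in> F then \<xi>' z else 0)"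
  using \<open>finite F\<close> \<open>F \<subseteq> carrier G\<close>
proof (induction F rule: finite_induct)
  case empty
  have 0: "(\<lambda>x. 0) \<in> Linf M" by simp
  have "fibre \<one> (\<lambda>x. 0) = (\<lambda>z. 0)" by (auto simp: fibre_def)
  then have \<Omega>: "m_op (\<lambda>x. 0) \<Omega> = l2_cls N (\<lambda>z. 0)" by (simp add: m_op_Omega[OF 0])
  have "adjoint_ops N (m_op (\<lambda>x. 0)) (m_op (\<lambda>x. 0))" using m_op_adjoint[OF 0] by simp
  then show ?case
    using m_op_const[OF Q, of 0] m_op_bounded[OF 0] \<Omega>
    by (intro exI[of _ "m_op (\<lambda>x. 0)"]) simp
next
  case (insert g F)
  then have g: "g \<in> carrier G" and gi: "inv g \<in> carrier G" and F: "F \<subseteq> carrier G" by auto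
  obtain q q' where q: "q \<in> Q" "q' \<in> bounded_ops N" "adjoint_ops N q q'"
    and q_Omega: "q \<Omega> = l2_cls N (\<lambda>z. if snd z \<in> F then \<xi> z else 0)"
    and q'_Omega: "q' \<Omega> = l2_cls N (\<lambda>z. if inv (snd z) \<in> F then \<xi>' z else 0)"
    using insert.IH[OF F] by blast
  have qb: "q \<in> bounded_ops N" using q(1) von_neumann_algebra_subset[OF Q] by blast
  let ?f = "\<lambda>x. \<xi> (x, g)"
  define p where "p = compose (L2 N) (m_op ?f) (U g)"
  define p' where "p' = compose (L2 N) (U (inv g)) (m_op (\<lambda>x. cnj (?f x)))"
  have pQ: "p \<in> Q" unfolding p_def by (intro von_neumann_algebra_compose[OF Q] fQ UQ g)
  have pb: "p \<in> bounded_ops N" using pQ von_neumann_algebra_subset[OF Q] by blast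
  have p'b: "p' \<in> bounded_ops N"
    unfolding p'_def by (intro bounded_ops_compose U_bounded m_op_bounded Linf_cnj fL g gi)
  have padj: "adjoint_ops N p p'"
    unfolding p_def p'_def
    by (intro adjoint_ops_compose m_op_bounded U_bounded Linf_cnj fL g gi m_op_adjoint U_adjoint)
  have l2: "fibre g ?f \<in> l2_fun N" "fibre \<one> (\<lambda>x. cnj (?f x)) \<in> l2_fun N"
    by (intro fibre_l2 Linf_l2 Linf_cnj fL g one_closed)+
  have 1: "fibre g (\<lambda>x. 1) \<in> l2_fun N" by (intro fibre_l2 Linf_l2 g) simp
  have "p \<Omega> = m_op ?f (l2_cls N (fibre g (\<lambda>x. 1)))"
    by (simp add: p_def compose_eq U_Omega[OF g])
  also have "\<dots> = l2_cls N (fibre g ?f)"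
    unfolding m_op_eq wc_cls[OF m_adm[OF fL[OF g]] 1]
    by (rule arg_cong[of _ _ "l2_cls N"]) (auto simp: fibre_def)
  finally have p_Omega: "p \<Omega> = l2_cls N (fibre g ?f)" .
  have "p' \<Omega> = U (inv g) (l2_cls N (fibre \<one> (\<lambda>x. cnj (?f x))))"
    by (simp add: p'_def compose_eq m_op_Omega[OF Linf_cnj[OF fL[OF g]]])
  also have "\<dots> = l2_cls N (\<lambda>z. fibre \<one> (\<lambda>x. cnj (?f x)) (U_map (inv g) z))"
    by (rule U_cls(2)[OF gi l2(2)])
  finally have p'_Omega: "p' \<Omega> = l2_cls N (\<lambda>z. fibre \<one> (\<lambda>x. cnj (?f x)) (U_map (inv g) z))" .
  have r: "(\<lambda>z. if snd z \<in> A then \<xi> z else 0) \<in> l2_fun N"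
    "(\<lambda>z. if inv (snd z) \<in> A then \<xi>' z else 0) \<in> l2_fun N" for A
    using l2_restrict_snd[OF \<xi>(1), of "\<lambda>s. s \<in> A"] l2_restrict_snd[OF \<xi>'(1), of "\<lambda>s. inv s \<in> A"] by simp_all
  have "op_add N q p \<Omega> = l2_cls N (\<lambda>z. if snd z \<in> insert g F then \<xi> z else 0)"
  proof -
    have "op_add N q p \<Omega> = l2_cls N (\<lambda>z. (if snd z \<in> F then \<xi> z else 0) + fibre g ?f z)"
      by (simp add: op_add_def q_Omega p_Omega l2_add_cls[OF r(1) l2(1)])
    also have "(\<lambda>z. (if snd z \<in> F then \<xi> z else 0) + fibre g ?f z) = (\<lambda>z. if snd z \<in> insert g F then \<xi> z else 0)"
      using insert.hyps by (auto simp: fibre_def fun_eq_iff)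
    finally show ?thesis .
  qed
  moreover have "op_add N q' p' \<Omega> = l2_cls N (\<lambda>z. if inv (snd z) \<in> insert g F then \<xi>' z else 0)"
  proof -
    have U: "(\<lambda>z. fibre \<one> (\<lambda>x. cnj (?f x)) (U_map (inv g) z)) \<in> l2_fun N"
      by (rule U_cls(1)[OF gi l2(2)])
    have "op_add N q' p' \<Omega> =
        l2_cls N (\<lambda>z. (if inv (snd z) \<in> F then \<xi>' z else 0) + fibre \<one> (\<lambda>x. cnj (?f x)) (U_map (inv g) z))"
      by (simp add: op_add_def q'_Omega p'_Omega l2_add_cls[OF r(2) U])
    also have "\<dots> = l2_cls N (\<lambda>z. if inv (snd z) \<in> insert g F then \<xi>' z else 0)"
    proof (rule l2_cls_eqI[OF l2_fun_add[OF r(2) U] r(2)])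
      \<comment> \<open>The new term of the adjoint lies over the inverse of \<open>g\<close> and
        agrees with \<xi>' only almost everywhere, so classes and not functions are
        compared.\<close>
      have "AE x in M. \<xi>' (x, inv g) = cnj (\<xi> (\<alpha> g x, g))"
        using adjoint_coefficient[OF a a' adj \<xi> \<xi>' gi] g by simp
      then have "AE z in N. \<xi>' (fst z, inv g) = cnj (\<xi> (\<alpha> g (fst z), g))"
        by (simp add: AE_N_iff)
      then show "AE z in N. (if inv (snd z) \<in> F then \<xi>' z else 0) + fibre \<one> (\<lambda>x. cnj (?f x)) (U_map (inv g) z) =
          (if inv (snd z) \<in> insert g F then \<xi>' z else 0)"
        using AE_space
      proof eventually_elim
        case (elim z)
        obtain x s where z: "z = (x, s)" "s \<in> carrier G" using elim by (cases z) (auto simp: space_N)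
        have "g \<otimes> s = \<one> \<longleftrightarrow> s = inv g"
          using z g by (metis inv_equality inv_inv r_inv)
        moreover have "inv s = g \<longleftrightarrow> s = inv g"
          using z g by auto
        ultimately show ?case
          using elim insert.hyps g by (auto simp: z fibre_def U_map_def)
      qed
    qed
    finally show ?thesis .
  qed
  moreover have "op_add N q p \<in> Q" by (rule von_neumann_algebra_add[OF Q q(1) pQ])
  moreover have "op_add N q' p' \<in> bounded_ops N" by (rule op_add_bounded[OF q(2) p'b])
  moreover have "adjoint_ops N (op_add N q p) (op_add N q' p')"
    by (rule adjoint_ops_add[OF qb pb q(2) p'b q(3) padj])
  ultimately show ?case by blast
qed

lemma mem_if_coefficients_mem:
  assumes Q: "von_neumann_algebra N Q" and QC: "Q \<subseteq> right_commutant" and UQ: "\<And>g. g \<in> carrier G \<Longrightarrow> U g \<in> Q"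
    and a: "a \<in> right_commutant" and \<xi>: "\<xi> \<in> l2_fun N" "a \<Omega> = l2_cls N \<xi>"
    and fL: "\<And>g. g \<in> carrier G \<Longrightarrow> (\<lambda>x. \<xi> (x, g)) \<in> Linf M"
    and fQ: "\<And>g. g \<in> carrier G \<Longrightarrow> m_op (\<lambda>x. \<xi> (x, g)) \<in> Q"
  shows "a \<in> Q"
proof -
  obtain a' where a': "a' \<in> bounded_ops N" "adjoint_ops N a a'"
    using adjoint_exists[OF right_commutant_bounded[OF a]] by blast
  obtain \<xi>' where \<xi>': "\<xi>' \<in> l2_fun N" "a' \<Omega> = l2_cls N \<xi>'"
    using bounded_ops_closed[OF a'(1) Omega_L2] by (rule L2E)
  have "\<exists>q q'. q \<in> Q \<and> q' \<in> bounded_ops N \<and> adjoint_ops N q q' \<and>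
      q \<Omega> = l2_cls N (\<lambda>z. if snd z \<in> exhaustion n then \<xi> z else 0) \<and>
      q' \<Omega> = l2_cls N (\<lambda>z. if inv (snd z) \<in> exhaustion n then \<xi>' z else 0)" for n
    by (rule finite_Fourier_sum[OF Q UQ a a' \<xi> \<xi>' fL fQ exhaustion_finite exhaustion_carrier])
  then obtain q where "\<forall>n. \<exists>q'. q n \<in> Q \<and> q' \<in> bounded_ops N \<and> adjoint_ops N (q n) q' \<and>
      q n \<Omega> = l2_cls N (\<lambda>z. if snd z \<in> exhaustion n then \<xi> z else 0) \<and>
      q' \<Omega> = l2_cls N (\<lambda>z. if inv (snd z) \<in> exhaustion n then \<xi>' z else 0)"
    using choice[of "\<lambda>n q. \<exists>q'. q \<in> Q \<and> q' \<in> bounded_ops N \<and> adjoint_ops N q q' \<and>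
      q \<Omega> = l2_cls N (\<lambda>z. if snd z \<in> exhaustion n then \<xi> z else 0) \<and>
      q' \<Omega> = l2_cls N (\<lambda>z. if inv (snd z) \<in> exhaustion n then \<xi>' z else 0)"] by blast
  from choice[OF this] obtain q' where q: "\<And>n. q n \<in> Q" "\<And>n. q' n \<in> bounded_ops N" "\<And>n. adjoint_ops N (q n) (q' n)"
    and q_Omega: "\<And>n. q n \<Omega> = l2_cls N (\<lambda>z. if snd z \<in> exhaustion n then \<xi> z else 0)"
    and q'_Omega: "\<And>n. q' n \<Omega> = l2_cls N (\<lambda>z. if inv (snd z) \<in> exhaustion n then \<xi>' z else 0)"
    by blast
  \<comment> \<open>One statement for both sequences: \<rho> is the identity for \<open>a\<close>
    and inversion for its adjoint.\<close>
  have conv: "(\<lambda>n. l2_inner N (l2_cls N (\<lambda>z. if \<rho> (snd z) \<in> exhaustion n then v z else 0)) \<zeta>)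
      \<longlonglongrightarrow> l2_inner N (l2_cls N v) \<zeta>"
    if \<rho>: "\<And>s. s \<in> carrier G \<Longrightarrow> \<rho> s \<in> carrier G" and v: "v \<in> l2_fun N" and \<zeta>: "\<zeta> \<in> L2 N" for \<rho> v \<zeta>
  proof -
    obtain u where u: "u \<in> l2_fun N" "\<zeta> = l2_cls N u" using \<zeta> by (rule L2E)
    have r: "(\<lambda>z. if \<rho> (snd z) \<in> exhaustion n then v z else 0) \<in> l2_fun N" for n
      using l2_restrict_snd[OF v, of "\<lambda>s. \<rho> s \<in> exhaustion n"] .
    have "(\<lambda>n. ip N (\<lambda>z. if \<rho> (snd z) \<in> exhaustion n then v z else 0) u) \<longlonglongrightarrow> ip N v u"
    proof (rule ip_tendsto_dominated[OF v u(1) l2_fun_measurable[OF r]])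
      show "(\<lambda>n. if \<rho> (snd z) \<in> exhaustion n then v z else 0) \<longlonglongrightarrow> v z" if "z \<in> space N" for z
      proof (rule tendsto_eventually)
        show "\<forall>\<^sub>F n in sequentially. (if \<rho> (snd z) \<in> exhaustion n then v z else 0) = v z"
          by (rule eventually_mono[OF exhaustion_eventually[of "\<rho> (snd z)"]]) (use \<rho> that in \<open>auto simp: space_N\<close>)
      qed
    qed auto
    then show ?thesis by (simp add: u(2) l2_inner_cls[OF r u(1)] l2_inner_cls[OF v u(1)])
  qed
  show ?thesis
  proof (rule mem_if_weak_limit[OF Q QC a a' q])
    show "(\<lambda>n. l2_inner N (q n \<Omega>) \<zeta>) \<longlonglongrightarrow> l2_inner N (a \<Omega>) \<zeta>" if "\<zeta> \<in> L2 N" for \<zeta>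
      unfolding q_Omega \<xi>(2) using conv[of "\<lambda>s. s", OF _ \<xi>(1) that] by simp
    show "(\<lambda>n. l2_inner N (q' n \<Omega>) \<zeta>) \<longlonglongrightarrow> l2_inner N (a' \<Omega>) \<zeta>" if "\<zeta> \<in> L2 N" for \<zeta>
      unfolding q'_Omega \<xi>'(2) by (rule conv[OF inv_closed \<xi>'(1) that])
  qed
qed

end

section \<open>The intermediate algebra comes from a factor\<close>

text \<open>Its purpose is to cut an arbitrary algebra containing the generators down to
  \<open>right_commutant\<close>, where the weak limit criterion applies.\<close>

lemma von_neumann_algebra_Int:
  assumes P: "von_neumann_algebra N P" and Q: "von_neumann_algebra N Q"
  shows "von_neumann_algebra N (P \<inter> Q)"
  unfolding von_neumann_algebra_def
proof (intro conjI ballI)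
  show b: "P \<inter> Q \<subseteq> bounded_ops N" using von_neumann_algebra_subset[OF P] by blast
  have "commutant N (commutant N (P \<inter> Q)) \<subseteq> commutant N (commutant N P)"
    "commutant N (commutant N (P \<inter> Q)) \<subseteq> commutant N (commutant N Q)"
    by (intro commutant_antimono Int_lower1 Int_lower2)+
  then show "commutant N (commutant N (P \<inter> Q)) = P \<inter> Q"
    using P Q subset_bicommutant[OF b] by (auto simp: von_neumann_algebra_def)
  fix T assume T: "T \<in> P \<inter> Q"
  then obtain S where "S \<in> bounded_ops N" "adjoint_ops N T S"
    using b adjoint_exists[of T N] by blast
  then show "\<exists>S\<in>P \<inter> Q. adjoint_ops N T S"
    using T von_neumann_algebra_adjoint[OF P, of T S] von_neumann_algebra_adjoint[OF Q, of T S] by blast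
qed

text \<open>The iterates of this odd cubic, which fixes \<open>-1\<close>, \<open>0\<close> and \<open>1\<close>, converge on \<open>[-1, 1]\<close> to the sign function.\<close>

definition sgn_step :: "real \<Rightarrow> real" where
  "sgn_step t = (3 * t - t ^ 3) / 2"

lemma sgn_step_pos:
  assumes "0 < t" "t \<le> 1"
  shows "t \<le> sgn_step t" "sgn_step t \<le> 1"
proof -
  have "0 \<le> t * (1 - t) * (1 + t)" using assms by (intro mult_nonneg_nonneg) auto
  then show "t \<le> sgn_step t" by (simp add: sgn_step_def algebra_simps power3_eq_cube)
  have "0 \<le> (t - 1)\<^sup>2 * (t + 2)" using assms by (intro mult_nonneg_nonneg) auto
  then show "sgn_step t \<le> 1" by (simp add: sgn_step_def algebra_simps power3_eq_cube power2_eq_square)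
qed

lemma sgn_step_minus: "sgn_step (- t) = - sgn_step t"
  by (simp add: sgn_step_def power3_eq_cube field_simps)

text \<open>The iterates increase and stay in [t, 1], so they converge to a positive fixed point;
  the cubic has fixed points -1, 0 and 1 only.\<close>

lemma sgn_step_iterates_pos:
  assumes t: "0 < t" "t \<le> 1"
  shows "(\<lambda>n. (sgn_step ^^ n) t) \<longlonglongrightarrow> 1"
proof -
  have bd: "t \<le> (sgn_step ^^ n) t \<and> (sgn_step ^^ n) t \<le> 1" for n
  proof (induction n)
    case (Suc n)
    then show ?case using sgn_step_pos[of "(sgn_step ^^ n) t"] t by auto
  qed (use t in auto)
  have "(sgn_step ^^ n) t \<le> (sgn_step ^^ Suc n) t" for n
    using sgn_step_pos(1)[of "(sgn_step ^^ n) t"] bd[of n] t by simp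
  then have "incseq (\<lambda>n. (sgn_step ^^ n) t)" by (rule incseq_SucI)
  then obtain L where L: "(\<lambda>n. (sgn_step ^^ n) t) \<longlonglongrightarrow> L"
    using incseq_convergent[of _ 1] bd by metis
  have "t \<le> L" by (rule LIMSEQ_le_const[OF L]) (use bd in auto)
  have "(\<lambda>n. sgn_step ((sgn_step ^^ n) t)) \<longlonglongrightarrow> sgn_step L"
    unfolding sgn_step_def by (intro tendsto_intros L[unfolded sgn_step_def]) simp
  moreover have "(\<lambda>n. sgn_step ((sgn_step ^^ n) t)) \<longlonglongrightarrow> L"
    using LIMSEQ_Suc[OF L] by simp
  ultimately have "sgn_step L = L" by (rule LIMSEQ_unique)
  then have "L * ((1 - L) * (1 + L)) = 0"
    by (simp add: sgn_step_def algebra_simps power3_eq_cube)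
  then have "L = 1" using \<open>t \<le> L\<close> t by auto
  then show ?thesis using L by simp
qed

lemma sgn_step_iterates:
  assumes "\<bar>t\<bar> \<le> 1"
  shows "(\<lambda>n. (sgn_step ^^ n) t) \<longlonglongrightarrow> sgn t"
proof -
  have neg: "(sgn_step ^^ n) (- s) = - (sgn_step ^^ n) s" for n s
    by (induction n) (simp_all add: sgn_step_minus)
  consider "t > 0" | "t = 0" | "t < 0" by linarith
  then show ?thesis
  proof cases
    case 1
    then show ?thesis using sgn_step_iterates_pos[of t] assms by simp
  next
    case 2
    have "(sgn_step ^^ n) 0 = 0" for n by (induction n) (simp_all add: sgn_step_def)
    then show ?thesis using 2 by simp
  next
    case 3
    then show ?thesis
      using tendsto_minus[OF sgn_step_iterates_pos[of "- t"]] assms by (simp add: neg)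
  qed
qed

lemma sgn_step_iterates_bound:
  assumes "\<bar>t\<bar> \<le> 1"
  shows "\<bar>(sgn_step ^^ n) t\<bar> \<le> 1"
proof (induction n)
  case (Suc n)
  define s where "s = (sgn_step ^^ n) t"
  consider "s > 0" | "s = 0" | "s < 0" by linarith
  then have "\<bar>sgn_step s\<bar> \<le> 1"
  proof cases
    case 1
    then show ?thesis using sgn_step_pos[of s] Suc by (simp add: s_def)
  next
    case 2
    then show ?thesis by (simp add: sgn_step_def)
  next
    case 3
    then show ?thesis using sgn_step_pos[of "- s"] Suc by (simp add: s_def sgn_step_minus)
  qed
  then show ?case by (simp add: s_def)
qed (use assms in simp)

locale intermediate_algebra = pmp_setting G M \<alpha>
  for G :: "('g, 'b) monoid_scheme" (structure) and M :: "'x measure" and \<alpha> +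
  fixes P :: "('x \<times> 'g) l2_op set"
  assumes P: "von_neumann_algebra N P" and PC: "P \<subseteq> right_commutant" and UP: "\<And>g. g \<in> carrier G \<Longrightarrow> U g \<in> P"
begin

section \<open>Bounded functions in the intermediate algebra\<close>

definition B :: "('x \<Rightarrow> complex) set" where
  "B = {f \<in> Linf M. m_op f \<in> P}"

lemma B_const: "(\<lambda>x. r) \<in> B"
  by (simp add: B_def m_op_const[OF P])

lemma B_Linf: "f \<in> B \<Longrightarrow> f \<in> Linf M"
  by (simp add: B_def)

lemma B_add: "f \<in> B \<Longrightarrow> g \<in> B \<Longrightarrow> (\<lambda>x. f x + g x) \<in> B"
  using von_neumann_algebra_add[OF P] by (auto simp: B_def Linf_add m_op_add[symmetric])

lemma B_mult: "f \<in> B \<Longrightarrow> g \<in> B \<Longrightarrow> (\<lambda>x. f x * g x) \<in> B"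
  using von_neumann_algebra_compose[OF P] by (auto simp: B_def Linf_mult m_op_mult[symmetric])

lemma B_cnj: "f \<in> B \<Longrightarrow> (\<lambda>x. cnj (f x)) \<in> B"
  using von_neumann_algebra_adjoint[OF P _ m_op_bounded m_op_adjoint] by (auto simp: B_def Linf_cnj)

lemma B_cong:
  assumes f: "f \<in> B" and [measurable]: "g \<in> borel_measurable M" and eq: "AE x in M. f x = g x"
  shows "g \<in> B"
proof -
  obtain K where "AE x in M. cmod (f x) \<le> K" using f by (auto simp: B_def Linf_def)
  then have "AE x in M. cmod (g x) \<le> K" using eq by eventually_elim simp
  then have g: "g \<in> Linf M" by (auto simp: Linf_def)
  have "m_op f = m_op g"
    unfolding m_op_eq by (rule wc_cong[OF m_adm[OF B_Linf[OF f]] m_adm[OF g]]) (use eq in \<open>simp add: AE_N_iff\<close>)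
  then show ?thesis using f g by (simp add: B_def)
qed

lemma B_limit:
  assumes fn: "\<And>n. fn n \<in> B" and [measurable]: "f \<in> borel_measurable M"
    and bd: "\<And>n. AE x in M. cmod (fn n x) \<le> K" and lim: "AE x in M. (\<lambda>n. fn n x) \<longlonglongrightarrow> f x"
  shows "f \<in> B"
proof -
  have "AE x in M. \<forall>n. cmod (fn n x) \<le> K" using bd by (simp add: AE_all_countable)
  then have "AE x in M. cmod (f x) \<le> K"
    using lim by eventually_elim (auto intro: LIMSEQ_le_const2[OF tendsto_norm])
  then have f: "f \<in> Linf M" by (auto simp: Linf_def)
  then show ?thesis
    using m_op_limit[OF P PC f _ _ bd lim] fn by (simp add: B_def)
qed

lemma B_sum: "finite I \<Longrightarrow> (\<And>i. i \<in> I \<Longrightarrow> f i \<in> B) \<Longrightarrow> (\<lambda>x. \<Sum>i\<in>I. f i x) \<in> B"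
  by (induction I rule: finite_induct) (auto intro: B_add B_const)

lemma B_prod: "finite I \<Longrightarrow> (\<And>i. i \<in> I \<Longrightarrow> f i \<in> B) \<Longrightarrow> (\<lambda>x. \<Prod>i\<in>I. f i x) \<in> B"
  by (induction I rule: finite_induct) (auto intro: B_mult B_const)

text \<open>Conjugation by the unitaries in \<open>P\<close> implements the action on functions;
  this is what makes the \<sigma>-algebra below invariant.\<close>

lemma B_act:
  assumes f: "f \<in> B" and g: "g \<in> carrier G"
  shows "(\<lambda>x. f (\<alpha> g x)) \<in> B"
proof -
  have gi: "inv g \<in> carrier G" using g by simp
  have fL: "f \<in> Linf M" by (rule B_Linf[OF f])
  note fU = wc_adm_compose[OF m_adm[OF fL] U_adm[OF g]]
  have "compose (L2 N) (U (inv g)) (compose (L2 N) (m_op f) (U g)) = m_op (\<lambda>x. f (\<alpha> g x))"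
    unfolding U_eq m_op_eq wc_compose[OF m_adm[OF fL] U_adm[OF g]] wc_compose[OF U_adm[OF gi] fU]
  proof (rule wc_cong[OF wc_adm_compose[OF U_adm[OF gi] fU] m_adm[OF Linf_act[OF fL g]]])
    show "AE z in N. 1 * (f (fst (U_map (inv g) z)) * 1) = f (\<alpha> g (fst z)) \<and> U_map g (U_map (inv g) z) = z"
      using U_map_inv[OF gi] g by (auto simp: U_map_def)
  qed
  moreover have "compose (L2 N) (U (inv g)) (compose (L2 N) (m_op f) (U g)) \<in> P"
    using f by (intro von_neumann_algebra_compose[OF P] UP g gi) (simp add: B_def)
  ultimately show ?thesis using Linf_act[OF fL g] by (simp add: B_def)
qed

section \<open>The invariant sub-\<sigma>-algebra\<close>

text \<open>The projections of \<open>B\<close>. By \<open>B_cong\<close> this family contains every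
  null set of \<open>M\<close>, so functions in \<open>B\<close> turn out to be measurable for it as
  they stand, without passing to another representative.\<close>

definition factor_sets :: "'x set set" where
  "factor_sets = {A \<in> sets M. indicator A \<in> B}"

lemma factor_sets_sigma_algebra: "sigma_algebra (space M) factor_sets"
  unfolding sigma_algebra_iff2
proof (intro conjI ballI allI impI)
  show "factor_sets \<subseteq> Pow (space M)" using sets.sets_into_space by (auto simp: factor_sets_def)
  have "(indicator {} :: 'x \<Rightarrow> complex) = (\<lambda>x. 0)" by auto
  then show "{} \<in> factor_sets" using B_const[of 0] by (simp add: factor_sets_def)
  have co: "(\<lambda>x. 1 + (-1) * indicator A x) \<in> B" if "A \<in> factor_sets" for A
    using that by (intro B_add B_mult B_const) (simp add: factor_sets_def)
  show "space M - A \<in> factor_sets" if A: "A \<in> factor_sets" for A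
  proof -
    have m: "space M - A \<in> sets M" using A by (auto simp: factor_sets_def)
    have "indicator (space M - A) \<in> B"
    proof (rule B_cong[OF co[OF A]])
      show "AE x in M. 1 + - 1 * indicator A x = (indicator (space M - A) x :: complex)"
        by (rule AE_I2) (auto simp: indicator_def)
    qed (use m in measurable)
    then show ?thesis using m by (simp add: factor_sets_def)
  qed
  fix A :: "nat \<Rightarrow> 'x set" assume "range A \<subseteq> factor_sets"
  then have A: "A i \<in> factor_sets" for i by blast
  have m: "(\<Union>i. A i) \<in> sets M" using A by (auto simp: factor_sets_def)
  \<comment> \<open>Indicators of finite unions as polynomials in the indicators; the countable
    union is their bounded limit.\<close>
  define f :: "nat \<Rightarrow> 'x \<Rightarrow> complex" where
    "f n x = 1 + (-1) * (\<Prod>i<n. 1 + (-1) * indicator (A i) x)" for n x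
  have f_eq: "f n x = indicator (\<Union>i<n. A i) x" for n x
  proof (cases "\<exists>i<n. x \<in> A i")
    case True
    then obtain i where "i < n" "x \<in> A i" by blast
    then have "(\<Prod>i<n. 1 + (-1) * indicator (A i) x :: complex) = 0"
      by (intro prod_zero) (auto intro!: bexI[of _ i])
    then have "f n x = 1" unfolding f_def by (simp only: mult_zero_right add_0_right)
    then show ?thesis using True by (auto simp: indicator_def)
  qed (auto simp: f_def indicator_def)
  have "indicator (\<Union>i. A i) \<in> B"
  proof (rule B_limit[where fn = f and K = 1])
    show "f n \<in> B" for n
      unfolding f_def by (intro B_add B_mult B_const B_prod co A) auto
    show "AE x in M. cmod (f n x) \<le> 1" for n by (simp add: f_eq indicator_def)
    show "AE x in M. (\<lambda>n. f n x) \<longlonglongrightarrow> indicator (\<Union>i. A i) x"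
      unfolding f_eq by (intro AE_I2 LIMSEQ_indicator_UN)
  qed (use m in measurable)
  then show "(\<Union>i. A i) \<in> factor_sets" using m by (simp add: factor_sets_def)
qed

text \<open>A spectral projection obtained by iteration: rescale Re f - c into [-1, 1], iterate the
  cubic towards its sign, and combine signs into an indicator. Each iterate is a polynomial and so
  stays in \<open>B\<close>.\<close>

lemma superlevel_factor_sets:
  assumes f: "f \<in> B"
  shows "{x \<in> space M. c < Re (f x)} \<in> factor_sets"
proof -
  note [measurable] = Linf_measurable[OF B_Linf[OF f]]
  obtain K where K: "AE x in M. cmod (f x) \<le> K" using B_Linf[OF f] by (auto simp: Linf_def)
  \<comment> \<open>An essential bound for |Re f - c|, with 1 added so that division by it is
    safe.\<close>
  define K' where "K' = \<bar>K\<bar> + \<bar>c\<bar> + 1"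
  have K': "K' > 0" by (simp add: K'_def)
  define g0 where "g0 x = (Re (f x) - c) / K'" for x
  \<comment> \<open>The bound on \<open>f\<close> holds only almost everywhere; clipping makes it
    hold everywhere, changes the function on a null set only, and preserves the sign.\<close>
  define g where "g x = max (-1) (min 1 (g0 x))" for x
  have g_meas [measurable]: "g \<in> borel_measurable M" unfolding g_def g0_def by measurable
  have g_le: "\<bar>g x\<bar> \<le> 1" for x by (auto simp: g_def)
  have g_sgn: "0 < g x \<longleftrightarrow> c < Re (f x)" for x
  proof -
    have "0 < g0 x \<longleftrightarrow> c < Re (f x)" using K' by (simp add: g0_def zero_less_divide_iff)
    then show ?thesis by (auto simp: g_def max_def min_def)
  qed
  have "(\<lambda>x. of_real (1 / (2 * K')) * (f x + cnj (f x)) + of_real (- c / K')) \<in> B"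
    by (intro B_add B_mult B_const B_cnj f)
  then have gB: "(\<lambda>x. complex_of_real (g x)) \<in> B"
  proof (rule B_cong)
    show "AE x in M. of_real (1 / (2 * K')) * (f x + cnj (f x)) + of_real (- c / K') = complex_of_real (g x)"
      using K
    proof eventually_elim
      case (elim x)
      have "\<bar>Re (f x) - c\<bar> \<le> K'"
        using elim abs_Re_le_cmod[of "f x"] by (simp add: K'_def)
      then have "g x = g0 x" using K' by (auto simp: g_def g0_def field_simps abs_le_iff)
      then have "1 / (2 * K') * (2 * Re (f x)) + - c / K' = g x"
        using K' by (simp only: g0_def) (simp add: field_simps)
      then show ?case
        by (simp only: complex_add_cnj flip: of_real_mult of_real_add)
    qed
  qed measurable
  have it: "(\<lambda>x. complex_of_real ((sgn_step ^^ n) (g x))) \<in> B" for n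
  proof (induction n)
    case (Suc n)
    let ?s = "\<lambda>x. complex_of_real ((sgn_step ^^ n) (g x))"
    have "(\<lambda>x. (3/2) * ?s x + (-1/2) * (?s x * (?s x * ?s x))) \<in> B"
      by (intro B_add B_mult B_const Suc)
    also have "(\<lambda>x. (3/2) * ?s x + (-1/2) * (?s x * (?s x * ?s x))) =
        (\<lambda>x. complex_of_real ((sgn_step ^^ Suc n) (g x)))"
      by (simp add: sgn_step_def power3_eq_cube fun_eq_iff field_simps)
    finally show ?case .
  qed (use gB in simp)
  \<comment> \<open>The polynomial (s^2 + s)/2 sends the signs 1, 0, -1 to 1, 0, 0, which makes the
    inequality c < Re f strict in the limit.\<close>
  define u where "u n x = (1/2) * (complex_of_real ((sgn_step ^^ n) (g x)) * of_real ((sgn_step ^^ n) (g x)))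
    + (1/2) * complex_of_real ((sgn_step ^^ n) (g x))" for n x
  have "indicator {x \<in> space M. c < Re (f x)} \<in> B"
  proof (rule B_limit[where fn = u and K = 1])
    show "u n \<in> B" for n
      unfolding u_def by (intro B_add B_mult B_const it)
    show "AE x in M. cmod (u n x) \<le> 1" for n
    proof (rule AE_I2)
      fix x
      let ?s = "(sgn_step ^^ n) (g x)"
      have s: "\<bar>?s\<bar> \<le> 1" by (rule sgn_step_iterates_bound[OF g_le])
      have "cmod (u n x) \<le> (1/2) * (\<bar>?s\<bar> * \<bar>?s\<bar>) + (1/2) * \<bar>?s\<bar>"
        unfolding u_def by (rule order_trans[OF norm_triangle_ineq]) (simp add: norm_mult)
      also have "\<dots> \<le> (1/2) * (1 * 1) + (1/2) * 1"
        using s by (intro add_mono mult_mono) auto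
      finally show "cmod (u n x) \<le> 1" by simp
    qed
    show "AE x in M. (\<lambda>n. u n x) \<longlonglongrightarrow> indicator {x \<in> space M. c < Re (f x)} x"
    proof (rule AE_I2)
      fix x assume x: "x \<in> space M"
      have "(\<lambda>n. u n x) \<longlonglongrightarrow> (1/2) * (complex_of_real (sgn (g x)) * of_real (sgn (g x))) + (1/2) * complex_of_real (sgn (g x))"
        unfolding u_def by (intro tendsto_intros sgn_step_iterates g_le)
      moreover have "(1/2) * (complex_of_real (sgn (g x)) * of_real (sgn (g x))) + (1/2) * complex_of_real (sgn (g x)) =
          indicator {x \<in> space M. c < Re (f x)} x"
        using g_sgn[of x] x by (auto simp: sgn_real_def indicator_def)
      ultimately show "(\<lambda>n. u n x) \<longlonglongrightarrow> indicator {x \<in> space M. c < Re (f x)} x" by simp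
    qed
  qed measurable
  then show ?thesis by (simp add: factor_sets_def)
qed

section \<open>The factor\<close>

text \<open>Only a carrier for the \<sigma>-algebra, in the form that \<open>restr_to_subalg\<close>
  expects.\<close>

definition F :: "'x measure" where "F = sigma (space M) factor_sets"

text \<open>The points of the space are kept and only the \<sigma>-algebra shrinks, so the identity
  is the factor map and the action is unchanged.\<close>

definition Y :: "'x measure" where "Y = restr_to_subalg M F"

lemma sets_F: "sets F = factor_sets" and space_F: "space F = space M"
  using sigma_algebra.sigma_sets_eq[OF factor_sets_sigma_algebra] sigma_algebra_iff2[of "space M" factor_sets] factor_sets_sigma_algebra
  by (simp_all add: F_def)

lemma subalg: "subalgebra M F"
  by (auto simp: subalgebra_def sets_F space_F factor_sets_def)

lemma sets_Y: "sets Y = factor_sets" and space_Y: "space Y = space M"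
  by (simp_all add: Y_def sets_restr_to_subalg[OF subalg] sets_F space_restr_to_subalg)

lemma emeasure_Y: "A \<in> factor_sets \<Longrightarrow> emeasure Y A = emeasure M A"
  unfolding Y_def by (rule emeasure_restr_to_subalg[OF subalg]) (simp add: sets_F)

lemma B_measurable_Y:
  assumes f: "f \<in> B"
  shows "f \<in> borel_measurable Y"
proof -
  have "(\<lambda>x. Re (f x)) \<in> borel_measurable Y"
    unfolding borel_measurable_iff_greater sets_Y space_Y using superlevel_factor_sets[OF f] by blast
  \<comment> \<open>The imaginary part is the real part of -\<i> f, which lies in \<open>B\<close>
    again.\<close>
  moreover have "(\<lambda>x. Im (f x)) \<in> borel_measurable Y"
    unfolding borel_measurable_iff_greater sets_Y space_Y
    using superlevel_factor_sets[OF B_mult[OF B_const[of "- \<i>"] f]] by simp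
  ultimately show ?thesis by (simp add: borel_measurable_complex_iff)
qed

lemma measurable_YD: "f \<in> measurable Y K \<Longrightarrow> f \<in> measurable M K"
  unfolding Y_def by (rule measurable_from_subalg[OF subalg]) (metis measurable_cong_sets sets_restr_to_subalg[OF subalg])

lemma B_Linf_Y:
  assumes f: "f \<in> B"
  shows "f \<in> Linf Y"
proof -
  obtain K where K: "AE x in M. cmod (f x) \<le> K" using B_Linf[OF f] by (auto simp: Linf_def)
  have "f \<in> borel_measurable F"
    using B_measurable_Y[OF f] sets_restr_to_subalg[OF subalg] unfolding Y_def
    by (metis measurable_cong_sets)
  then have "(\<lambda>x. cmod (f x) \<le> K) \<in> measurable F (count_space UNIV)" by measurable
  from AE_restr_to_subalg2[OF subalg K this] show ?thesis
    using B_measurable_Y[OF f] by (auto simp: Linf_def Y_def)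
qed

text \<open>Simple functions over \<open>factor_sets\<close> are linear combinations of indicators
  in \<open>B\<close>, and bounded limits stay in \<open>B\<close>.\<close>

lemma Linf_Y_B:
  assumes f: "f \<in> Linf Y"
  shows "f \<in> B"
proof -
  have fY: "f \<in> borel_measurable Y" by (rule Linf_measurable[OF f])
  obtain K where "AE x in Y. cmod (f x) \<le> K" using f by (auto simp: Linf_def)
  then have K: "AE x in M. cmod (f x) \<le> K"
    unfolding Y_def by (rule AE_restr_to_subalg[OF subalg])
  obtain s where "\<forall>i. simple_function Y (s i)" "\<forall>x\<in>space Y. (\<lambda>i. s i x) \<longlonglongrightarrow> f x"
    "\<forall>i. \<forall>x\<in>space Y. dist (s i x) 0 \<le> 2 * dist (f x) 0"
    using borel_measurable_implies_sequence_metric[OF fY, of 0] by blast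
  then have s: "\<And>i. simple_function Y (s i)" "\<And>x. x \<in> space M \<Longrightarrow> (\<lambda>i. s i x) \<longlonglongrightarrow> f x"
    "\<And>i x. x \<in> space M \<Longrightarrow> cmod (s i x) \<le> 2 * cmod (f x)"
    by (auto simp: space_Y)
  show ?thesis
  \<comment> \<open>The factor 2 is the one in the domination of the approximating simple functions
    by \<open>f\<close>.\<close>
  proof (rule B_limit[where fn = s and K = "2 * K"])
    show "s i \<in> B" for i
    proof -
      have fin: "finite (s i ` space M)" using simple_functionD(1)[OF s(1), of i] by (simp add: space_Y)
      have lev: "s i -` {y} \<inter> space M \<in> factor_sets" for y
        using simple_functionD(2)[OF s(1), of i "{y}"] by (simp add: space_Y sets_Y)
      have "(\<lambda>x. \<Sum>y\<in>s i ` space M. y * indicator (s i -` {y} \<inter> space M) x) \<in> B"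
        using lev by (intro B_sum[OF fin] B_mult B_const) (auto simp: factor_sets_def)
      then show ?thesis
      proof (rule B_cong)
        show "s i \<in> borel_measurable M"
          by (intro measurable_YD borel_measurable_simple_function s)
        show "AE x in M. (\<Sum>y\<in>s i ` space M. y * indicator (s i -` {y} \<inter> space M) x) = s i x"
        proof (rule AE_I2)
          fix x assume x: "x \<in> space M"
          have "(\<Sum>y\<in>s i ` space M. y * indicator (s i -` {y} \<inter> space M) x) =
              (\<Sum>y\<in>s i ` space M. if y = s i x then y else 0)"
            using x by (intro sum.cong) (auto simp: indicator_def)
          then show "(\<Sum>y\<in>s i ` space M. y * indicator (s i -` {y} \<inter> space M) x) = s i x"
            using fin x by simp
        qed
      qed
    qed
    show "f \<in> borel_measurable M" by (rule measurable_YD[OF fY])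
    show "AE x in M. cmod (s i x) \<le> 2 * K" for i
      using K AE_space by eventually_elim (use s(3)[of _ i] in fastforce)
    show "AE x in M. (\<lambda>i. s i x) \<longlonglongrightarrow> f x"
      using s(2) by simp
  qed
qed

lemma act_measurable_Y:
  assumes g: "g \<in> carrier G"
  shows "\<alpha> g \<in> measurable Y Y"
proof (rule measurableI)
  fix A assume "A \<in> sets Y"
  then have A: "A \<in> sets M" "indicator A \<in> B" by (auto simp: sets_Y factor_sets_def)
  have m: "\<alpha> g -` A \<inter> space M \<in> sets M"
    using act_measurable[OF g] A(1) by (rule measurable_sets)
  have "indicator (\<alpha> g -` A \<inter> space M) \<in> B"
  proof (rule B_cong[OF B_act[OF A(2) g]])
    show "AE x in M. indicator A (\<alpha> g x) = (indicator (\<alpha> g -` A \<inter> space M) x :: complex)"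
      by (rule AE_I2) (auto simp: indicator_def)
  qed (use m in measurable)
  then show "\<alpha> g -` A \<inter> space Y \<in> sets Y"
    using m by (simp add: sets_Y space_Y factor_sets_def)
qed (use g in \<open>simp add: space_Y act_space\<close>)

lemma factor: "pmp_factor G M \<alpha> Y \<alpha> (\<lambda>x. x)"
  unfolding pmp_factor_def
proof (intro conjI ballI)
  have id: "(\<lambda>x. x) \<in> measurable M Y"
    by (rule measurable_YD) simp
  then show "(\<lambda>x. x) \<in> measurable M Y" .
  show "distr M Y (\<lambda>x. x) = Y"
  proof (rule measure_eqI)
    fix A assume "A \<in> sets (distr M Y (\<lambda>x. x))"
    then have A: "A \<in> factor_sets" by (simp add: sets_Y)
    then have "A \<subseteq> space M" using sets.sets_into_space by (auto simp: factor_sets_def)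
    then show "emeasure (distr M Y (\<lambda>x. x)) A = emeasure Y A"
      using A by (simp add: emeasure_distr[OF id] sets_Y emeasure_Y Int_absorb2)
  qed simp
  show "pmp_action G Y \<alpha>"
    unfolding pmp_action_def
  proof (intro conjI ballI)
    show "prob_space Y" unfolding Y_def by (rule prob_space_restr_to_subalg[OF subalg prob_space_axioms])
    show "group_action G (space Y) \<alpha>" using pmp by (simp add: pmp_action_def space_Y)
    fix g assume g: "g \<in> carrier G"
    show gY: "\<alpha> g \<in> measurable Y Y" by (rule act_measurable_Y[OF g])
    show "distr Y Y (\<alpha> g) = Y"
    proof (rule measure_eqI)
      fix A assume "A \<in> sets (distr Y Y (\<alpha> g))"
      then have A: "A \<in> sets Y" by simp
      have "\<alpha> g -` A \<inter> space Y \<in> sets Y" using gY A by (rule measurable_sets)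
      then have "emeasure (distr Y Y (\<alpha> g)) A = emeasure M (\<alpha> g -` A \<inter> space M)"
        using A by (simp add: emeasure_distr[OF gY] sets_Y emeasure_Y space_Y)
      also have "\<dots> = emeasure (distr M M (\<alpha> g)) A"
        using A g by (intro emeasure_distr[symmetric]) (auto simp: sets_Y factor_sets_def)
      also have "\<dots> = emeasure Y A" using A g by (simp add: act_distr emeasure_Y sets_Y)
      finally show "emeasure (distr Y Y (\<alpha> g)) A = emeasure Y A" .
    qed simp
  qed
qed simp

lemma eq_factor_crossed_product:
  assumes H: "subgroup H G" and icc: "strong_relative_icc G H" and triv: "\<And>h. h \<in> H \<Longrightarrow> AE x in M. \<alpha> h x = x"
  shows "P = factor_crossed_product G M \<alpha> Y (\<lambda>x. x)"
proof
  let ?gen = "m_op ` ((\<lambda>f. f \<circ> (\<lambda>x. x)) ` Linf Y) \<union> U ` carrier G"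
  show "factor_crossed_product G M \<alpha> Y (\<lambda>x. x) \<subseteq> P"
    unfolding factor_crossed_product_def
    by (intro vn_generated_subset P) (use Linf_Y_B UP in \<open>auto simp: B_def comp_def\<close>)
  show "P \<subseteq> factor_crossed_product G M \<alpha> Y (\<lambda>x. x)"
    unfolding factor_crossed_product_def vn_generated_def
  proof (intro subsetI InterI)
    fix a Q assume a: "a \<in> P" and "Q \<in> {Q. von_neumann_algebra N Q \<and> ?gen \<subseteq> Q}"
    then have Q: "von_neumann_algebra N Q" and gen: "?gen \<subseteq> Q" by auto
    have aC: "a \<in> right_commutant" using a PC by blast
    obtain \<xi> where \<xi>: "\<xi> \<in> l2_fun N" "a \<Omega> = l2_cls N \<xi>"
      using bounded_ops_closed[OF right_commutant_bounded[OF aC] Omega_L2] by (rule L2E)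
    have coeff: "(\<lambda>x. \<xi> (x, g)) \<in> B" if g: "g \<in> carrier G" for g
    proof -
      have b: "compose (L2 N) a (U (inv g)) \<in> P"
        using g by (intro von_neumann_algebra_compose[OF P] a UP) simp
      then have bC: "compose (L2 N) a (U (inv g)) \<in> right_commutant" using PC by blast
      note sh = coefficient_shift[OF aC \<xi> g]
      show ?thesis
        using unit_coefficient_mem[OF P PC UP H icc triv b sh] coefficient_Linf[OF bC sh] g
        by (simp add: B_def)
    qed
    \<comment> \<open>\<open>Q\<close> is any von Neumann algebra containing the generators; the
      intersection supplies the commutation with right multiplications that the Fourier argument
      requires.\<close>
    have "a \<in> Q \<inter> right_commutant"
    proof (rule mem_if_coefficients_mem[OF von_neumann_algebra_Int[OF Q right_commutant_vna] _ _ aC \<xi>])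
      fix g assume g: "g \<in> carrier G"
      show "U g \<in> Q \<inter> right_commutant" using gen U_right_commutant[OF g] g by blast
      show "(\<lambda>x. \<xi> (x, g)) \<in> Linf M" by (rule B_Linf[OF coeff[OF g]])
      have "(\<lambda>x. \<xi> (x, g)) \<circ> (\<lambda>x. x) = (\<lambda>x. \<xi> (x, g))" by auto
      then have "m_op (\<lambda>x. \<xi> (x, g)) \<in> ?gen"
        using B_Linf_Y[OF coeff[OF g]] by (metis UnI1 imageI)
      then show "m_op (\<lambda>x. \<xi> (x, g)) \<in> Q \<inter> right_commutant"
        using gen m_op_right_commutant[OF B_Linf[OF coeff[OF g]]] by blast
    qed auto
    then show "a \<in> Q" by blast
  qed
qed

end

theorem theorem3p7:
  fixes G :: "('g, 'b) monoid_scheme"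
    and H :: "'g set"
    and M :: "'x measure"
    and \<alpha> :: "'g \<Rightarrow> 'x \<Rightarrow> 'x"
    and P :: "('x \<times> 'g) l2_op set"
  assumes "group G" and "countable (carrier G)"
    and "pmp_action G M \<alpha>" and "ergodic_action G M \<alpha>"
    and "subgroup H G" and "strong_relative_icc G H"
    and "\<forall>h\<in>H. AE x in M. \<alpha> h x = x"
    and "von_neumann_algebra (cp_space G M) P"
    and "group_vn_algebra G M \<alpha> \<subseteq> P" and "P \<subseteq> crossed_product G M \<alpha>"
  shows "\<exists>(Y :: 'x measure) \<beta> \<pi>.
           pmp_factor G M \<alpha> Y \<beta> \<pi> \<and> P = factor_crossed_product G M \<alpha> Y \<pi>"
proof -
  interpret pmp_setting G M \<alpha>
    by (intro pmp_setting.intro assms)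
  interpret intermediate_algebra G M \<alpha> P
  proof unfold_locales
    show "von_neumann_algebra N P" by fact
    show "P \<subseteq> right_commutant" using assms(10) crossed_product_right_commutant by blast
    show "U g \<in> P" if "g \<in> carrier G" for g
      using assms(9) that subset_vn_generated[of "U ` carrier G" N] unfolding group_vn_algebra_def by blast
  qed
  show ?thesis
    using factor eq_factor_crossed_product[OF assms(5,6)] assms(7) by blast
qed

end
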